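(* Let $(J^s)_{s\in(1/2,1)}$ satisfy Hypothesis (H1) below and let $k\in(0,1)$. For all $t>0$ and $R_1,R_2>0$ there exists a constant $\alpha>0$, independent of $\varepsilon\in(0,1]$ and $s\in(1/2,1)$, such that for every probability density $u_0\in L^1_k$, the solution $u$ of $$\partial_tu=\frac{1}{\varepsilon^{2s}}(J^s_\varepsilon*u-u)+\mathrm{div}(xu),\qquad u(0)=u_0,$$ satisfies $$u(t,x)\ge\alpha\int_{B_{R_2}}u_0\quad\text{for all }x\in B_{R_1}.$$
   Context: $\langle x\rangle=(1+|x|^2)^{1/2}$; $L^1_k$ the space of $f$ with $\int\langle x\rangle^k|f|<\infty$; $B_R$ the ball of radius $R$ centered at $0$; $J^s_\varepsilon(x)=\varepsilon^{-d}J^s(x/\varepsilon)$; $\hat f(\xi)=\int e^{-ix\cdot\xi}f$. Solutions are mild solutions in $C([0,\infty);L^1_k)$. Hypothesis (H1): $(J^s)_{s\in(1/2,1)}$ is a family of probability densities on $\mathbb{R}^d$ with $J^s\in L^1\cap L^p$ for some $p\in(1,\infty]$, such that (i) $\int\min\{1,|y|^2\}J^s<\infty$; (ii) there exist $\delta,C_0>0$ independent of $s$ with $\hat J^s(\xi)=1-|\xi|^{2s}+R_s(\xi)$, $|R_s(\xi)|\le C_0|\xi|^{2s+\delta}$ for $|\xi|\le1$; (iii) there exist $C,R>0$, $\Psi\in L^1_2$ with $\int x\Psi=0$, independent of $s$, with $J^s(x)\le C(1-s)|x|^{-d-2s}+\Psi(x)$ for $|x|\ge R$. *)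

theory Defs
  imports "HOL-Analysis.Analysis"
begin

definition jbr :: "'a::euclidean_space \<Rightarrow> real" where
  "jbr x = sqrt (1 + (norm x)\<^sup>2)"

definition in_L1k :: "real \<Rightarrow> ('a::euclidean_space \<Rightarrow> real) \<Rightarrow> bool" where
  "in_L1k k f \<longleftrightarrow> f \<in> borel_measurable lborel \<and>
     integrable lborel (\<lambda>x. jbr x powr k * \<bar>f x\<bar>)"

definition dist_L1k :: "real \<Rightarrow> ('a::euclidean_space \<Rightarrow> real) \<Rightarrow> ('a \<Rightarrow> real) \<Rightarrow> real" where
  "dist_L1k k f g = (\<integral>x. jbr x powr k * \<bar>f x - g x\<bar> \<partial>lborel)"

definition prob_density :: "('a::euclidean_space \<Rightarrow> real) \<Rightarrow> bool" where
  "prob_density f \<longleftrightarrow> f \<in> borel_measurable lborel \<and> (\<forall>x. 0 \<le> f x) \<and>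
     integrable lborel f \<and> (\<integral>x. f x \<partial>lborel) = 1"

definition fourier :: "('a::euclidean_space \<Rightarrow> real) \<Rightarrow> 'a \<Rightarrow> complex" where
  "fourier f \<xi> = (\<integral>x. cis (- (x \<bullet> \<xi>)) * complex_of_real (f x) \<partial>lborel)"

definition in_some_Lp :: "('a::euclidean_space \<Rightarrow> real) \<Rightarrow> bool" where
  "in_some_Lp f \<longleftrightarrow>
     (\<exists>p>1. integrable lborel (\<lambda>x. \<bar>f x\<bar> powr p)) \<or>
     (\<exists>M. AE x in lborel. \<bar>f x\<bar> \<le> M)"

definition H1 :: "(real \<Rightarrow> 'a::euclidean_space \<Rightarrow> real) \<Rightarrow> bool" where
  "H1 J \<longleftrightarrow>
    (\<forall>s\<in>{1/2<..<1}. prob_density (J s) \<and> in_some_Lp (J s) \<and>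
        integrable lborel (\<lambda>y. min 1 ((norm y)\<^sup>2) * J s y)) \<and>
    (\<exists>\<delta>>0. \<exists>C0>0. \<forall>s\<in>{1/2<..<1}. \<forall>\<xi>::'a. norm \<xi> \<le> 1 \<longrightarrow>
        cmod (fourier (J s) \<xi> - complex_of_real (1 - norm \<xi> powr (2 * s)))
          \<le> C0 * norm \<xi> powr (2 * s + \<delta>)) \<and>
    (\<exists>C>0. \<exists>R>0. \<exists>\<Psi>::'a \<Rightarrow> real.
        \<Psi> \<in> borel_measurable lborel \<and>
        integrable lborel (\<lambda>x. (jbr x)\<^sup>2 * \<bar>\<Psi> x\<bar>) \<and>
        (\<integral>x. \<Psi> x *\<^sub>R x \<partial>lborel) = 0 \<and>
        (\<forall>s\<in>{1/2<..<1}. \<forall>x. norm x \<ge> R \<longrightarrow>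
            J s x \<le> C * (1 - s) * norm x powr (- real DIM('a) - 2 * s) + \<Psi> x))"

definition rescale :: "real \<Rightarrow> ('a::euclidean_space \<Rightarrow> real) \<Rightarrow> 'a \<Rightarrow> real" where
  "rescale \<epsilon> J x = \<epsilon> powr (- real DIM('a)) * J (x /\<^sub>R \<epsilon>)"

definition conv :: "('a::euclidean_space \<Rightarrow> real) \<Rightarrow> ('a \<Rightarrow> real) \<Rightarrow> 'a \<Rightarrow> real" where
  "conv f g x = (\<integral>y. f (x - y) * g y \<partial>lborel)"

text \<open>Mild solution in \<open>C([0,\<infinity>); L^1_k)\<close> of
  \<open>\<partial>_t u = \<epsilon>^{-2s}(J^s_\<epsilon> * u - u) + div(x u)\<close>, \<open>u(0)=u0\<close>.
  With \<open>c = \<epsilon>^{-2s}\<close> and the transport semigroup \<open>(S_t f)(x) = e^{d t} f(e^t x)\<close>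
  generated by \<open>f \<mapsto> div(x f)\<close>, the Duhamel formula reads
  \<open>u(t) = e^{-ct} S_t u0 + \<integral>_0^t e^{-c(t-\<tau>)} S_{t-\<tau>}(c J_\<epsilon> * u(\<tau>)) d\<tau>\<close>.\<close>
definition mild_solution ::
  "real \<Rightarrow> real \<Rightarrow> real \<Rightarrow> ('a::euclidean_space \<Rightarrow> real) \<Rightarrow> ('a \<Rightarrow> real)
     \<Rightarrow> (real \<Rightarrow> 'a \<Rightarrow> real) \<Rightarrow> bool" where
  "mild_solution k \<epsilon> s J u0 u \<longleftrightarrow>
    (let c = \<epsilon> powr (- 2 * s); d = real DIM('a); K = rescale \<epsilon> J;
         integrand = (\<lambda>t x \<tau>. exp (- c * (t - \<tau>)) * exp (d * (t - \<tau>)) *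
                        (c * conv K (u \<tau>) (exp (t - \<tau>) *\<^sub>R x)))
     in (\<forall>t\<ge>0. in_L1k k (u t)) \<and>
        (\<forall>t0\<ge>0. ((\<lambda>t. dist_L1k k (u t) (u t0)) \<longlongrightarrow> 0) (at t0 within {0..})) \<and>
        (\<forall>t\<ge>0. AE x in lborel.
            set_integrable lborel {0..t} (integrand t x) \<and>
            u t x = exp (- c * t) * exp (d * t) * u0 (exp t *\<^sub>R x)
                    + (\<integral>\<tau>\<in>{0..t}. integrand t x \<tau> \<partial>lborel)))"

end

theory Submission
  imports Defs "HOL-Real_Asymp.Real_Asymp" "HOL-Probability.Probability" "HOL-Complex_Analysis.Complex_Analysis"
begin

text \<open>The equation is linear and its mild solution is explicit on the Fourier side: \<open>u t\<close> is the rescaled datum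
  convolved with the compound Poisson law of transform \<open>exp (c (m (\<epsilon> \<xi>) - t))\<close>, where \<open>c = \<epsilon> powr (- 2 s)\<close> and
  \<open>m\<close> is the transform of the jump measure averaged over the jump time. It therefore suffices to bound the
  density of this law from below on a ball, uniformly in \<open>\<epsilon>\<close> and \<open>s\<close>.

  The \<open>L\<^sup>p\<close> bounds on \<open>J s\<close> are not uniform in \<open>s\<close>, so they cannot provide the regularity needed. It comes
  from the randomness of the jump times instead: finitely many jumps, in directions that
  span the space quantitatively, already have an integrable transform. The expansion of the symbol
  near \<open>0\<close> alone shows that such jumps have a probability bounded below.

  Spending a bounded number of jumps on smoothing, the remaining ones obey a local limit theorem with
  an explicit uniform error, the limit being the stable density with symbol \<open>\<bar>\<xi>\<bar> powr (2 s)\<close>. That density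
  is nonnegative as a limit, strictly positive by analyticity, and hence bounded below on compact sets,
  uniformly for \<open>s\<close> in the closed interval \<open>[1/2, 1]\<close>. If \<open>\<epsilon>\<close> is small, the number of jumps is large by
  itself; otherwise the law is bounded below by the contribution of a large but bounded number of jumps.\<close>

section \<open>Gaussians and integrability on Euclidean space\<close>

text \<open>A jump made \<tau> time units before the end is contracted by the drift to
  \<open>exp (- \<tau>) y\<close>. Averaging over \<tau> therefore smooths even a jump of fixed
  size: the phase \<open>exp (- \<tau>) (\<xi> \<bullet> y)\<close> has no stationary point, so the
  average decays like the inverse of \<open>\<bar>\<xi> \<bullet> y\<bar>\<close>. The gain is in
  the direction of y only, hence jumps along a net of directions; it is a single power, hence
  \<open>2 * DIM('a)\<close> rounds of such jumps.

  The expansion gives no direct lower bound on \<open>Re (1 - K \<xi>)\<close> away from 0, where K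
  is the transform of the kernel. Replacing 1 - cos w by the truncated square
  \<open>min 1 (w^2)\<close> yields a quantity that grows along rays, so that its size near 0
  controls it everywhere. The averaged phase is coercive with respect to the same truncation, and
  the slab probabilities come from it as well.

  Uniformity in s rests on 1/2 \<le> s \<le> 1: powers with exponent \<open>2 * s\<close> are
  compared with first and second powers, and the limit law depends continuously on s up to both
  endpoints.\<close>

lemma
  fixes f :: "'a::euclidean_space \<Rightarrow> 'b::{banach, second_countable_topology}"
  assumes c: "c \<noteq> 0" and f: "f \<in> borel_measurable borel"
  shows integral_lborel_affine: "(\<integral>x. f (t + c *\<^sub>R x) \<partial>lborel) = (1 / \<bar>c\<bar> ^ DIM('a)) *\<^sub>R (\<integral>x. f x \<partial>lborel)"
    and integrable_lborel_affine_iff: "integrable lborel (\<lambda>x. f (t + c *\<^sub>R x)) \<longleftrightarrow> integrable lborel f"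
proof -
  have eq: "lborel = density (distr lborel borel (\<lambda>x. t + c *\<^sub>R x)) (\<lambda>_. ennreal (\<bar>c\<bar> ^ DIM('a)))"
    using lborel_affine[OF c, of t] by simp
  have "(\<integral>x. f x \<partial>lborel) = \<bar>c\<bar> ^ DIM('a) *\<^sub>R (\<integral>x. f (t + c *\<^sub>R x) \<partial>lborel)"
    using f by (subst eq) (simp add: integral_density integral_distr)
  then show "(\<integral>x. f (t + c *\<^sub>R x) \<partial>lborel) = (1 / \<bar>c\<bar> ^ DIM('a)) *\<^sub>R (\<integral>x. f x \<partial>lborel)"
    using c by simp
  have "integrable lborel f \<longleftrightarrow> integrable lborel (\<lambda>x. \<bar>c\<bar> ^ DIM('a) *\<^sub>R f (t + c *\<^sub>R x))"
    using f by (subst eq) (simp add: integrable_density integrable_distr_eq)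
  then show "integrable lborel (\<lambda>x. f (t + c *\<^sub>R x)) \<longleftrightarrow> integrable lborel f"
    using c integrable_scaleR_right[of "\<bar>c\<bar> ^ DIM('a)" lborel "\<lambda>x. f (t + c *\<^sub>R x)"]
      integrable_scaleR_right[of "1 / \<bar>c\<bar> ^ DIM('a)" lborel "\<lambda>x. \<bar>c\<bar> ^ DIM('a) *\<^sub>R f (t + c *\<^sub>R x)"] by auto
qed

lemma borel_measurable_cis [measurable (raw)]:
  assumes "f \<in> borel_measurable M"
  shows "(\<lambda>x. cis (f x)) \<in> borel_measurable M"
  using borel_measurable_continuous_onI[OF continuous_on_cis[OF continuous_on_id]] assms
  by (rule measurable_compose_rev)

lemma integral_lborel_reflect:
  fixes f :: "'a::euclidean_space \<Rightarrow> 'b::{banach, second_countable_topology}"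
  assumes f: "f \<in> borel_measurable borel"
  shows "(\<integral>x. f (t - x) \<partial>lborel) = (\<integral>x. f x \<partial>lborel)"
  using integral_lborel_affine[of "-1" f t] f by simp

text \<open>Reduces integrals over the Euclidean space to one-dimensional ones. The integrable
  majorants and the Gaussian transform below are built from factors in the single
  coordinates.\<close>

lemma
  fixes f :: "'a::euclidean_space \<Rightarrow> real \<Rightarrow> 'b::{real_normed_field, banach, second_countable_topology}"
  assumes "\<And>b. b \<in> Basis \<Longrightarrow> integrable lborel (f b)"
  shows integrable_lborel_prod: "integrable lborel (\<lambda>x::'a. \<Prod>b\<in>Basis. f b (x \<bullet> b))"
    and integral_lborel_prod: "(\<integral>(x::'a). (\<Prod>b\<in>Basis. f b (x \<bullet> b)) \<partial>lborel) = (\<Prod>b\<in>Basis. (\<integral>y. f b y \<partial>lborel))"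
proof -
  interpret product_sigma_finite "\<lambda>b::'a. lborel :: real measure" ..
  have [measurable]: "f b \<in> borel_measurable borel" if "b \<in> Basis" for b
    using assms[OF that] by auto
  have comp: "(\<lambda>g. \<Prod>b\<in>Basis. f b ((\<Sum>b\<in>Basis. g b *\<^sub>R b) \<bullet> b)) = (\<lambda>g. \<Prod>b\<in>Basis. f b (g b))"
    by (simp add: fun_eq_iff inner_sum_left inner_Basis if_distrib cong: if_cong prod.cong)
  have m1: "(\<lambda>x::'a. \<Prod>b\<in>Basis. f b (x \<bullet> b)) \<in> borel_measurable borel"
    by measurable
  have m2: "(\<lambda>g. \<Sum>b\<in>Basis. g b *\<^sub>R b) \<in> measurable (\<Pi>\<^sub>M b\<in>(Basis::'a set). lborel) borel"
    by measurable
  show "integrable lborel (\<lambda>x::'a. \<Prod>b\<in>Basis. f b (x \<bullet> b))"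
    unfolding lborel_eq[where 'a='a] integrable_distr_eq[OF m2 m1] comp
    using assms by (intro product_integrable_prod) auto
  show "(\<integral>(x::'a). (\<Prod>b\<in>Basis. f b (x \<bullet> b)) \<partial>lborel) = (\<Prod>b\<in>Basis. (\<integral>y. f b y \<partial>lborel))"
    unfolding lborel_eq[where 'a='a] integral_distr[OF m2 m1] comp
    using assms by (intro product_integral_prod) auto
qed

section \<open>Integrable majorants with exponential and polynomial decay\<close>

lemma integrable_exp_abs:
  assumes "0 < c"
  shows "integrable lborel (\<lambda>x::real. exp (- (c * \<bar>x\<bar>)))"
proof -
  have 1: "set_integrable lborel {0<..} (\<lambda>x::real. exp (- (x * c)))"
    using integrable_I0i_exp_mscale[OF assms] by simp
  have 2: "integrable lborel (\<lambda>x::real. indicator {0<..} x *\<^sub>R exp (- (x * c)))"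
    using 1 unfolding set_integrable_def .
  have 3: "integrable lborel (\<lambda>x::real. indicator {0<..} (0 + (-1) *\<^sub>R x) *\<^sub>R exp (- ((0 + (-1) *\<^sub>R x) * c)))"
    by (subst integrable_lborel_affine_iff[where f="\<lambda>x::real. indicator {0<..} x *\<^sub>R exp (- (x * c))"]) (use 2 in auto)
  have "integrable lborel (\<lambda>x::real. indicator {0<..} x *\<^sub>R exp (- (x * c)) + indicator {0<..} (0 + (-1) *\<^sub>R x) *\<^sub>R exp (- ((0 + (-1) *\<^sub>R x) * c)))"
    using 2 3 by (rule Bochner_Integration.integrable_add)
  moreover have "AE x in lborel. (indicator {0<..} x *\<^sub>R exp (- (x * c)) + indicator {0<..} (0 + (-1) *\<^sub>R x) *\<^sub>R exp (- ((0 + (-1) *\<^sub>R x) * c))) = exp (- (c * \<bar>x\<bar>))"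
    using AE_lborel_singleton[of "0::real"]
    by eventually_elim (auto simp: indicator_def mult.commute)
  ultimately show ?thesis
    by (subst integrable_cong_AE[THEN iffD1]) auto
qed

lemma integrable_exp_norm:
  assumes "0 < c"
  shows "integrable lborel (\<lambda>x::'a::euclidean_space. exp (- (c * norm x)))"
proof -
  \<comment> \<open>Every coordinate is at most the norm in modulus, so \<open>DIM('a)\<close>
    factors with this rate together decay no faster than the rate \<open>c\<close> in the
    norm.\<close>
  define c' where "c' = c / DIM('a)"
  have c': "c' > 0" using assms by (simp add: c'_def)
  have "integrable lborel (\<lambda>x::'a. \<Prod>b\<in>Basis. exp (- (c' * \<bar>x \<bullet> b\<bar>)))"
    using integrable_exp_abs[OF c'] by (intro integrable_lborel_prod)
  then show ?thesis
  proof (rule Bochner_Integration.integrable_bound)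
    show "AE x::'a in lborel. norm (exp (- (c * norm x))) \<le> norm (\<Prod>b\<in>Basis. exp (- (c' * \<bar>x \<bullet> b\<bar>)))"
    proof (rule AE_I2)
      fix x :: 'a
      have "(\<Sum>b\<in>Basis. c' * \<bar>x \<bullet> b\<bar>) \<le> (\<Sum>b\<in>(Basis::'a set). c' * norm x)"
        using c' by (intro sum_mono mult_left_mono Basis_le_norm) auto
      also have "\<dots> = c * norm x" by (simp add: c'_def)
      finally show "norm (exp (- (c * norm x))) \<le> norm (\<Prod>b\<in>Basis. exp (- (c' * \<bar>x \<bullet> b\<bar>)))"
        by (simp add: exp_sum[symmetric] sum_negf)
    qed
  qed simp
qed

lemma power_mult_exp_bound:
  fixes r c :: real
  assumes "0 < c"
  shows "\<exists>K>0. \<forall>r\<ge>0. (1 + r) ^ n * exp (- (c * r)) \<le> K * exp (- (c / 2 * r))"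
proof -
  have l: "((\<lambda>r::real. (1 + r) ^ n * exp (- (c / 2 * r))) \<longlongrightarrow> 0) at_top"
    using assms by real_asymp
  then have "eventually (\<lambda>r::real. (1 + r) ^ n * exp (- (c / 2 * r)) < 1) at_top"
    by (rule order_tendstoD) simp
  then obtain B where B: "\<And>r. r \<ge> B \<Longrightarrow> (1 + r) ^ n * exp (- (c / 2 * r)) < 1"
    by (auto simp: eventually_at_top_linorder)
  define B' where "B' = max B 0"
  have le: "(1 + r) ^ n * exp (- (c / 2 * r)) \<le> (1 + B') ^ n + 1" if "r \<ge> 0" for r
  proof (cases "r \<ge> B")
    case True
    then show ?thesis using B[of r] B'_def
      by (smt (verit) zero_le_power)
  next
    case False
    then have "(1 + r) ^ n * exp (- (c / 2 * r)) \<le> (1 + B') ^ n * 1"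
      using that assms B'_def by (intro mult_mono power_mono) auto
    then show ?thesis by simp
  qed
  show ?thesis
  proof (intro exI conjI allI impI)
    show "0 < (1 + B') ^ n + 1" by (simp add: B'_def add_pos_nonneg add_nonneg_pos)
    fix r :: real assume r: "r \<ge> 0"
    have "exp (- (c * r)) = exp (- (c / 2 * r)) * exp (- (c / 2 * r))"
      by (simp add: exp_add[symmetric])
    then have "(1 + r) ^ n * exp (- (c * r)) = ((1 + r) ^ n * exp (- (c / 2 * r))) * exp (- (c / 2 * r))"
      by simp
    also have "\<dots> \<le> ((1 + B') ^ n + 1) * exp (- (c / 2 * r))"
      using le[OF r] by (intro mult_right_mono) auto
    finally show "(1 + r) ^ n * exp (- (c * r)) \<le> ((1 + B') ^ n + 1) * exp (- (c / 2 * r))" .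
  qed
qed

lemma integrable_power_exp_norm:
  assumes "0 < c"
  shows "integrable lborel (\<lambda>x::'a::euclidean_space. (1 + norm x) ^ n * exp (- (c * norm x)))"
proof -
  obtain K where K: "K > 0" "\<And>r. r \<ge> 0 \<Longrightarrow> (1 + r) ^ n * exp (- (c * r)) \<le> K * exp (- (c / 2 * r))"
    using power_mult_exp_bound[OF assms] by blast
  have "integrable lborel (\<lambda>x::'a. K * exp (- (c / 2 * norm x)))"
    using assms by (intro integrable_mult_right integrable_exp_norm) simp
  then show ?thesis
    by (rule Bochner_Integration.integrable_bound) (use K in \<open>auto simp: abs_mult\<close>)
qed

lemma integrable_inverse_quadratic: "integrable lborel (\<lambda>x::real. 1 / (1 + \<bar>x\<bar>)\<^sup>2)"
proof -
  have h: "set_integrable lborel {0..} (\<lambda>x::real. 1 / (1 + x)\<^sup>2)"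
    unfolding set_integrable_def
  proof (rule integrableI_nonneg)
    have "(\<integral>\<^sup>+ x. ennreal (1 / (1 + x)\<^sup>2) * indicator {0..} x \<partial>lborel) = ennreal (0 - (- 1 / (1 + 0)))"
    proof (rule nn_integral_FTC_atLeast)
      show "((\<lambda>x::real. - 1 / (1 + x)) \<longlongrightarrow> 0) at_top" by real_asymp
      show "DERIV (\<lambda>x. - 1 / (1 + x)) x :> 1 / (1 + x)\<^sup>2" if "0 \<le> x" for x :: real
        using that by (auto intro!: derivative_eq_intros simp: power2_eq_square)
    qed auto
    moreover have "(\<integral>\<^sup>+ x. ennreal (indicat_real {0..} x *\<^sub>R (1 / (1 + x)\<^sup>2)) \<partial>lborel) = (\<integral>\<^sup>+ x. ennreal (1 / (1 + x)\<^sup>2) * indicator {0..} x \<partial>lborel)"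
      by (intro nn_integral_cong) (auto simp: indicator_def)
    ultimately show "(\<integral>\<^sup>+ x. ennreal (indicat_real {0..} x *\<^sub>R (1 / (1 + x)\<^sup>2)) \<partial>lborel) < \<infinity>" by simp
  qed (auto simp: indicator_def)
  have 2: "integrable lborel (\<lambda>x::real. indicator {0..} x *\<^sub>R (1 / (1 + x)\<^sup>2))"
    using h unfolding set_integrable_def .
  have 3: "integrable lborel (\<lambda>x::real. indicator {0..} (0 + (-1) *\<^sub>R x) *\<^sub>R (1 / (1 + (0 + (-1) *\<^sub>R x))\<^sup>2))"
    by (subst integrable_lborel_affine_iff[where f="\<lambda>x::real. indicator {0..} x *\<^sub>R (1 / (1 + x)\<^sup>2)"]) (use 2 in auto)
  have "integrable lborel (\<lambda>x::real. indicator {0..} x *\<^sub>R (1 / (1 + x)\<^sup>2) + indicator {0..} (0 + (-1) *\<^sub>R x) *\<^sub>R (1 / (1 + (0 + (-1) *\<^sub>R x))\<^sup>2))"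
    using 2 3 by (rule Bochner_Integration.integrable_add)
  then show ?thesis
    by (rule Bochner_Integration.integrable_bound) (auto simp: indicator_def)
qed

text \<open>The exponent is not optimal, but it splits into one factor
  \<open>1 / (1 + \<bar>x \<bullet> b\<bar>)^2\<close> per coordinate. It is the origin of the power
  \<open>2 * DIM('a)\<close> in \<open>slabs\<close>.\<close>

lemma integrable_inverse_power_norm:
  "integrable lborel (\<lambda>x::'a::euclidean_space. 1 / (1 + norm x) ^ (2 * DIM('a)))"
proof -
  have "integrable lborel (\<lambda>x::'a. \<Prod>b\<in>Basis. 1 / (1 + \<bar>x \<bullet> b\<bar>)\<^sup>2)"
    using integrable_inverse_quadratic by (intro integrable_lborel_prod)
  then show ?thesis
  proof (rule Bochner_Integration.integrable_bound)
    show "AE x::'a in lborel. norm (1 / (1 + norm x) ^ (2 * DIM('a))) \<le> norm (\<Prod>b\<in>Basis. 1 / (1 + \<bar>x \<bullet> b\<bar>)\<^sup>2)"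
    proof (rule AE_I2)
      fix x :: 'a
      have "1 / (1 + norm x) ^ (2 * DIM('a)) = (\<Prod>b\<in>(Basis::'a set). 1 / (1 + norm x)\<^sup>2)"
        by (simp add: power_mult power_one_over)
      also have "\<dots> \<le> (\<Prod>b\<in>Basis. 1 / (1 + \<bar>x \<bullet> b\<bar>)\<^sup>2)"
        by (intro prod_mono conjI frac_le power_mono add_left_mono Basis_le_norm)
           (auto intro!: zero_less_power add_pos_nonneg)
      finally show "norm (1 / (1 + norm x) ^ (2 * DIM('a))) \<le> norm (\<Prod>b\<in>Basis. 1 / (1 + \<bar>x \<bullet> b\<bar>)\<^sup>2)"
        by (simp add: abs_prod abs_power_minus)
    qed
  qed simp
qed

text \<open>The characteristic function of the centred normal law of standard deviation \<sigma>,
  whose density is \<open>heat \<sigma>\<close> below. It tends to 1 as \<sigma> \<rightarrow> 0,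
  which makes it the cutoff in frequency throughout.\<close>

definition gauss :: "real \<Rightarrow> 'a::euclidean_space \<Rightarrow> real" where
  "gauss \<sigma> x = exp (- (\<sigma>\<^sup>2 * (norm x)\<^sup>2 / 2))"

text \<open>The substitution of \<open>\<sigma> * y\<close> for \<open>y\<close> reduces this to the
  known characteristic function of the standard normal law.\<close>

lemma
  assumes "0 < \<sigma>"
  shows integrable_gauss_real: "integrable lborel (\<lambda>y::real. complex_of_real (exp (- (\<sigma>\<^sup>2 * y\<^sup>2 / 2))) * cis (v * y))"
    and integral_gauss_real: "(\<integral>y. complex_of_real (exp (- (\<sigma>\<^sup>2 * y\<^sup>2 / 2))) * cis (v * y) \<partial>lborel) = sqrt (2 * pi) / \<sigma> * exp (- (v\<^sup>2 / (2 * \<sigma>\<^sup>2)))"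
proof -
  let ?f = "\<lambda>v y::real. complex_of_real (exp (- (y\<^sup>2 / 2))) * cis (v * y)"
  have eq: "?f v y = complex_of_real (sqrt (2 * pi)) * (std_normal_density y *\<^sub>R cis (v * y))" for v y
    by (simp add: std_normal_density_def scaleR_conv_of_real)
  have int: "integrable lborel (\<lambda>y. std_normal_density y *\<^sub>R cis (v * y))" for v
  proof (rule Bochner_Integration.integrable_bound[OF integrable_std_normal_moment[of 0]])
    show "(\<lambda>y. std_normal_density y *\<^sub>R cis (v * y)) \<in> borel_measurable lborel" by measurable
  qed auto
  have base_int: "integrable lborel (?f v)" for v
    unfolding eq by (intro integrable_mult_right int)
  have "char std_normal_distribution v = (\<integral>y. std_normal_density y *\<^sub>R cis (v * y) \<partial>lborel)" for v
    unfolding char_def by (simp add: integral_density cis_conv_exp)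
  then have c: "(\<integral>y. std_normal_density y *\<^sub>R cis (v * y) \<partial>lborel) = complex_of_real (exp (- (v\<^sup>2) / 2))" for v
    by (simp add: char_std_normal_distribution)
  have base: "(\<integral>y. ?f v y \<partial>lborel) = complex_of_real (sqrt (2 * pi) * exp (- (v\<^sup>2 / 2)))" for v
    unfolding eq integral_mult_right_zero c by simp
  have sc: "complex_of_real (exp (- (\<sigma>\<^sup>2 * y\<^sup>2 / 2))) * cis (v * y) = ?f (v / \<sigma>) (0 + \<sigma> *\<^sub>R y)" for y
    using assms by (simp add: power_mult_distrib)
  have m: "?f (v / \<sigma>) \<in> borel_measurable borel" by measurable
  show "integrable lborel (\<lambda>y::real. complex_of_real (exp (- (\<sigma>\<^sup>2 * y\<^sup>2 / 2))) * cis (v * y))"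
    unfolding sc using assms base_int[of "v/\<sigma>"]
      integrable_lborel_affine_iff[where f="?f (v / \<sigma>)" and c=\<sigma> and t=0, OF _ m] by auto
  show "(\<integral>y. complex_of_real (exp (- (\<sigma>\<^sup>2 * y\<^sup>2 / 2))) * cis (v * y) \<partial>lborel) = sqrt (2 * pi) / \<sigma> * exp (- (v\<^sup>2 / (2 * \<sigma>\<^sup>2)))"
    unfolding sc using assms base[of "v/\<sigma>"]
      integral_lborel_affine[where f="?f (v / \<sigma>)" and c=\<sigma> and t=0, OF _ m]
    by (simp add: power_divide scaleR_conv_of_real)
qed

lemma
  fixes v :: "'a::euclidean_space"
  assumes "0 < \<sigma>"
  shows integrable_gauss_cis: "integrable lborel (\<lambda>x. complex_of_real (gauss \<sigma> x) * cis (v \<bullet> x))"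
    and integral_gauss_cis: "(\<integral>x. complex_of_real (gauss \<sigma> x) * cis (v \<bullet> x) \<partial>lborel) = (sqrt (2 * pi) / \<sigma>) ^ DIM('a) * gauss (1 / \<sigma>) v"
proof -
  have nrm: "(\<Sum>b\<in>Basis. (x \<bullet> b)\<^sup>2) = (norm x)\<^sup>2" for x :: 'a
    by (simp add: norm_eq_sqrt_inner euclidean_inner[of x x] power2_eq_square sum_nonneg)
  let ?f = "\<lambda>(b::'a) y::real. complex_of_real (exp (- (\<sigma>\<^sup>2 * y\<^sup>2 / 2))) * cis ((v \<bullet> b) * y)"
  have cisum: "cis (\<Sum>b\<in>B. g b) = (\<Prod>b\<in>B. cis (g b))" if "finite B" for B and g :: "'a \<Rightarrow> real"
    using that by (induction B) (auto simp: cis_mult[symmetric])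
  have eq: "complex_of_real (gauss \<sigma> x) * cis (v \<bullet> x) = (\<Prod>b\<in>Basis. ?f b (x \<bullet> b))" for x :: 'a
  proof -
    have "gauss \<sigma> x = exp (\<Sum>b\<in>Basis. - (\<sigma>\<^sup>2 * (x \<bullet> b)\<^sup>2 / 2))"
      unfolding gauss_def nrm[symmetric] by (simp add: sum_negf sum_distrib_left sum_divide_distrib)
    moreover have "v \<bullet> x = (\<Sum>b\<in>Basis. (v \<bullet> b) * (x \<bullet> b))" by (rule euclidean_inner)
    ultimately show ?thesis
      by (simp add: exp_sum cisum prod.distrib)
  qed
  show "integrable lborel (\<lambda>x. complex_of_real (gauss \<sigma> x) * cis (v \<bullet> x))"
    unfolding eq using integrable_gauss_real[OF assms] by (intro integrable_lborel_prod)
  have g: "gauss (1 / \<sigma>) v = (\<Prod>b\<in>Basis. exp (- ((v \<bullet> b)\<^sup>2 / (2 * \<sigma>\<^sup>2))))"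
    unfolding gauss_def nrm[symmetric]
    by (simp add: exp_sum[symmetric] sum_negf sum_distrib_left sum_divide_distrib power_divide mult.commute)
  have "(\<integral>x. complex_of_real (gauss \<sigma> x) * cis (v \<bullet> x) \<partial>lborel) = (\<Prod>b\<in>(Basis::'a set). (\<integral>y. ?f b y \<partial>lborel))"
    unfolding eq using integrable_gauss_real[OF assms] by (intro integral_lborel_prod)
  also have "\<dots> = (\<Prod>b\<in>(Basis::'a set). complex_of_real (sqrt (2 * pi) / \<sigma>) * complex_of_real (exp (- ((v \<bullet> b)\<^sup>2 / (2 * \<sigma>\<^sup>2)))))"
    using integral_gauss_real[OF assms] by (intro prod.cong) auto
  also have "\<dots> = (sqrt (2 * pi) / \<sigma>) ^ DIM('a) * gauss (1 / \<sigma>) v"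
    unfolding g prod.distrib by simp
  finally show "(\<integral>x. complex_of_real (gauss \<sigma> x) * cis (v \<bullet> x) \<partial>lborel) = (sqrt (2 * pi) / \<sigma>) ^ DIM('a) * gauss (1 / \<sigma>) v" .
qed

lemma gauss_pos: "0 < gauss \<sigma> x" and gauss_le_1: "gauss \<sigma> x \<le> 1"
  and gauss_minus: "gauss \<sigma> (- x) = gauss \<sigma> x"
  by (simp_all add: gauss_def power_mult_distrib)

lemma borel_measurable_gauss [measurable]: "gauss \<sigma> \<in> borel_measurable borel"
  unfolding gauss_def[abs_def] by measurable

lemma
  assumes "0 < \<sigma>"
  shows integrable_gauss: "integrable lborel (gauss \<sigma> :: 'a::euclidean_space \<Rightarrow> real)"
    and integral_gauss: "(\<integral>(x::'a). gauss \<sigma> x \<partial>lborel) = (sqrt (2 * pi) / \<sigma>) ^ DIM('a)"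
proof -
  have i: "integrable lborel (\<lambda>x::'a. complex_of_real (gauss \<sigma> x))"
    using integrable_gauss_cis[OF assms, of "0::'a"] by simp
  then show "integrable lborel (gauss \<sigma> :: 'a \<Rightarrow> real)" by (simp only: complex_of_real_integrable_eq)
  have "complex_of_real (\<integral>(x::'a). gauss \<sigma> x \<partial>lborel) = complex_of_real ((sqrt (2 * pi) / \<sigma>) ^ DIM('a))"
    using integral_gauss_cis[OF assms, of "0::'a"] by (simp add: gauss_def)
  then show "(\<integral>(x::'a). gauss \<sigma> x \<partial>lborel) = (sqrt (2 * pi) / \<sigma>) ^ DIM('a)"
    by (simp only: of_real_eq_iff)
qed

section \<open>Fourier transform and positive multipliers\<close>

text \<open>The shape of most exchanges of integrals below: a product of integrable functions
  against a bounded kernel, usually \<open>cis\<close> of an inner product, for which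
  \<open>C = 1\<close>.\<close>

lemma (in pair_sigma_finite)
  fixes f g :: "_ \<Rightarrow> complex"
  assumes f: "integrable M1 f" and g: "integrable M2 g"
    and k[measurable]: "(\<lambda>(x, y). k x y) \<in> borel_measurable (M1 \<Otimes>\<^sub>M M2)"
    and C: "\<And>x y. norm (k x y) \<le> C"
  shows integrable_kernel: "integrable (M1 \<Otimes>\<^sub>M M2) (\<lambda>(x, y). f x * g y * k x y)"
    and integral_kernel_swap: "(\<integral>x. f x * (\<integral>y. g y * k x y \<partial>M2) \<partial>M1) = (\<integral>y. g y * (\<integral>x. f x * k x y \<partial>M1) \<partial>M2)"
proof -
  have fm[measurable]: "f \<in> borel_measurable M1" "g \<in> borel_measurable M2"
    using f g by auto
  have k2[measurable]: "(\<lambda>p. k (fst p) (snd p)) \<in> borel_measurable (M1 \<Otimes>\<^sub>M M2)"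
    using k by (simp add: split_beta')
  have "integrable (M1 \<Otimes>\<^sub>M M2) (\<lambda>p. f (fst p) * g (snd p))"
  proof (rule Fubini_integrable)
    show "integrable M1 (\<lambda>x. \<integral>y. norm (f (fst (x, y)) * g (snd (x, y))) \<partial>M2)"
      using f by (simp add: norm_mult)
    show "AE x in M1. integrable M2 (\<lambda>y. f (fst (x, y)) * g (snd (x, y)))"
      using g by simp
  qed measurable
  then have "integrable (M1 \<Otimes>\<^sub>M M2) (\<lambda>p. C * norm (f (fst p) * g (snd p)))"
    by (intro integrable_mult_right integrable_norm)
  then have "integrable (M1 \<Otimes>\<^sub>M M2) (\<lambda>p. f (fst p) * g (snd p) * k (fst p) (snd p))"
  proof (rule Bochner_Integration.integrable_bound)
    have "norm (f (fst p) * g (snd p) * k (fst p) (snd p)) \<le> norm (C * norm (f (fst p) * g (snd p)))" for p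
    proof -
      have "norm (f (fst p) * g (snd p)) * norm (k (fst p) (snd p)) \<le> norm (f (fst p) * g (snd p)) * C"
        using C by (intro mult_left_mono) auto
      then show ?thesis by (simp add: norm_mult mult_ac)
    qed
    then show "AE p in M1 \<Otimes>\<^sub>M M2. norm (f (fst p) * g (snd p) * k (fst p) (snd p)) \<le> norm (C * norm (f (fst p) * g (snd p)))"
      by simp
  qed measurable
  then show int: "integrable (M1 \<Otimes>\<^sub>M M2) (\<lambda>(x, y). f x * g y * k x y)"
    by (simp add: split_beta')
  have "(\<integral>y. (\<integral>x. f x * g y * k x y \<partial>M1) \<partial>M2) = (\<integral>x. (\<integral>y. f x * g y * k x y \<partial>M2) \<partial>M1)"
    by (rule Fubini_integral) (use int in simp)
  moreover have "(\<integral>y. f x * g y * k x y \<partial>M2) = f x * (\<integral>y. g y * k x y \<partial>M2)" for x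
    by (simp add: mult.assoc)
  moreover have "(\<integral>x. f x * g y * k x y \<partial>M1) = g y * (\<integral>x. f x * k x y \<partial>M1)" for y
    by (subst integral_mult_right_zero[symmetric]) (simp add: mult_ac)
  ultimately show "(\<integral>x. f x * (\<integral>y. g y * k x y \<partial>M2) \<partial>M1) = (\<integral>y. g y * (\<integral>x. f x * k x y \<partial>M1) \<partial>M2)"
    by simp
qed

text \<open>The phase has the sign opposite to \<open>fourier\<close>, and there is no normalising
  factor. The same operator serves as transform of functions and as inverse transform of
  multipliers, the latter up to a reflection and the factor
  \<open>(2 * pi) ^ DIM('a)\<close>.\<close>

definition ft :: "('a::euclidean_space \<Rightarrow> complex) \<Rightarrow> 'a \<Rightarrow> complex" where
  "ft w x = (\<integral>\<xi>. w \<xi> * cis (\<xi> \<bullet> x) \<partial>lborel)"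

abbreviation ftr :: "('a::euclidean_space \<Rightarrow> real) \<Rightarrow> 'a \<Rightarrow> complex" where
  "ftr f \<equiv> ft (\<lambda>x. complex_of_real (f x))"

lemma integrable_mult_cis:
  fixes w :: "'b \<Rightarrow> complex"
  assumes "integrable M w" "g \<in> borel_measurable M"
  shows "integrable M (\<lambda>\<xi>. w \<xi> * cis (g \<xi>))"
  by (rule Bochner_Integration.integrable_bound[OF assms(1)]) (use assms in \<open>auto simp: norm_mult\<close>)

lemma integrable_ft: "integrable lborel w \<Longrightarrow> integrable lborel (\<lambda>\<xi>. w \<xi> * cis (\<xi> \<bullet> x))"
  by (rule integrable_mult_cis) auto

lemma norm_ft_le: "norm (ft w x) \<le> (\<integral>\<xi>. norm (w \<xi>) \<partial>lborel)"
  unfolding ft_def by (rule order_trans[OF integral_norm_bound]) (simp add: norm_mult)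

lemma ft_add: "integrable lborel v \<Longrightarrow> integrable lborel w \<Longrightarrow> ft (\<lambda>\<xi>. v \<xi> + w \<xi>) x = ft v x + ft w x"
  unfolding ft_def by (simp add: distrib_right integrable_ft)

lemma ft_diff: "integrable lborel v \<Longrightarrow> integrable lborel w \<Longrightarrow> ft (\<lambda>\<xi>. v \<xi> - w \<xi>) x = ft v x - ft w x"
  unfolding ft_def by (simp add: left_diff_distrib integrable_ft)

lemma ft_cmult: "ft (\<lambda>\<xi>. c * w \<xi>) x = c * ft w x"
  unfolding ft_def by (simp add: mult.assoc)

lemma ft_dominated:
  fixes w :: "'a::euclidean_space \<Rightarrow> complex"
  assumes "w \<in> borel_measurable borel" "\<And>n. v n \<in> borel_measurable borel" "integrable lborel g"
    and "\<And>\<xi>. (\<lambda>n. v n \<xi>) \<longlonglongrightarrow> w \<xi>" and "\<And>n \<xi>. norm (v n \<xi>) \<le> g \<xi>"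
  shows "(\<lambda>n. ft (v n) x) \<longlonglongrightarrow> ft w x"
  unfolding ft_def
  by (rule integral_dominated_convergence[where w=g])
     (use assms in \<open>auto intro!: tendsto_mult simp: norm_mult\<close>)

lemma continuous_ft:
  fixes w :: "'a::euclidean_space \<Rightarrow> complex"
  assumes "integrable lborel w"
  shows "continuous_on UNIV (ft w)"
  unfolding continuous_on_sequentially
proof (intro ballI allI impI)
  fix u a assume "(\<forall>n. u n \<in> (UNIV :: 'a set)) \<and> u \<longlonglongrightarrow> a"
  then have u: "u \<longlonglongrightarrow> a" by simp
  have "(\<lambda>n. \<integral>\<xi>. w \<xi> * cis (\<xi> \<bullet> u n) \<partial>lborel) \<longlonglongrightarrow> (\<integral>\<xi>. w \<xi> * cis (\<xi> \<bullet> a) \<partial>lborel)"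
  proof (rule integral_dominated_convergence[where w="\<lambda>\<xi>. norm (w \<xi>)"])
    show "AE \<xi> in lborel. (\<lambda>n. w \<xi> * cis (\<xi> \<bullet> u n)) \<longlonglongrightarrow> w \<xi> * cis (\<xi> \<bullet> a)"
      using u by (auto intro!: tendsto_intros)
  qed (use assms in \<open>auto simp: norm_mult\<close>)
  then show "(ft w \<circ> u) \<longlonglongrightarrow> ft w a" by (simp add: ft_def o_def)
qed

lemma borel_measurable_ft [measurable]:
  "integrable lborel w \<Longrightarrow> ft w \<in> borel_measurable borel"
  by (intro borel_measurable_continuous_onI continuous_ft)

text \<open>Reflecting the variable turns the integral into its own conjugate.\<close>

lemma ft_even_real:
  fixes \<phi> :: "'a::euclidean_space \<Rightarrow> real"
  assumes \<phi>: "integrable lborel \<phi>" and ev: "\<And>x. \<phi> (- x) = \<phi> x"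
  shows "ftr \<phi> x = of_real (Re (ftr \<phi> x))"
proof -
  have [measurable]: "\<phi> \<in> borel_measurable borel" using \<phi> by auto
  have "ftr \<phi> x = (\<integral>\<xi>. of_real (\<phi> (0 - \<xi>)) * cis ((0 - \<xi>) \<bullet> x) \<partial>lborel)"
    unfolding ft_def by (subst integral_lborel_reflect[where t=0, symmetric]) auto
  also have "\<dots> = cnj (ftr \<phi> x)"
    unfolding ft_def Bochner_Integration.integral_cnj[symmetric] by (intro Bochner_Integration.integral_cong) (auto simp: ev cis_cnj)
  finally have "Im (ftr \<phi> x) = - Im (ftr \<phi> x)"
    by (metis cnj.sel(2))
  then show ?thesis by (simp add: complex_eq_iff)
qed

section \<open>The heat kernel as an approximate identity\<close>

definition heat :: "real \<Rightarrow> 'a::euclidean_space \<Rightarrow> real" where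
  "heat \<sigma> x = gauss (1 / \<sigma>) x / (sqrt (2 * pi) * \<sigma>) ^ DIM('a)"

lemma borel_measurable_heat [measurable]: "heat \<sigma> \<in> borel_measurable borel"
  unfolding heat_def[abs_def] by measurable

lemma heat_nonneg: "0 < \<sigma> \<Longrightarrow> 0 \<le> heat \<sigma> x"
  by (simp add: heat_def gauss_pos[THEN less_imp_le])

lemma
  assumes "0 < \<sigma>"
  shows integrable_heat: "integrable lborel (heat \<sigma> :: 'a::euclidean_space \<Rightarrow> real)"
    and integral_heat: "(\<integral>(x::'a). heat \<sigma> x \<partial>lborel) = 1"
  using integrable_gauss[of "1 / \<sigma>", where 'a='a] integral_gauss[of "1 / \<sigma>", where 'a='a] assms
  by (simp_all add: heat_def[abs_def])

text \<open>A Gaussian is thus an integrable function with nonnegative transform: the test function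
  on which the positivity of a multiplier is evaluated.\<close>

lemma ft_gauss:
  assumes "0 < \<sigma>"
  shows "ftr (gauss \<sigma>) y = of_real ((2 * pi) ^ DIM('a) * heat \<sigma> (y::'a::euclidean_space))"
proof -
  have "sqrt (2 * pi) / \<sigma> = 2 * pi / (sqrt (2 * pi) * \<sigma>)"
    using real_div_sqrt[of "2 * pi"] by (metis divide_divide_eq_left pi_ge_zero mult_nonneg_nonneg zero_le_numeral)
  then have "(sqrt (2 * pi) / \<sigma>) ^ DIM('a) = (2 * pi) ^ DIM('a) / (sqrt (2 * pi) * \<sigma>) ^ DIM('a)"
    by (simp only: power_divide)
  then have "(sqrt (2 * pi) / \<sigma>) ^ DIM('a) * gauss (1 / \<sigma>) y = (2 * pi) ^ DIM('a) * heat \<sigma> y"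
    by (simp add: heat_def)
  moreover have "ftr (gauss \<sigma>) y = (sqrt (2 * pi) / \<sigma>) ^ DIM('a) * gauss (1 / \<sigma>) y"
    using integral_gauss_cis[OF assms, of y] by (simp add: ft_def inner_commute)
  ultimately show ?thesis by (metis of_real_mult of_real_power)
qed

lemma ft_gauss_nonneg: "0 < \<sigma> \<Longrightarrow> 0 \<le> Re (ftr (gauss \<sigma>) y)"
  by (simp add: ft_gauss heat_nonneg)

text \<open>Rescaling moves \<sigma> from the kernel into the argument of \<open>f\<close>, where
  continuity and dominated convergence apply.\<close>

lemma heat_approx_identity:
  fixes f :: "'a::euclidean_space \<Rightarrow> 'b::{banach, second_countable_topology}"
  assumes cont: "continuous_on UNIV f" and bd: "\<And>x. norm (f x) \<le> B"
    and \<sigma>: "\<And>n. 0 < \<sigma> n" "\<sigma> \<longlonglongrightarrow> 0"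
  shows "(\<lambda>n. \<integral>z. heat (\<sigma> n) z *\<^sub>R f (x - z) \<partial>lborel) \<longlonglongrightarrow> f x"
proof -
  have [measurable]: "f \<in> borel_measurable borel" using cont by (rule borel_measurable_continuous_onI)
  have eq: "(\<integral>z. heat (\<sigma> n) z *\<^sub>R f (x - z) \<partial>lborel) = (\<integral>z. heat 1 z *\<^sub>R f (x - \<sigma> n *\<^sub>R z) \<partial>lborel)" for n
  proof -
    have s: "0 < \<sigma> n" by fact
    have "(\<integral>z. heat 1 z *\<^sub>R f (x - \<sigma> n *\<^sub>R z) \<partial>lborel)
        = (\<integral>z. (\<sigma> n ^ DIM('a) * heat (\<sigma> n) (0 + \<sigma> n *\<^sub>R z)) *\<^sub>R f (x - (0 + \<sigma> n *\<^sub>R z)) \<partial>lborel)"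
    proof (intro Bochner_Integration.integral_cong refl)
      fix z :: 'a
      have "heat 1 z = \<sigma> n ^ DIM('a) * heat (\<sigma> n) (\<sigma> n *\<^sub>R z)"
        using s by (simp add: heat_def gauss_def power_mult_distrib field_simps)
      then show "heat 1 z *\<^sub>R f (x - \<sigma> n *\<^sub>R z) = (\<sigma> n ^ DIM('a) * heat (\<sigma> n) (0 + \<sigma> n *\<^sub>R z)) *\<^sub>R f (x - (0 + \<sigma> n *\<^sub>R z))"
        by simp
    qed
    also have "\<dots> = (1 / \<bar>\<sigma> n\<bar> ^ DIM('a)) *\<^sub>R (\<integral>z. (\<sigma> n ^ DIM('a) * heat (\<sigma> n) z) *\<^sub>R f (x - z) \<partial>lborel)"
      using s by (intro integral_lborel_affine[where f="\<lambda>z. (\<sigma> n ^ DIM('a) * heat (\<sigma> n) z) *\<^sub>R f (x - z)"]) auto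
    also have "\<dots> = (\<integral>z. heat (\<sigma> n) z *\<^sub>R f (x - z) \<partial>lborel)"
      using s by (simp only: scaleR_scaleR[symmetric] integral_scaleR_right) simp
    finally show ?thesis by simp
  qed
  have "(\<lambda>n. \<integral>z. heat 1 z *\<^sub>R f (x - \<sigma> n *\<^sub>R z) \<partial>lborel) \<longlonglongrightarrow> (\<integral>(z::'a). heat 1 z *\<^sub>R f x \<partial>lborel)"
  proof (rule integral_dominated_convergence[where w="\<lambda>z::'a. heat 1 z * B"])
    show "integrable lborel (\<lambda>z::'a. heat 1 z * B)" using integrable_heat[of 1] by auto
    show "AE z in lborel. (\<lambda>n. heat 1 z *\<^sub>R f (x - \<sigma> n *\<^sub>R z)) \<longlonglongrightarrow> heat 1 z *\<^sub>R f x"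
    proof (rule AE_I2)
      fix z
      have "(\<lambda>n. x - \<sigma> n *\<^sub>R z) \<longlonglongrightarrow> x - 0 *\<^sub>R z" by (intro tendsto_intros \<sigma>)
      then have "(\<lambda>n. f (x - \<sigma> n *\<^sub>R z)) \<longlonglongrightarrow> f x"
        using continuous_on_tendsto_compose[OF cont, of "\<lambda>n. x - \<sigma> n *\<^sub>R z" x sequentially] by simp
      then show "(\<lambda>n. heat 1 z *\<^sub>R f (x - \<sigma> n *\<^sub>R z)) \<longlonglongrightarrow> heat 1 z *\<^sub>R f x" by (intro tendsto_intros)
    qed
    show "AE z in lborel. norm (heat 1 z *\<^sub>R f (x - \<sigma> n *\<^sub>R z)) \<le> heat 1 z * B" for n
      using bd by (intro AE_I2) (simp add: heat_nonneg mult_left_mono)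
  qed auto
  also have "(\<integral>(z::'a). heat 1 z *\<^sub>R f x \<partial>lborel) = f x"
    using integral_heat[of 1, where 'a='a] integrable_heat[of 1, where 'a='a] by simp
  finally show ?thesis unfolding eq .
qed

text \<open>In effect, these are the transforms of finite positive measures, characterised by their action on
  transforms, so that no measure has to be constructed. That \<open>posm (\<lambda>\<xi>. m \<xi> - n \<xi>)\<close> expresses the
  inequality between the underlying measures.\<close>

definition posm :: "('a::euclidean_space \<Rightarrow> complex) \<Rightarrow> bool" where
  "posm m \<longleftrightarrow> m \<in> borel_measurable borel \<and> (\<exists>B. \<forall>\<xi>. norm (m \<xi>) \<le> B) \<and>
    (\<forall>w. integrable lborel w \<longrightarrow> (\<forall>x. 0 \<le> Re (ft w x)) \<longrightarrow> (\<forall>x. 0 \<le> Re (ft (\<lambda>\<xi>. m \<xi> * w \<xi>) x)))"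

lemma posm_measurable: "posm m \<Longrightarrow> m \<in> borel_measurable borel"
  and posm_bounded: "posm m \<Longrightarrow> \<exists>B. \<forall>\<xi>. norm (m \<xi>) \<le> B"
  and posmD: "posm m \<Longrightarrow> integrable lborel w \<Longrightarrow> (\<And>x. 0 \<le> Re (ft w x)) \<Longrightarrow> 0 \<le> Re (ft (\<lambda>\<xi>. m \<xi> * w \<xi>) x)"
  by (auto simp: posm_def)

lemma integrable_bounded_mult:
  fixes m :: "'b \<Rightarrow> complex"
  assumes "m \<in> borel_measurable M" "\<And>\<xi>. norm (m \<xi>) \<le> B" "integrable M w"
  shows "integrable M (\<lambda>\<xi>. m \<xi> * w \<xi>)"
proof (rule Bochner_Integration.integrable_bound)
  show "integrable M (\<lambda>\<xi>. B * norm (w \<xi>))" using assms by auto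
  show "AE \<xi> in M. norm (m \<xi> * w \<xi>) \<le> norm (B * norm (w \<xi>))"
    using assms(2) norm_ge_zero[of "m undefined"] order_trans[OF norm_ge_zero assms(2)] by (auto simp: norm_mult abs_mult intro!: mult_right_mono)
qed (use assms in auto)

lemma posm_integrable: "posm m \<Longrightarrow> integrable lborel w \<Longrightarrow> integrable lborel (\<lambda>\<xi>. m \<xi> * w \<xi>)"
  using posm_bounded[of m] posm_measurable[of m] integrable_bounded_mult[of m lborel _ w] by auto

section \<open>Closure properties of positive multipliers\<close>

lemma posm_add:
  fixes m n :: "'a::euclidean_space \<Rightarrow> complex"
  assumes "posm m" "posm n" shows "posm (\<lambda>\<xi>. m \<xi> + n \<xi>)"
proof -
  note [measurable] = posm_measurable[OF assms(1)] posm_measurable[OF assms(2)]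
  obtain A B where "\<forall>\<xi>. norm (m \<xi>) \<le> A" "\<forall>\<xi>. norm (n \<xi>) \<le> B"
    using posm_bounded assms by meson
  then have "\<forall>\<xi>. norm (m \<xi> + n \<xi>) \<le> A + B" by (auto intro: norm_triangle_mono)
  moreover have "0 \<le> Re (ft (\<lambda>\<xi>. (m \<xi> + n \<xi>) * w \<xi>) x)" if "integrable lborel w" "\<forall>x. 0 \<le> Re (ft w x)" for w :: "'a \<Rightarrow> complex" and x
    using that posmD[OF assms(1), of w x] posmD[OF assms(2), of w x] ft_add[OF posm_integrable posm_integrable, OF assms(1) _ assms(2), of w w x]
    by (simp add: distrib_right)
  ultimately show ?thesis unfolding posm_def by (auto intro: borel_measurable_add assms posm_measurable)
qed

lemma posm_mult:
  fixes m n :: "'a::euclidean_space \<Rightarrow> complex"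
  assumes "posm m" "posm n" shows "posm (\<lambda>\<xi>. m \<xi> * n \<xi>)"
proof -
  note [measurable] = posm_measurable[OF assms(1)] posm_measurable[OF assms(2)]
  obtain A B where AB: "\<forall>\<xi>. norm (m \<xi>) \<le> A" "\<forall>\<xi>. norm (n \<xi>) \<le> B"
    using posm_bounded assms by meson
  have "norm (m \<xi> * n \<xi>) \<le> A * B" for \<xi>
    using AB order_trans[OF norm_ge_zero] unfolding norm_mult by (intro mult_mono) auto
  moreover have "0 \<le> Re (ft (\<lambda>\<xi>. (m \<xi> * n \<xi>) * w \<xi>) x)" if "integrable lborel w" "\<forall>x. 0 \<le> Re (ft w x)" for w :: "'a \<Rightarrow> complex" and x
    using posmD[OF assms(1), of "\<lambda>\<xi>. n \<xi> * w \<xi>" x] posmD[OF assms(2), of w] posm_integrable[OF assms(2)] that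
    by (simp add: mult.assoc)
  ultimately show ?thesis unfolding posm_def by (auto intro: borel_measurable_times assms posm_measurable)
qed

lemma posm_const: assumes "0 \<le> c" shows "posm (\<lambda>_. complex_of_real c)"
  unfolding posm_def using assms by (auto simp: ft_cmult)

lemma posm_scale: "posm m \<Longrightarrow> 0 \<le> c \<Longrightarrow> posm (\<lambda>\<xi>. complex_of_real c * m \<xi>)"
  by (intro posm_mult posm_const)

lemma posm_power: "posm m \<Longrightarrow> posm (\<lambda>\<xi>. m \<xi> ^ n)"
  by (induction n) (use posm_const[of 1] in \<open>auto intro: posm_mult\<close>)

lemma posm_prod: "finite I \<Longrightarrow> (\<And>i. i \<in> I \<Longrightarrow> posm (m i)) \<Longrightarrow> posm (\<lambda>\<xi>. \<Prod>i\<in>I. m i \<xi>)"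
  by (induction I rule: finite_induct) (use posm_const[of 1] in \<open>auto intro: posm_mult\<close>)

lemma posm_sum: "finite I \<Longrightarrow> (\<And>i. i \<in> I \<Longrightarrow> posm (m i)) \<Longrightarrow> posm (\<lambda>\<xi>. \<Sum>i\<in>I. m i \<xi>)"
  by (induction I rule: finite_induct) (use posm_const[of 0] in \<open>auto intro: posm_add\<close>)

text \<open>Dominated convergence on the transform side. Power series in a multiplier and the stable
  multiplier are reached through this closure.\<close>

lemma posm_lim:
  fixes m :: "nat \<Rightarrow> 'a::euclidean_space \<Rightarrow> complex"
  assumes pos: "\<And>n. posm (m n)" and lim: "\<And>\<xi>. (\<lambda>n. m n \<xi>) \<longlonglongrightarrow> l \<xi>" and bd: "\<And>n \<xi>. norm (m n \<xi>) \<le> B"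
  shows "posm l"
  unfolding posm_def
proof (intro conjI allI impI exI)
  note [measurable] = posm_measurable[OF pos]
  show lm[measurable]: "l \<in> borel_measurable borel"
    by (rule borel_measurable_LIMSEQ_metric[OF _ lim]) measurable
  show "norm (l \<xi>) \<le> B" for \<xi>
    using lim[of \<xi>] bd by (intro Lim_bounded[of "\<lambda>n. norm (m n \<xi>)" _ 0]) (auto intro: tendsto_norm)
  fix w :: "'a \<Rightarrow> complex" and x assume w: "integrable lborel w" "\<forall>x. 0 \<le> Re (ft w x)"
  have "(\<lambda>n. ft (\<lambda>\<xi>. m n \<xi> * w \<xi>) x) \<longlonglongrightarrow> ft (\<lambda>\<xi>. l \<xi> * w \<xi>) x"
    by (rule ft_dominated[where g="\<lambda>\<xi>. B * norm (w \<xi>)"])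
       (use w lim bd in \<open>auto intro!: tendsto_intros mult_right_mono simp: norm_mult\<close>)
  then have "(\<lambda>n. Re (ft (\<lambda>\<xi>. m n \<xi> * w \<xi>) x)) \<longlonglongrightarrow> Re (ft (\<lambda>\<xi>. l \<xi> * w \<xi>) x)"
    by (rule tendsto_Re)
  then show "0 \<le> Re (ft (\<lambda>\<xi>. l \<xi> * w \<xi>) x)"
    by (rule LIMSEQ_le_const) (use posmD[OF pos w(1)] w(2) in auto)
qed

lemma posm_power_series:
  assumes m: "posm m" and a: "\<And>n. 0 \<le> a n" "\<And>n. a n \<le> 1 / fact n"
  shows "posm (\<lambda>\<xi>. \<Sum>n. complex_of_real (a n) * m \<xi> ^ n)"
proof -
  obtain B where B: "\<And>\<xi>. norm (m \<xi>) \<le> B" using posm_bounded[OF m] by auto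
  have le: "norm (complex_of_real (a n) * m \<xi> ^ n) \<le> B ^ n / fact n" for n \<xi>
  proof -
    have "a n * norm (m \<xi>) ^ n \<le> 1 / fact n * B ^ n"
      using a B by (intro mult_mono power_mono) auto
    then show ?thesis using a(1)[of n] by (simp add: norm_mult norm_power)
  qed
  have sB: "summable (\<lambda>n. B ^ n / fact n)"
    using summable_exp[of B] by (simp add: divide_inverse mult.commute)
  have B0: "0 \<le> B" using B[of 0] norm_ge_zero order_trans by blast
  show ?thesis
  proof (rule posm_lim)
    show "posm (\<lambda>\<xi>. \<Sum>n<N. complex_of_real (a n) * m \<xi> ^ n)" for N
      by (intro posm_sum posm_scale posm_power m a) auto
    show "(\<lambda>N. \<Sum>n<N. complex_of_real (a n) * m \<xi> ^ n) \<longlonglongrightarrow> (\<Sum>n. complex_of_real (a n) * m \<xi> ^ n)" for \<xi>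
      by (rule summable_LIMSEQ, rule summable_comparison_test[OF _ sB]) (use le in auto)
    show "norm (\<Sum>n<N. complex_of_real (a n) * m \<xi> ^ n) \<le> (\<Sum>n. B ^ n / fact n)" for N \<xi>
      by (rule order_trans[OF norm_sum], rule order_trans[OF sum_mono[OF le] sum_le_suminf[OF sB]]) (use B0 in auto)
  qed
qed

lemma exp_eq_suminf_of_real: "exp z = (\<Sum>n. complex_of_real (1 / fact n) * z ^ n)"
  by (simp add: exp_def scaleR_conv_of_real divide_inverse)

lemma posm_exp: "posm m \<Longrightarrow> posm (\<lambda>\<xi>. exp (m \<xi>))"
  unfolding exp_eq_suminf_of_real by (rule posm_power_series) auto

text \<open>Inequalities between compound Poisson laws are read off coefficient by coefficient: what
  is left of the exponential series is again a power series in \<open>m\<close> with nonnegative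
  coefficients.\<close>

lemma posm_exp_minus_sum:
  assumes m: "posm m" and b: "\<And>n. n \<in> I \<Longrightarrow> 0 \<le> b n" "\<And>n. n \<in> I \<Longrightarrow> b n \<le> 1 / fact n" and I: "finite I"
  shows "posm (\<lambda>\<xi>. exp (m \<xi>) - (\<Sum>n\<in>I. complex_of_real (b n) * m \<xi> ^ n))"
proof -
  define a where "a n = 1 / fact n - (if n \<in> I then b n else 0)" for n
  have "exp z - (\<Sum>n\<in>I. complex_of_real (b n) * z ^ n) = (\<Sum>n. complex_of_real (a n) * z ^ n)" for z
  proof -
    have 1: "(\<lambda>n. complex_of_real (1 / fact n) * z ^ n) sums exp z"
      using exp_converges[of z] by (simp add: scaleR_conv_of_real divide_inverse)
    have 2: "(\<lambda>n. if n \<in> I then complex_of_real (b n) * z ^ n else 0) sums (\<Sum>n\<in>I. complex_of_real (b n) * z ^ n)"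
      by (rule sums_If_finite_set[OF I])
    have "(\<lambda>n. complex_of_real (a n) * z ^ n) sums (exp z - (\<Sum>n\<in>I. complex_of_real (b n) * z ^ n))"
      using sums_diff[OF 1 2] by (rule sums_cong[THEN iffD1, rotated]) (auto simp: a_def left_diff_distrib)
    then show ?thesis by (simp add: sums_iff)
  qed
  moreover have "posm (\<lambda>\<xi>. \<Sum>n. complex_of_real (a n) * m \<xi> ^ n)"
    by (rule posm_power_series[OF m]) (use b in \<open>auto simp: a_def\<close>)
  ultimately show ?thesis by simp
qed

text \<open>Multiplying \<open>w\<close> by the transform of a positive measure replaces
  \<open>ft w\<close> by an average of its translates. The abstract space \<open>P\<close> admits
  image measures: below it carries jump size and jump time, and \<open>h\<close> is the resulting
  displacement.\<close>

lemma posm_fourier: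
  fixes f :: "'b \<Rightarrow> real" and h :: "'b \<Rightarrow> 'a::euclidean_space"
  assumes P: "sigma_finite_measure P" and f: "integrable P f" "\<And>\<omega>. 0 \<le> f \<omega>" and h[measurable]: "h \<in> borel_measurable P"
  shows "posm (\<lambda>\<xi>. \<integral>\<omega>. of_real (f \<omega>) * cis (\<xi> \<bullet> h \<omega>) \<partial>P)"
proof -
  interpret P: sigma_finite_measure P by fact
  interpret pair_sigma_finite "lborel :: 'a measure" P ..
  have [measurable]: "f \<in> borel_measurable P" using f by auto
  have fc: "integrable P (\<lambda>\<omega>. complex_of_real (f \<omega>))" using f by simp
  show ?thesis unfolding posm_def
  proof (intro conjI allI impI exI)
    show "(\<lambda>\<xi>. \<integral>\<omega>. of_real (f \<omega>) * cis (\<xi> \<bullet> h \<omega>) \<partial>P) \<in> borel_measurable borel"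
      by measurable
    show "norm (\<integral>\<omega>. of_real (f \<omega>) * cis (\<xi> \<bullet> h \<omega>) \<partial>P) \<le> (\<integral>\<omega>. f \<omega> \<partial>P)" for \<xi>
      by (rule order_trans[OF integral_norm_bound]) (use f in \<open>simp add: norm_mult\<close>)
    fix w :: "'a \<Rightarrow> complex" and x assume w: "integrable lborel w" "\<forall>x. 0 \<le> Re (ft w x)"
    have eq: "ft (\<lambda>\<xi>. (\<integral>\<omega>. of_real (f \<omega>) * cis (\<xi> \<bullet> h \<omega>) \<partial>P) * w \<xi>) x
       = (\<integral>\<xi>. w \<xi> * (\<integral>\<omega>. of_real (f \<omega>) * cis (\<xi> \<bullet> (x + h \<omega>)) \<partial>P) \<partial>lborel)"
      unfolding ft_def
    proof (intro Bochner_Integration.integral_cong refl)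
      fix \<xi>
      have "(\<integral>\<omega>. of_real (f \<omega>) * cis (\<xi> \<bullet> (x + h \<omega>)) \<partial>P) = (\<integral>\<omega>. cis (\<xi> \<bullet> x) * (of_real (f \<omega>) * cis (\<xi> \<bullet> h \<omega>)) \<partial>P)"
        by (intro Bochner_Integration.integral_cong) (auto simp: inner_add_right cis_mult[symmetric])
      then show "(\<integral>\<omega>. of_real (f \<omega>) * cis (\<xi> \<bullet> h \<omega>) \<partial>P) * w \<xi> * cis (\<xi> \<bullet> x) = w \<xi> * (\<integral>\<omega>. of_real (f \<omega>) * cis (\<xi> \<bullet> (x + h \<omega>)) \<partial>P)"
        by simp
    qed
    also have "\<dots> = (\<integral>\<omega>. of_real (f \<omega>) * ft w (x + h \<omega>) \<partial>P)"
      unfolding ft_def by (rule integral_kernel_swap[where C=1]) (use w fc in auto)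
    finally have *: "ft (\<lambda>\<xi>. (\<integral>\<omega>. of_real (f \<omega>) * cis (\<xi> \<bullet> h \<omega>) \<partial>P) * w \<xi>) x = (\<integral>\<omega>. of_real (f \<omega>) * ft w (x + h \<omega>) \<partial>P)" .
    have "integrable P (\<lambda>\<omega>. ft w (x + h \<omega>) * of_real (f \<omega>))"
      by (rule integrable_bounded_mult[OF _ norm_ft_le fc]) (use borel_measurable_ft[OF w(1)] in measurable)
    then have "Re (\<integral>\<omega>. of_real (f \<omega>) * ft w (x + h \<omega>) \<partial>P) = (\<integral>\<omega>. f \<omega> * Re (ft w (x + h \<omega>)) \<partial>P)"
      by (subst integral_Re[symmetric]) (auto simp: mult.commute)
    then show "0 \<le> Re (ft (\<lambda>\<xi>. (\<integral>\<omega>. of_real (f \<omega>) * cis (\<xi> \<bullet> h \<omega>) \<partial>P) * w \<xi>) x)"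
      unfolding * using f w by (auto intro!: integral_nonneg_AE mult_nonneg_nonneg)
  qed
qed

section \<open>Strict positivity of the transform of a square\<close>

text \<open>The set where \<open>g\<close> does not vanish is open and null, hence empty.\<close>

lemma continuous_nonneg_integral_0:
  fixes g :: "'a::euclidean_space \<Rightarrow> real"
  assumes cont: "continuous_on UNIV g" and int: "integrable lborel g"
    and nn: "\<And>x. 0 \<le> g x" and le: "(\<integral>x. g x \<partial>lborel) \<le> 0"
  shows "g x = 0"
proof (rule ccontr)
  assume "g x \<noteq> 0"
  have "(\<integral>x. g x \<partial>lborel) = 0" using le nn by (intro order_antisym Bochner_Integration.integral_nonneg) auto
  then have ae: "AE x in lborel. g x = 0"
    using integral_nonneg_eq_0_iff_AE[OF int] nn by auto
  define U where "U = {x. g x \<noteq> 0}"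
  have "open U" unfolding U_def
    using cont by (intro open_Collect_neq) auto
  moreover have "U \<in> null_sets lborel"
    using ae AE_iff_null_sets[of U lborel] \<open>open U\<close> by (auto simp: U_def)
  then have "negligible U" using null_sets_completionI negligible_iff_null_sets by blast
  ultimately have "U = {}" by (metis open_not_negligible)
  then show False using \<open>g x \<noteq> 0\<close> by (auto simp: U_def)
qed

text \<open>The formula for the transform of \<open>w^2\<close> as a self-convolution, regularised:
  the Gaussian weight makes Fubini applicable without integrability of \<open>ft w\<close>, and on
  the other side it replaces one factor \<open>w\<close> by its heat average.\<close>

lemma ft_gauss_cutoff:
  fixes \<phi> :: "'a::euclidean_space \<Rightarrow> real"
  assumes \<phi>: "integrable lborel \<phi>" and \<sigma>: "0 < \<sigma>"
  defines "w \<equiv> \<lambda>\<xi>. complex_of_real (\<phi> \<xi>)"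
  shows "(\<integral>z. of_real (gauss \<sigma> z) * ft w z * ft w (x - z) \<partial>lborel)
    = (2 * pi) ^ DIM('a) * (\<integral>\<zeta>. w \<zeta> * cis (\<zeta> \<bullet> x) * (\<integral>z. heat \<sigma> z *\<^sub>R w (\<zeta> - z) \<partial>lborel) \<partial>lborel)"
proof -
  have [measurable]: "\<phi> \<in> borel_measurable borel" "w \<in> borel_measurable borel" using \<phi> unfolding w_def by auto
  have w: "integrable lborel w" using \<phi> by (simp add: w_def)
  note [measurable] = borel_measurable_ft[OF w]
  have g: "integrable lborel (\<lambda>z::'a. complex_of_real (gauss \<sigma> z))" using integrable_gauss[OF \<sigma>, where 'a='a] by simp
  have gw: "integrable lborel (\<lambda>z. of_real (gauss \<sigma> z) * ft w z)"
    using integrable_bounded_mult[of "ft w" lborel _ "\<lambda>z. complex_of_real (gauss \<sigma> z)", OF _ norm_ft_le g]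
    by (simp add: mult.commute)
  have gc: "integrable lborel (\<lambda>z. of_real (gauss \<sigma> z) * cis (\<zeta> \<bullet> (x - z)))" for \<zeta>
    by (rule integrable_mult_cis[OF g]) simp
  have A: "(\<integral>z. of_real (gauss \<sigma> z) * ft w z * ft w (x - z) \<partial>lborel)
     = (\<integral>\<zeta>. w \<zeta> * (\<integral>z. of_real (gauss \<sigma> z) * ft w z * cis (\<zeta> \<bullet> (x - z)) \<partial>lborel) \<partial>lborel)"
    unfolding ft_def[of w "x - _"]
    by (rule lborel_pair.integral_kernel_swap[OF gw w, where C=1]) auto
  have B: "(\<integral>z. of_real (gauss \<sigma> z) * ft w z * cis (\<zeta> \<bullet> (x - z)) \<partial>lborel)
     = (2 * pi) ^ DIM('a) * (cis (\<zeta> \<bullet> x) * (\<integral>z. heat \<sigma> z *\<^sub>R w (\<zeta> - z) \<partial>lborel))" for \<zeta>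
  proof -
    have "(\<integral>z. of_real (gauss \<sigma> z) * ft w z * cis (\<zeta> \<bullet> (x - z)) \<partial>lborel)
      = (\<integral>z. (of_real (gauss \<sigma> z) * cis (\<zeta> \<bullet> (x - z))) * (\<integral>\<xi>. w \<xi> * cis (\<xi> \<bullet> z) \<partial>lborel) \<partial>lborel)"
      by (simp add: ft_def mult_ac)
    also have "\<dots> = (\<integral>\<xi>. w \<xi> * (\<integral>z. (of_real (gauss \<sigma> z) * cis (\<zeta> \<bullet> (x - z))) * cis (\<xi> \<bullet> z) \<partial>lborel) \<partial>lborel)"
      by (rule lborel_pair.integral_kernel_swap[OF gc w, where C=1]) auto
    also have "\<dots> = (\<integral>\<xi>. (2 * pi) ^ DIM('a) * cis (\<zeta> \<bullet> x) * (heat \<sigma> (\<zeta> - \<xi>) *\<^sub>R w \<xi>) \<partial>lborel)"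
    proof (intro Bochner_Integration.integral_cong refl)
      fix \<xi>
      have "(\<integral>z. (of_real (gauss \<sigma> z) * cis (\<zeta> \<bullet> (x - z))) * cis (\<xi> \<bullet> z) \<partial>lborel)
        = (\<integral>z. cis (\<zeta> \<bullet> x) * (of_real (gauss \<sigma> z) * cis ((\<xi> - \<zeta>) \<bullet> z)) \<partial>lborel)"
      proof (intro Bochner_Integration.integral_cong refl)
        fix z
        have "cis (\<zeta> \<bullet> (x - z)) * cis (\<xi> \<bullet> z) = cis (\<zeta> \<bullet> x) * cis ((\<xi> - \<zeta>) \<bullet> z)"
          unfolding cis_mult by (rule arg_cong[where f=cis]) (simp add: inner_diff_left inner_diff_right)
        then show "of_real (gauss \<sigma> z) * cis (\<zeta> \<bullet> (x - z)) * cis (\<xi> \<bullet> z) = cis (\<zeta> \<bullet> x) * (of_real (gauss \<sigma> z) * cis ((\<xi> - \<zeta>) \<bullet> z))"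
          by (metis mult.assoc mult.left_commute)
      qed
      also have "\<dots> = cis (\<zeta> \<bullet> x) * ((2 * pi) ^ DIM('a) * heat \<sigma> (\<xi> - \<zeta>))"
        using ft_gauss[OF \<sigma>, of "\<xi> - \<zeta>"] by (simp add: ft_def inner_commute)
      also have "heat \<sigma> (\<xi> - \<zeta>) = heat \<sigma> (\<zeta> - \<xi>)"
        using gauss_minus[of "1 / \<sigma>" "\<zeta> - \<xi>"] by (simp add: heat_def)
      finally show "w \<xi> * (\<integral>z. (of_real (gauss \<sigma> z) * cis (\<zeta> \<bullet> (x - z))) * cis (\<xi> \<bullet> z) \<partial>lborel)
         = (2 * pi) ^ DIM('a) * cis (\<zeta> \<bullet> x) * (heat \<sigma> (\<zeta> - \<xi>) *\<^sub>R w \<xi>)"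
        by (simp add: scaleR_conv_of_real mult_ac)
    qed
    also have "\<dots> = (2 * pi) ^ DIM('a) * cis (\<zeta> \<bullet> x) * (\<integral>\<xi>. (heat \<sigma> (\<zeta> - \<xi>) *\<^sub>R w \<xi>) \<partial>lborel)"
      by (rule integral_mult_right_zero)
    also have "(\<integral>\<xi>. (heat \<sigma> (\<zeta> - \<xi>) *\<^sub>R w \<xi>) \<partial>lborel) = (\<integral>\<xi>. (heat \<sigma> \<xi> *\<^sub>R w (\<zeta> - \<xi>)) \<partial>lborel)"
      by (subst integral_lborel_reflect[where t=\<zeta>, symmetric]) auto
    finally show ?thesis by (simp add: mult.assoc)
  qed
  show ?thesis unfolding A B
    by (subst integral_mult_right_zero[symmetric]) (simp add: mult_ac)
qed

text \<open>An inequality is all that strict positivity needs, and the fixed weight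
  \<open>gauss 1\<close> keeps the left side finite. For \<sigma> \<le> 1 one has
  \<open>gauss 1 z \<le> gauss \<sigma> z\<close>, and the other factors are nonnegative, so the
  cutoff identity bounds the left side for every such \<sigma>; then \<sigma> \<rightarrow>
  0.\<close>

lemma ft_square_lower:
  fixes \<phi> :: "'a::euclidean_space \<Rightarrow> real"
  assumes \<phi>: "integrable lborel \<phi>" and cont: "continuous_on UNIV \<phi>" and bd: "\<And>\<xi>. \<bar>\<phi> \<xi>\<bar> \<le> B"
    and even: "\<And>x. \<phi> (- x) = \<phi> x" and nn: "\<And>x. 0 \<le> Re (ftr \<phi> x)"
  shows "(\<integral>z. gauss 1 z * (Re (ftr \<phi> z) * Re (ftr \<phi> (x - z))) \<partial>lborel)
     \<le> (2 * pi) ^ DIM('a) * Re (ft (\<lambda>\<xi>. of_real ((\<phi> \<xi>)\<^sup>2)) x)" (is "?L \<le> ?R")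
proof -
  define w where "w = (\<lambda>\<xi>. complex_of_real (\<phi> \<xi>))"
  define p where "p z = Re (ft w z)" for z
  define s where "s n = 1 / (real n + 1)" for n
  have [measurable]: "\<phi> \<in> borel_measurable borel" "w \<in> borel_measurable borel" using \<phi> unfolding w_def by auto
  have w: "integrable lborel w" using \<phi> by (simp add: w_def)
  note [measurable] = borel_measurable_ft[OF w]
  have [measurable]: "p \<in> borel_measurable borel" unfolding p_def by measurable
  have ftp: "ft w z = of_real (p z)" for z
    unfolding p_def w_def by (rule ft_even_real[OF \<phi> even])
  have s: "0 < s n" "s n \<le> 1" for n by (auto simp: s_def)
  have s0: "s \<longlonglongrightarrow> 0" unfolding s_def using LIMSEQ_inverse_real_of_nat by (simp add: inverse_eq_divide add.commute)
  define C where "C = (\<integral>\<xi>. norm (w \<xi>) \<partial>lborel)"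
  have pC: "p z \<le> C" "0 \<le> p z" for z
    using order_trans[OF complex_Re_le_cmod norm_ft_le, of w z] nn[of z] by (auto simp: C_def p_def w_def)
  have C0: "0 \<le> C" using pC order_trans by blast
  have int: "integrable lborel (\<lambda>z. gauss \<sigma> z * (p z * p (x - z)))" if "0 < \<sigma>" for \<sigma>
  proof (rule Bochner_Integration.integrable_bound)
    show "integrable lborel (\<lambda>z::'a. (C * C) * gauss \<sigma> z)" using integrable_gauss[OF that] by auto
    show "AE z in lborel. norm (gauss \<sigma> z * (p z * p (x - z))) \<le> norm (C * C * gauss \<sigma> z)"
    proof (rule AE_I2)
      fix z
      have "p z * p (x - z) \<le> C * C" using pC C0 by (intro mult_mono) auto
      then have "gauss \<sigma> z * (p z * p (x - z)) \<le> gauss \<sigma> z * (C * C)"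
        by (intro mult_left_mono) (simp_all add: gauss_pos less_imp_le)
      moreover have "0 \<le> gauss \<sigma> z * (p z * p (x - z))" "0 \<le> C * C * gauss \<sigma> z"
        using C0 by (simp_all add: pC gauss_pos less_imp_le)
      ultimately show "norm (gauss \<sigma> z * (p z * p (x - z))) \<le> norm (C * C * gauss \<sigma> z)"
        by (simp add: mult.commute)
    qed
  qed measurable
  define X where "X n = (\<integral>\<zeta>. w \<zeta> * cis (\<zeta> \<bullet> x) * (\<integral>z. heat (s n) z *\<^sub>R w (\<zeta> - z) \<partial>lborel) \<partial>lborel)" for n
  have ge: "?L \<le> (2 * pi) ^ DIM('a) * Re (X n)" for n
  proof -
    have "(2 * pi) ^ DIM('a) * X n = (\<integral>z. of_real (gauss (s n) z) * ft w z * ft w (x - z) \<partial>lborel)"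
      unfolding X_def w_def using ft_gauss_cutoff[OF \<phi> s(1)[of n], of x] by simp
    also have "\<dots> = of_real (\<integral>z. gauss (s n) z * (p z * p (x - z)) \<partial>lborel)"
      unfolding ftp integral_complex_of_real[symmetric] by (simp add: mult_ac)
    finally have "Re (complex_of_real ((2 * pi) ^ DIM('a)) * X n) = (\<integral>z. gauss (s n) z * (p z * p (x - z)) \<partial>lborel)"
      by simp
    then have "(2 * pi) ^ DIM('a) * Re (X n) = (\<integral>z. gauss (s n) z * (p z * p (x - z)) \<partial>lborel)"
      by (simp only: Re_complex_of_real Im_complex_of_real times_complex.sel)
    moreover have "?L \<le> (\<integral>z. gauss (s n) z * (p z * p (x - z)) \<partial>lborel)"
    proof -
      have "gauss 1 z \<le> gauss (s n) z" for z :: 'a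
      proof -
        have "(s n)\<^sup>2 \<le> 1" using s[of n] by (simp add: power_le_one)
        then have "(s n)\<^sup>2 * (norm z)\<^sup>2 \<le> 1 * (norm z)\<^sup>2" by (rule mult_right_mono) simp
        then show ?thesis by (simp add: gauss_def)
      qed
      then show ?thesis
        using int[of 1] int[of "s n"] s[of n] unfolding p_def[symmetric] w_def[symmetric]
        by (intro integral_mono mult_right_mono mult_nonneg_nonneg pC) simp_all
    qed
    ultimately show ?thesis by simp
  qed
  have "X \<longlonglongrightarrow> (\<integral>\<zeta>. w \<zeta> * cis (\<zeta> \<bullet> x) * w \<zeta> \<partial>lborel)"
    unfolding X_def
  proof (rule integral_dominated_convergence[where w="\<lambda>\<zeta>. norm (w \<zeta>) * B"])
    show "integrable lborel (\<lambda>\<zeta>. norm (w \<zeta>) * B)" using w by auto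
    show "(\<lambda>\<zeta>. w \<zeta> * cis (\<zeta> \<bullet> x) * (\<integral>z. heat (s n) z *\<^sub>R w (\<zeta> - z) \<partial>lborel)) \<in> borel_measurable lborel" for n
      by measurable
    show "AE \<zeta> in lborel. (\<lambda>n. w \<zeta> * cis (\<zeta> \<bullet> x) * (\<integral>z. heat (s n) z *\<^sub>R w (\<zeta> - z) \<partial>lborel)) \<longlonglongrightarrow> w \<zeta> * cis (\<zeta> \<bullet> x) * w \<zeta>"
      by (intro AE_I2 tendsto_mult tendsto_const heat_approx_identity[where B=B] s s0)
         (use cont bd in \<open>auto simp: w_def intro!: continuous_intros\<close>)
    show "AE \<zeta> in lborel. norm (w \<zeta> * cis (\<zeta> \<bullet> x) * (\<integral>z. heat (s n) z *\<^sub>R w (\<zeta> - z) \<partial>lborel)) \<le> norm (w \<zeta>) * B" for n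
    proof (rule AE_I2)
      fix \<zeta>
      have "norm (\<integral>z. heat (s n) z *\<^sub>R w (\<zeta> - z) \<partial>lborel) \<le> (\<integral>(z::'a). heat (s n) z * B \<partial>lborel)"
      proof (rule Bochner_Integration.integral_norm_bound_integral)
        show 1: "integrable lborel (\<lambda>z::'a. heat (s n) z * B)" using integrable_heat[OF s(1), of n, where 'a='a] by auto
        show 2: "norm (heat (s n) z *\<^sub>R w (\<zeta> - z)) \<le> heat (s n) z * B" for z
          using heat_nonneg[OF s(1), of n z] bd by (simp add: w_def mult_left_mono)
        show "integrable lborel (\<lambda>z. heat (s n) z *\<^sub>R w (\<zeta> - z))"
          by (rule Bochner_Integration.integrable_bound[OF 1]) (use 2 in \<open>auto intro!: AE_I2 order_trans[OF _ abs_ge_self] simp del: norm_scaleR\<close>)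
      qed
      also have "\<dots> = B" using integral_heat[OF s(1), of n, where 'a='a] by simp
      finally show "norm (w \<zeta> * cis (\<zeta> \<bullet> x) * (\<integral>z. heat (s n) z *\<^sub>R w (\<zeta> - z) \<partial>lborel)) \<le> norm (w \<zeta>) * B"
        by (auto simp: norm_mult intro!: mult_left_mono)
    qed
  qed measurable
  also have "(\<integral>\<zeta>. w \<zeta> * cis (\<zeta> \<bullet> x) * w \<zeta> \<partial>lborel) = ft (\<lambda>\<xi>. of_real ((\<phi> \<xi>)\<^sup>2)) x"
    unfolding ft_def w_def by (intro Bochner_Integration.integral_cong) (auto simp: power2_eq_square)
  finally have "(\<lambda>n. (2 * pi) ^ DIM('a) * Re (X n)) \<longlonglongrightarrow> ?R"
    by (intro tendsto_intros)
  then show ?thesis by (rule LIMSEQ_le_const) (use ge in auto)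
qed

text \<open>The exponential decay of \<open>\<phi>\<close> absorbs the growth of the kernel in the
  strip. Differentiation under the integral is applied on the boxes \<open>K n\<close> only; the
  integrals over the boxes converge uniformly on the strip, since the tail \<open>e n\<close> of the
  majorant does not involve \<open>w\<close>, and so the limit is holomorphic.\<close>

lemma holomorphic_exp_integral:
  fixes \<phi> :: "'a::euclidean_space \<Rightarrow> real" and x :: 'a
  assumes cont: "continuous_on UNIV \<phi>" and bd: "\<And>\<xi>. \<bar>\<phi> \<xi>\<bar> \<le> C * exp (- (c * norm \<xi>))" and c: "0 < c"
    and r: "r * norm x \<le> c / 2"
  shows "(\<lambda>w. \<integral>\<xi>. of_real (\<phi> \<xi>) * exp (\<i> * w * of_real (\<xi> \<bullet> x)) \<partial>lborel) holomorphic_on {w. \<bar>Im w\<bar> < r}"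
proof -
  let ?S = "{w. \<bar>Im w\<bar> < r}"
  let ?f = "\<lambda>w \<xi>. of_real (\<phi> \<xi>) * exp (\<i> * w * of_real (\<xi> \<bullet> x)) :: complex"
  define K where "K n = cbox (- real n *\<^sub>R One) (real n *\<^sub>R One :: 'a)" for n
  have [measurable]: "\<phi> \<in> borel_measurable borel" using cont by (rule borel_measurable_continuous_onI)
  have S: "?S = {w. Im w < r} \<inter> {w. - r < Im w}" by auto
  have openS: "open ?S" unfolding S by (intro open_Int open_halfspace_Im_lt open_halfspace_Im_gt)
  have convS: "convex ?S" unfolding S by (intro convex_Int convex_halfspace_Im_lt convex_halfspace_Im_gt)
  have bound: "norm (?f w \<xi>) \<le> C * exp (- (c / 2 * norm \<xi>))" if "w \<in> ?S" for w \<xi>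
  proof -
    have "\<bar>Im w * (\<xi> \<bullet> x)\<bar> \<le> r * (norm \<xi> * norm x)"
      unfolding abs_mult using that Cauchy_Schwarz_ineq2[of \<xi> x] by (intro mult_mono) auto
    also have "\<dots> \<le> c / 2 * norm \<xi>" using r mult_right_mono[of "r * norm x" "c/2" "norm \<xi>"] by (simp add: mult_ac)
    finally have "norm (exp (\<i> * w * of_real (\<xi> \<bullet> x))) \<le> exp (c / 2 * norm \<xi>)"
      by (simp add: norm_exp_eq_Re)
    then have "norm (?f w \<xi>) \<le> (C * exp (- (c * norm \<xi>))) * exp (c / 2 * norm \<xi>)"
      unfolding norm_mult using bd[of \<xi>] by (intro mult_mono) auto
    then show ?thesis by (simp add: mult.assoc exp_add[symmetric] field_simps)
  qed
  have dom: "integrable lborel (\<lambda>\<xi>::'a. C * exp (- (c / 2 * norm \<xi>)))"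
    using c by (intro integrable_mult_right integrable_exp_norm) simp
  have fint: "integrable lborel (?f w)" if "w \<in> ?S" for w
    by (rule Bochner_Integration.integrable_bound[OF dom])
       (use bound[OF that] in \<open>auto intro!: AE_I2 order_trans[OF _ abs_ge_self] simp del: norm_mult\<close>)
  define H where "H n w = integral (K n) (?f w)" for n w
  have H_eq: "H n w = (\<integral>\<xi>. indicator (K n) \<xi> *\<^sub>R ?f w \<xi> \<partial>lborel)" if "w \<in> ?S" for n w
  proof -
    have "set_integrable lborel (K n) (?f w)"
      unfolding set_integrable_def by (rule integrable_mult_indicator[OF _ fint[OF that]]) (simp add: K_def)
    from set_borel_integral_eq_integral(2)[OF this] show ?thesis
      by (simp add: H_def set_lebesgue_integral_def)
  qed
  have holH: "H n holomorphic_on ?S" for n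
    unfolding H_def K_def
  proof (rule leibniz_rule_holomorphic[where fx="\<lambda>w \<xi>. of_real (\<phi> \<xi>) * (\<i> * of_real (\<xi> \<bullet> x) * exp (\<i> * w * of_real (\<xi> \<bullet> x)))"])
    show "((\<lambda>w. ?f w \<xi>) has_field_derivative of_real (\<phi> \<xi>) * (\<i> * of_real (\<xi> \<bullet> x) * exp (\<i> * w * of_real (\<xi> \<bullet> x)))) (at w within ?S)" for w \<xi>
      by (auto intro!: derivative_eq_intros)
    have c1: "continuous_on A (\<lambda>z. \<phi> (snd z))" for A :: "(complex \<times> 'a) set"
      by (rule continuous_on_compose2[OF cont]) (auto intro: continuous_intros)
    show "continuous_on (?S \<times> cbox (- real n *\<^sub>R One) (real n *\<^sub>R One)) (\<lambda>(w, \<xi>). of_real (\<phi> \<xi>) * (\<i> * of_real (\<xi> \<bullet> x) * exp (\<i> * w * of_real (\<xi> \<bullet> x))))"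
      unfolding split_beta' by (intro continuous_intros c1)
    show "?f w integrable_on cbox (- real n *\<^sub>R One) (real n *\<^sub>R One)" for w
      by (intro integrable_continuous continuous_intros continuous_on_subset[OF cont]) auto
  qed (rule convS)
  define e where "e n = (\<integral>\<xi>. indicator (- K n) \<xi> * (C * exp (- (c / 2 * norm \<xi>))) \<partial>lborel)" for n
  have e_lim: "e \<longlonglongrightarrow> 0"
  proof -
    have "e \<longlonglongrightarrow> (\<integral>(\<xi>::'a). 0 \<partial>lborel)" unfolding e_def
    proof (rule integral_dominated_convergence[where w="\<lambda>\<xi>::'a. norm (C * exp (- (c / 2 * norm \<xi>)))"])
      show "AE \<xi> in lborel. (\<lambda>n. indicator (- K n) \<xi> * (C * exp (- (c / 2 * norm \<xi>)))) \<longlonglongrightarrow> 0"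
      proof (rule AE_I2)
        fix \<xi> :: 'a
        obtain N :: nat where N: "norm \<xi> \<le> real N" using real_arch_simple by blast
        have "\<xi> \<in> K n" if "n \<ge> N" for n
        proof -
          have "\<bar>\<xi> \<bullet> b\<bar> \<le> real n" if "b \<in> Basis" for b
            using Basis_le_norm[OF that, of \<xi>] N \<open>n \<ge> N\<close> by (meson of_nat_mono order_trans)
          then show ?thesis unfolding K_def mem_box by (auto simp: abs_le_iff minus_le_iff)
        qed
        then have "eventually (\<lambda>n. indicator (- K n) \<xi> * (C * exp (- (c / 2 * norm \<xi>))) = 0) sequentially"
          by (auto intro!: eventually_sequentiallyI[of N])
        then show "(\<lambda>n. indicator (- K n) \<xi> * (C * exp (- (c / 2 * norm \<xi>)))) \<longlonglongrightarrow> 0"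
          by (rule tendsto_eventually)
      qed
      show "(\<lambda>\<xi>. indicator (- K n) \<xi> * (C * exp (- (c / 2 * norm \<xi>)))) \<in> borel_measurable lborel" for n
        unfolding K_def by measurable
    qed (use dom in \<open>auto simp: indicator_def\<close>)
    then show ?thesis by simp
  qed
  have near: "norm (H n w - (\<integral>\<xi>. ?f w \<xi> \<partial>lborel)) \<le> e n" if "w \<in> ?S" for n w
  proof -
    have i1: "integrable lborel (\<lambda>\<xi>. indicator (K n) \<xi> *\<^sub>R ?f w \<xi>)"
      by (rule integrable_mult_indicator[OF _ fint[OF that]]) (simp add: K_def)
    have "H n w - (\<integral>\<xi>. ?f w \<xi> \<partial>lborel) = (\<integral>\<xi>. indicator (K n) \<xi> *\<^sub>R ?f w \<xi> - ?f w \<xi> \<partial>lborel)"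
      unfolding H_eq[OF that] using i1 fint[OF that] by (subst Bochner_Integration.integral_diff) auto
    also have "norm \<dots> \<le> e n"
      unfolding e_def
    proof (rule Bochner_Integration.integral_norm_bound_integral)
      show "integrable lborel (\<lambda>\<xi>. indicator (K n) \<xi> *\<^sub>R ?f w \<xi> - ?f w \<xi>)" using i1 fint[OF that] by auto
      show "integrable lborel (\<lambda>\<xi>. indicator (- K n) \<xi> * (C * exp (- (c / 2 * norm \<xi>))))"
        using integrable_mult_indicator[OF _ dom, of "- K n"] by (simp add: K_def)
      show "norm (indicator (K n) \<xi> *\<^sub>R ?f w \<xi> - ?f w \<xi>) \<le> indicator (- K n) \<xi> * (C * exp (- (c / 2 * norm \<xi>)))" for \<xi>
        using bound[OF that, of \<xi>] by (auto simp: indicator_def)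
    qed
    finally show ?thesis .
  qed
  show ?thesis
  proof (rule holomorphic_uniform_sequence[OF openS holH])
    fix w0 assume "w0 \<in> ?S"
    then obtain d where d: "d > 0" "cball w0 d \<subseteq> ?S" using openS open_contains_cball by blast
    have "uniform_limit (cball w0 d) H (\<lambda>w. \<integral>\<xi>. ?f w \<xi> \<partial>lborel) sequentially"
    proof (rule uniform_limitI)
      fix \<epsilon> :: real assume "\<epsilon> > 0"
      then have "eventually (\<lambda>n. e n < \<epsilon>) sequentially" using e_lim by (auto intro: order_tendstoD)
      then show "eventually (\<lambda>n. \<forall>w\<in>cball w0 d. dist (H n w) (\<integral>\<xi>. ?f w \<xi> \<partial>lborel) < \<epsilon>) sequentially"
      proof eventually_elim
        case (elim n)
        show ?case
        proof
          fix w assume "w \<in> cball w0 d"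
          then have "w \<in> ?S" using d(2) by blast
          from near[OF this, of n] elim show "dist (H n w) (\<integral>\<xi>. ?f w \<xi> \<partial>lborel) < \<epsilon>"
            unfolding dist_norm by linarith
        qed
      qed
    qed
    then show "\<exists>d>0. cball w0 d \<subseteq> ?S \<and> uniform_limit (cball w0 d) H (\<lambda>w. \<integral>\<xi>. ?f w \<xi> \<partial>lborel) sequentially"
      using d by blast
  qed
qed

text \<open>With \<open>p\<close> the transform of \<open>\<phi>\<close>, the transform of \<open>\<phi>\<^sup>2\<close> is a multiple of the convolution
  of \<open>p\<close> with itself. If it vanishes at \<open>x\<close>, then
  \<open>p z * p (x - z) = 0\<close> for all \<open>z\<close>; as \<open>p > 0\<close> near \<open>0\<close>, the real-analytic function \<open>\<theta> \<mapsto> p (\<theta> x)\<close> vanishes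
  near \<open>\<theta> = 1\<close>, hence everywhere, contradicting \<open>p 0 > 0\<close>.\<close>

lemma ft_square_pos:
  fixes \<phi> :: "'a::euclidean_space \<Rightarrow> real"
  assumes cont: "continuous_on UNIV \<phi>" and pos: "\<And>\<xi>. 0 < \<phi> \<xi>"
    and bd: "\<And>\<xi>. \<phi> \<xi> \<le> C * exp (- (c * norm \<xi>))" and c: "0 < c"
    and even: "\<And>x. \<phi> (- x) = \<phi> x" and nn: "\<And>x. 0 \<le> Re (ftr \<phi> x)"
  shows "0 < Re (ft (\<lambda>\<xi>. of_real ((\<phi> \<xi>)\<^sup>2)) x)"
proof (rule ccontr)
  assume neg: "\<not> ?thesis"
  have [measurable]: "\<phi> \<in> borel_measurable borel" using cont by (rule borel_measurable_continuous_onI)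
  have C0: "0 < C" using bd[of 0] pos[of 0] by simp
  have int: "integrable lborel \<phi>"
  proof (rule Bochner_Integration.integrable_bound)
    show "integrable lborel (\<lambda>\<xi>::'a. C * exp (- (c * norm \<xi>)))"
      using c by (intro integrable_mult_right integrable_exp_norm)
    show "AE \<xi> in lborel. norm (\<phi> \<xi>) \<le> norm (C * exp (- (c * norm \<xi>)))"
      using C0 by (intro AE_I2) (simp add: abs_of_pos[OF pos] abs_mult bd)
  qed simp
  have bdB: "\<bar>\<phi> \<xi>\<bar> \<le> C" for \<xi>
  proof -
    have "C * exp (- (c * norm \<xi>)) \<le> C * 1" using C0 c by (intro mult_left_mono) auto
    then show ?thesis using bd[of \<xi>] pos[of \<xi>] by simp
  qed
  define w where "w = (\<lambda>\<xi>. complex_of_real (\<phi> \<xi>))"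
  have w: "integrable lborel w" using int by (simp add: w_def)
  define p where "p z = Re (ft w z)" for z
  have ftp: "ft w z = of_real (p z)" for z
    unfolding p_def w_def by (rule ft_even_real[OF int even])
  have pcont: "continuous_on UNIV p" unfolding p_def by (intro continuous_intros continuous_ft w)
  have p0: "0 \<le> p z" for z using nn by (simp add: p_def w_def)
  have zero: "p z * p (x - z) = 0" for z
  proof -
    define g where "g z = gauss 1 z * (p z * p (x - z))" for z
    have "(\<integral>z. g z \<partial>lborel) \<le> (2 * pi) ^ DIM('a) * Re (ft (\<lambda>\<xi>. of_real ((\<phi> \<xi>)\<^sup>2)) x)"
      unfolding g_def p_def w_def by (rule ft_square_lower[OF int cont bdB even nn])
    also have "\<dots> \<le> 0" using neg by (intro mult_nonneg_nonpos) auto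
    finally have le: "(\<integral>z. g z \<partial>lborel) \<le> 0" .
    have [measurable]: "p \<in> borel_measurable borel" using pcont by (rule borel_measurable_continuous_onI)
    define D where "D = (\<integral>\<xi>. norm (w \<xi>) \<partial>lborel)"
    have pD: "p z \<le> D" for z using norm_ft_le[of w z] by (simp add: ftp D_def p0)
    have D0: "0 \<le> D" using pD p0 order_trans by blast
    have gi: "integrable lborel g"
    proof (rule Bochner_Integration.integrable_bound)
      show "integrable lborel (\<lambda>z::'a. (D * D) * gauss 1 z)" using integrable_gauss[of 1] by auto
      show "AE z in lborel. norm (g z) \<le> norm (D * D * gauss 1 z)"
      proof (rule AE_I2)
        fix z
        have "p z * p (x - z) \<le> D * D" using pD p0 D0 by (intro mult_mono) auto
        then have "gauss 1 z * (p z * p (x - z)) \<le> gauss 1 z * (D * D)"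
          by (intro mult_left_mono) (simp_all add: gauss_pos less_imp_le)
        moreover have "0 \<le> g z" "0 \<le> D * D * gauss 1 z"
          using D0 by (simp_all add: g_def p0 gauss_pos less_imp_le)
        ultimately show "norm (g z) \<le> norm (D * D * gauss 1 z)"
          by (simp add: g_def mult.commute)
      qed
    qed (simp add: g_def[abs_def])
    have "continuous_on UNIV g" unfolding g_def[abs_def] gauss_def
      by (intro continuous_intros continuous_on_compose2[OF pcont]) auto
    then have "g z = 0"
      by (rule continuous_nonneg_integral_0[OF _ gi _ le]) (simp add: g_def p0 gauss_pos less_imp_le)
    then show ?thesis using gauss_pos[of 1 z] by (auto simp: g_def)
  qed
  have pz: "p 0 > 0"
  proof -
    have eq: "p 0 = (\<integral>\<xi>. \<phi> \<xi> \<partial>lborel)" by (simp add: p_def ft_def w_def)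
    have "(\<integral>\<xi>. \<phi> \<xi> \<partial>lborel) > 0"
    proof (rule ccontr)
      assume "\<not> ?thesis"
      then have "(\<integral>\<xi>. \<phi> \<xi> \<partial>lborel) \<le> 0" by simp
      then have "\<phi> 0 = 0" using continuous_nonneg_integral_0[OF cont int] pos less_imp_le by blast
      then show False using pos[of 0] by simp
    qed
    then show ?thesis using eq by simp
  qed
  have "\<exists>\<eta>>0. \<forall>\<theta>::real. \<bar>\<theta>\<bar> < \<eta> \<longrightarrow> p (\<theta> *\<^sub>R x) > 0"
  proof -
    have "continuous_on UNIV (\<lambda>\<theta>::real. p (\<theta> *\<^sub>R x))"
      by (rule continuous_on_compose2[OF pcont]) (auto intro!: continuous_intros)
    then have "isCont (\<lambda>\<theta>::real. p (\<theta> *\<^sub>R x)) 0" by (simp add: continuous_on_eq_continuous_at)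
    then have "(\<lambda>\<theta>::real. p (\<theta> *\<^sub>R x)) \<midarrow>0\<rightarrow> p (0 *\<^sub>R x)" by (simp add: isCont_def)
    then have "eventually (\<lambda>\<theta>::real. p (\<theta> *\<^sub>R x) > 0) (at 0)" using pz by (intro order_tendstoD(1)[of _ "p (0 *\<^sub>R x)"]) auto
    then obtain \<eta> where "\<eta> > 0" and h: "\<And>\<theta>. \<theta> \<noteq> 0 \<Longrightarrow> dist \<theta> 0 < \<eta> \<Longrightarrow> p (\<theta> *\<^sub>R x) > 0"
      unfolding eventually_at by auto
    have "p (\<theta> *\<^sub>R x) > 0" if "\<bar>\<theta>\<bar> < \<eta>" for \<theta>
    proof (cases "\<theta> = 0")
      case True
      then show ?thesis using pz by simp
    next
      case False
      then show ?thesis by (rule h) (use that in \<open>simp add: dist_real_def\<close>)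
    qed
    then show ?thesis using \<open>\<eta> > 0\<close> by blast
  qed
  then obtain \<eta> where \<eta>: "\<eta> > 0" "\<And>\<theta>::real. \<bar>\<theta>\<bar> < \<eta> \<Longrightarrow> p (\<theta> *\<^sub>R x) > 0" by blast
  \<comment> \<open>Half of the decay rate is reserved for the imaginary part of the argument. The
    summand 1 covers \<open>x = 0\<close>.\<close>
  define r where "r = c / (2 * (norm x + 1))"
  have r: "0 < r" "r * norm x \<le> c / 2"
  proof -
    have n: "0 < norm x + 1" by (simp add: add_nonneg_pos)
    then show "0 < r" using c by (simp add: r_def)
    have "r * norm x = c / 2 * (norm x / (norm x + 1))" by (simp add: r_def)
    also have "\<dots> \<le> c / 2 * 1" using n c by (intro mult_left_mono) auto
    finally show "r * norm x \<le> c / 2" by simp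
  qed
  define H where "H w = (\<integral>\<xi>. of_real (\<phi> \<xi>) * exp (\<i> * w * of_real (\<xi> \<bullet> x)) \<partial>lborel)" for w
  have hol: "H holomorphic_on {w. \<bar>Im w\<bar> < r}"
    unfolding H_def by (rule holomorphic_exp_integral[OF cont _ c r(2), where C=C]) (simp add: abs_of_pos[OF pos] bd)
  have H_real: "H (of_real \<theta>) = of_real (p (\<theta> *\<^sub>R x))" for \<theta>
    unfolding H_def ftp[symmetric] ft_def w_def cis_conv_exp by (simp add: mult_ac)
  have "H 0 = 0"
  proof (rule analytic_continuation[OF hol, where U="of_real ` {1 - \<eta><..<1 + \<eta>}" and \<xi>=1])
    have S: "{w. \<bar>Im w\<bar> < r} = {w. Im w < r} \<inter> {w. - r < Im w}" by auto
    show "open {w. \<bar>Im w\<bar> < r}" unfolding S by (intro open_Int open_halfspace_Im_lt open_halfspace_Im_gt)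
    show "connected {w. \<bar>Im w\<bar> < r}" unfolding S by (intro convex_connected convex_Int convex_halfspace_Im_lt convex_halfspace_Im_gt)
    show "complex_of_real ` {1 - \<eta><..<1 + \<eta>} \<subseteq> {w. \<bar>Im w\<bar> < r}" using r by auto
    show "1 islimpt complex_of_real ` {1 - \<eta><..<1 + \<eta>}"
      unfolding islimpt_approachable
    proof (intro allI impI)
      fix e :: real assume "e > 0"
      define \<theta> where "\<theta> = 1 + min e \<eta> / 2"
      have "\<theta> \<in> {1 - \<eta><..<1 + \<eta>}" "\<theta> \<noteq> 1" "dist \<theta> 1 < e" using \<open>e > 0\<close> \<eta>(1) by (auto simp: \<theta>_def dist_real_def min_def)
      then show "\<exists>x'\<in>complex_of_real ` {1 - \<eta><..<1 + \<eta>}. x' \<noteq> 1 \<and> dist x' 1 < e"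
      proof (intro bexI[of _ "complex_of_real \<theta>"] conjI)
        show "complex_of_real \<theta> \<noteq> 1" using \<open>\<theta> \<noteq> 1\<close> by simp
        show "dist (complex_of_real \<theta>) 1 < e"
          using \<open>dist \<theta> 1 < e\<close> dist_of_real[of \<theta> 1, where 'a=complex] by simp
      qed blast
    qed
    show "H z = 0" if z: "z \<in> complex_of_real ` {1 - \<eta><..<1 + \<eta>}" for z
    proof -
      obtain \<theta> where \<theta>: "z = of_real \<theta>" "\<theta> \<in> {1 - \<eta><..<1 + \<eta>}" using z by blast
      have "p ((1 - \<theta>) *\<^sub>R x) > 0" using \<theta> by (intro \<eta>) auto
      moreover have "x - (1 - \<theta>) *\<^sub>R x = \<theta> *\<^sub>R x" by (simp add: algebra_simps)
      ultimately have "p (\<theta> *\<^sub>R x) = 0" using zero[of "(1 - \<theta>) *\<^sub>R x"] by auto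
      then show ?thesis by (simp add: \<theta> H_real)
    qed
  qed (simp_all add: r)
  then show False using H_real[of 0] pz by (metis of_real_0 of_real_eq_0_iff order_less_irrefl scaleR_zero_left)
qed

lemma norm_cis_minus_1_le: "norm (cis x - 1) \<le> \<bar>x\<bar>"
  using iexp_approx1[of x 0] by (simp add: cis_conv_exp)

section \<open>Averaging over the jump time\<close>

text \<open>\<open>w\<close> is the phase that a jump would contribute without drift; \<tau> time
  units after the jump the drift has contracted it to \<open>exp (- \<tau>) * w\<close>.\<close>

definition osc :: "real \<Rightarrow> real \<Rightarrow> complex" where
  "osc t w = (\<integral>\<tau>\<in>{0..t}. cis (exp (- \<tau>) * w) \<partial>lborel)"

lemma integrable_osc: "set_integrable lborel {0..t} (\<lambda>\<tau>. cis (exp (- \<tau>) * w))"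
  by (intro borel_integrable_atLeastAtMost' continuous_intros)

lemma integrable_indicator_Icc: fixes a b :: real shows "integrable lborel (indicat_real {a..b})"
  by (rule integrable_real_indicator) (auto simp: emeasure_lborel_Icc_eq)

lemma integral_const_Icc: "0 \<le> t \<Longrightarrow> (\<integral>\<tau>\<in>{0..t}. c \<partial>lborel) = t *\<^sub>R (c::'b::euclidean_space)"
  by (simp add: set_lebesgue_integral_def)

lemma norm_osc_le: assumes "0 \<le> t" shows "norm (osc t w) \<le> t"
proof -
  have "norm (osc t w) \<le> (\<integral>\<tau>\<in>{0..t}. 1 \<partial>lborel)"
    unfolding osc_def set_lebesgue_integral_def
    by (rule Bochner_Integration.integral_norm_bound_integral)
       (use integrable_osc[of t w] integrable_indicator_Icc in \<open>auto simp: set_integrable_def\<close>)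
  then show ?thesis using assms integral_const_Icc[of t "1::real"] by simp
qed

text \<open>One integration by parts, the phase having no stationary point. The derivative of
  \<open>F\<close> is the integrand plus \<open>g\<close>. The boundary terms contribute
  \<open>(exp t + 1) / \<bar>w\<bar>\<close> and the integral of \<open>g\<close> at most
  \<open>(exp t - 1) / \<bar>w\<bar>\<close>.\<close>

lemma norm_osc_decay:
  assumes "0 \<le> t" "w \<noteq> 0"
  shows "norm (osc t w) \<le> 2 * exp t / \<bar>w\<bar>"
proof -
  define F where "F z = (\<i> * exp z / of_real w) * exp (\<i> * (exp (- z) * of_real w))" for z
  define g where "g \<tau> = \<i> * of_real (exp \<tau>) * cis (exp (- \<tau>) * w) / of_real w" for \<tau>
  have "(F has_field_derivative (\<i> * exp z / of_real w * exp (\<i> * (exp (- z) * of_real w)) + exp (\<i> * (exp (- z) * of_real w)))) (at z)" for z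
    unfolding F_def using assms
    by (auto intro!: derivative_eq_intros simp: exp_minus field_simps)
  then have "((\<lambda>\<tau>. F (of_real \<tau>)) has_vector_derivative (\<i> * exp (of_real \<tau>) / of_real w * exp (\<i> * (exp (- of_real \<tau>) * of_real w)) + exp (\<i> * (exp (- of_real \<tau>) * of_real w)))) (at \<tau> within {0..t})" for \<tau>
    by (rule has_vector_derivative_real_field)
  moreover have "exp (\<i> * (exp (- of_real \<tau>) * of_real w)) = cis (exp (- \<tau>) * w)" for \<tau>
    by (simp add: cis_conv_exp flip: exp_of_real)
  ultimately have der: "((\<lambda>\<tau>. F (of_real \<tau>)) has_vector_derivative (g \<tau> + cis (exp (- \<tau>) * w))) (at \<tau> within {0..t})" for \<tau>
    by (simp add: g_def exp_of_real)
  have contg: "continuous_on {0..t} g" unfolding g_def using assms by (intro continuous_intros) auto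
  have "(\<integral>\<tau>. indicat_real {0..t} \<tau> *\<^sub>R (g \<tau> + cis (exp (- \<tau>) * w)) \<partial>lborel) = F (of_real t) - F (of_real 0)"
    by (rule integral_FTC_atLeastAtMost[OF assms(1) der]) (intro continuous_intros contg)
  moreover have gi: "set_integrable lborel {0..t} g" by (rule borel_integrable_atLeastAtMost'[OF contg])
  ultimately have eq: "(\<integral>\<tau>\<in>{0..t}. g \<tau> \<partial>lborel) + osc t w = F (of_real t) - F (of_real 0)"
    unfolding osc_def using set_integral_add[OF gi integrable_osc[of t w]]
    by (simp add: set_lebesgue_integral_def)
  have nF: "norm (F (of_real \<tau>)) = exp \<tau> / \<bar>w\<bar>" for \<tau>
  proof -
    have "F (of_real \<tau>) = \<i> * of_real (exp \<tau> / w) * cis (exp (- \<tau>) * w)"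
      unfolding F_def by (simp add: cis_conv_exp exp_of_real flip: exp_of_real)
    then show ?thesis by (simp add: norm_mult norm_divide)
  qed
  have ex: "(\<integral>\<tau>. indicat_real {0..t} \<tau> *\<^sub>R (exp \<tau> / \<bar>w\<bar>) \<partial>lborel) = exp t / \<bar>w\<bar> - exp 0 / \<bar>w\<bar>"
    by (rule integral_FTC_atLeastAtMost[OF assms(1)])
       (use assms in \<open>auto intro!: continuous_intros has_field_derivative_at_within[OF DERIV_cdivide[OF DERIV_exp]]
          simp: has_real_derivative_iff_has_vector_derivative[symmetric]\<close>)
  have "norm (\<integral>\<tau>\<in>{0..t}. g \<tau> \<partial>lborel) \<le> (\<integral>\<tau>. indicat_real {0..t} \<tau> *\<^sub>R (exp \<tau> / \<bar>w\<bar>) \<partial>lborel)"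
    unfolding set_lebesgue_integral_def
  proof (rule Bochner_Integration.integral_norm_bound_integral)
    show "integrable lborel (\<lambda>\<tau>. indicat_real {0..t} \<tau> *\<^sub>R (exp \<tau> / \<bar>w\<bar>))"
      using borel_integrable_atLeastAtMost'[of 0 t "\<lambda>\<tau>. exp \<tau> / \<bar>w\<bar>"] assms
      unfolding set_integrable_def by (simp add: continuous_intros)
  qed (use gi in \<open>auto simp: set_integrable_def g_def norm_mult norm_divide\<close>)
  then have "norm (\<integral>\<tau>\<in>{0..t}. g \<tau> \<partial>lborel) \<le> exp t / \<bar>w\<bar> - 1 / \<bar>w\<bar>" using ex by simp
  moreover have "norm (osc t w) \<le> norm (F (of_real t)) + norm (F (of_real 0)) + norm (\<integral>\<tau>\<in>{0..t}. g \<tau> \<partial>lborel)"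
  proof -
    have e: "osc t w = F (of_real t) - F (of_real 0) - (\<integral>\<tau>\<in>{0..t}. g \<tau> \<partial>lborel)" using eq by (simp add: algebra_simps)
    show ?thesis unfolding e
      using norm_triangle_ineq4[of "F (of_real t) - F (of_real 0)" "\<integral>\<tau>\<in>{0..t}. g \<tau> \<partial>lborel"]
        norm_triangle_ineq4[of "F (of_real t)" "F (of_real 0)"] by linarith
  qed
  ultimately show ?thesis unfolding nF by simp
qed

lemma osc_lipschitz:
  assumes "0 \<le> t"
  shows "norm (osc t v - osc t w) \<le> t * \<bar>v - w\<bar>"
proof -
  have cl: "norm (cis a - cis b) \<le> \<bar>a - b\<bar>" for a b
  proof -
    have "cis a - cis b = cis b * (cis (a - b) - 1)" by (simp add: algebra_simps cis_mult)
    then show ?thesis using norm_cis_minus_1_le by (simp add: norm_mult)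
  qed
  have "osc t v - osc t w = (\<integral>\<tau>\<in>{0..t}. cis (exp (- \<tau>) * v) - cis (exp (- \<tau>) * w) \<partial>lborel)"
    unfolding osc_def by (rule set_integral_diff(2)[symmetric]) (rule integrable_osc)+
  also have "norm \<dots> \<le> (\<integral>\<tau>\<in>{0..t}. \<bar>v - w\<bar> \<partial>lborel)"
    unfolding set_lebesgue_integral_def
  proof (rule Bochner_Integration.integral_norm_bound_integral)
    show "integrable lborel (\<lambda>\<tau>. indicat_real {0..t} \<tau> *\<^sub>R (cis (exp (- \<tau>) * v) - cis (exp (- \<tau>) * w)))"
      using set_integral_diff(1)[OF integrable_osc[of t v] integrable_osc[of t w]] by (simp add: set_integrable_def)
    show "norm (indicat_real {0..t} \<tau> *\<^sub>R (cis (exp (- \<tau>) * v) - cis (exp (- \<tau>) * w))) \<le> indicat_real {0..t} \<tau> *\<^sub>R \<bar>v - w\<bar>" for \<tau>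
    proof (cases "\<tau> \<in> {0..t}")
      case True
      have "norm (cis (exp (- \<tau>) * v) - cis (exp (- \<tau>) * w)) \<le> exp (- \<tau>) * \<bar>v - w\<bar>"
        using cl[of "exp (- \<tau>) * v" "exp (- \<tau>) * w"] by (simp add: right_diff_distrib[symmetric] abs_mult)
      also have "\<dots> \<le> 1 * \<bar>v - w\<bar>" using True by (intro mult_right_mono) auto
      finally show ?thesis using True by simp
    qed simp
  qed (simp add: integrable_indicator_Icc)
  also have "\<dots> = t * \<bar>v - w\<bar>" using integral_const_Icc[OF assms, of "\<bar>v - w\<bar>"] by simp
  finally show ?thesis .
qed

lemma osc_0: "0 \<le> t \<Longrightarrow> osc t 0 = of_real t"
  using integral_const_Icc[of t "1::complex"] by (simp add: osc_def scaleR_conv_of_real)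

lemma continuous_osc: assumes "0 \<le> t" shows "continuous_on UNIV (osc t)"
proof -
  have "t-lipschitz_on UNIV (osc t)"
    by (rule lipschitz_onI) (use osc_lipschitz[OF assms] assms in \<open>auto simp: dist_norm\<close>)
  then show ?thesis by (rule lipschitz_on_continuous_on)
qed

lemma borel_measurable_osc [measurable]: "0 \<le> t \<Longrightarrow> osc t \<in> borel_measurable borel"
  by (intro borel_measurable_continuous_onI continuous_osc)

section \<open>Coercivity of the averaged phase\<close>

lemma one_minus_cos_ge: fixes v :: real assumes "\<bar>v\<bar> \<le> 1" shows "v\<^sup>2 / 4 \<le> 1 - cos v"
proof -
  define x where "x = \<bar>v\<bar> / 2"
  have x: "0 \<le> x" "x \<le> 1/2" using assms by (auto simp: x_def)
  have "\<bar>sin x - (\<Sum>m<3. sin_coeff m * x ^ m)\<bar> \<le> inverse (fact 3) * \<bar>x\<bar> ^ 3" by (rule Maclaurin_sin_bound)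
  then have "\<bar>sin x - x\<bar> \<le> x ^ 3 / 6" using x by (simp add: sin_coeff_def eval_nat_numeral)
  moreover have "x ^ 3 / 6 \<le> x / 24"
  proof -
    have "x ^ 2 \<le> (1/2)^2" using x by (intro power_mono) auto
    then have "x * x ^ 2 \<le> x * (1/4)" using x by (intro mult_left_mono) (auto simp: power2_eq_square)
    then show ?thesis by (simp add: power3_eq_cube power2_eq_square)
  qed
  ultimately have "sin x \<ge> 23 / 24 * x" by linarith
  then have "(23 / 24 * x)\<^sup>2 \<le> (sin x)\<^sup>2" using x by (intro power_mono) auto
  moreover have "cos v = 1 - 2 * (sin x)\<^sup>2"
    using cos_double_sin[of x] by (auto simp: x_def abs_if split: if_splits)
  moreover have "v\<^sup>2 = 4 * x\<^sup>2" by (simp add: x_def power_divide)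
  moreover have "0 \<le> (sin x)\<^sup>2" "(23 / 24 * x)\<^sup>2 = 529 / 576 * x\<^sup>2" by (simp_all add: power_mult_distrib power_divide)
  ultimately show ?thesis by linarith
qed

lemma Re_osc: "0 \<le> t \<Longrightarrow> t - Re (osc t w) = (\<integral>\<tau>\<in>{0..t}. 1 - cos (exp (- \<tau>) * w) \<partial>lborel)"
proof -
  assume t: "0 \<le> t"
  have i: "set_integrable lborel {0..t} (\<lambda>\<tau>. cos (exp (- \<tau>) * w))" "set_integrable lborel {0..t} (\<lambda>\<tau>::real. 1::real)"
    by (intro borel_integrable_atLeastAtMost' continuous_intros)+
  have "Re (osc t w) = (\<integral>\<tau>\<in>{0..t}. cos (exp (- \<tau>) * w) \<partial>lborel)"
    unfolding osc_def set_lebesgue_integral_def using integrable_osc[of t w]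
    by (subst integral_Re[symmetric]) (auto simp: set_integrable_def)
  then show ?thesis using set_integral_diff(2)[OF i(2) i(1)] integral_const_Icc[OF t, of "1::real"] by simp
qed

text \<open>If the right side vanished at some w \<noteq> 0, the phase
  \<open>exp (- \<tau>) * w\<close> would stay in the discrete set of multiples of 2 pi although it
  moves with \<tau>. So it is positive, and compactness treats a middle range of \<open>w\<close>;
  small \<open>w\<close> follow from the quadratic bound on the cosine, large ones from
  \<open>norm_osc_decay\<close>.\<close>

lemma osc_coercive:
  assumes t: "0 < t"
  shows "\<exists>\<kappa>>0. \<forall>w. \<kappa> * min 1 (w\<^sup>2) \<le> t - Re (osc t w)"
proof -
  define g where "g w = t - Re (osc t w)" for w
  have int: "set_integrable lborel {0..t} (\<lambda>\<tau>. 1 - cos (exp (- \<tau>) * w))" for w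
    by (intro borel_integrable_atLeastAtMost' continuous_intros)
  have gcont: "continuous_on UNIV g" unfolding g_def using t by (intro continuous_intros continuous_osc) auto
  have gpos: "g w > 0" if "w \<noteq> 0" for w
  proof -
    have 0: "g w \<ge> 0" unfolding g_def using t
      by (subst Re_osc) (auto simp: set_lebesgue_integral_def intro!: integral_nonneg_AE)
    moreover have "g w \<noteq> 0"
    proof
      assume "g w = 0"
      then have "(\<integral>\<tau>. indicat_real {0..t} \<tau> *\<^sub>R (1 - cos (exp (- \<tau>) * w)) \<partial>lborel) = 0"
        using t by (simp add: g_def Re_osc set_lebesgue_integral_def)
      then have hi: "integral {0..t} (\<lambda>\<tau>. 1 - cos (exp (- \<tau>) * w)) = 0"
        using set_borel_integral_eq_integral(2)[OF int[of w]] by (simp add: set_lebesgue_integral_def)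
      have cc: "continuous_on {0..t} (\<lambda>\<tau>. 1 - cos (exp (- \<tau>) * w))" by (intro continuous_intros)
      have "1 - cos (exp (- \<tau>) * w) = 0" if "\<tau> \<in> {0..t}" for \<tau>
      proof -
        have "((\<lambda>\<tau>. 1 - cos (exp (- \<tau>) * w)) has_integral 0) (cbox 0 t)"
          using hi integrable_integral[OF integrable_continuous_real[OF cc]] by simp
        then show ?thesis
          using has_integral_0_cbox_imp_0[of 0 t "\<lambda>\<tau>. 1 - cos (exp (- \<tau>) * w)" \<tau>] t that cc
          by (auto simp: cos_le_one)
      qed
      then have c1: "cos (exp (- \<tau>) * w) = 1" if "\<tau> \<in> {0..t}" for \<tau> using that by force
      obtain \<tau> where \<tau>: "\<tau> \<in> {0..t}" "exp (- \<tau>) * \<bar>w\<bar> \<noteq> 0" "\<exists>\<tau>'\<in>{0..t}. 0 < \<bar>exp (- \<tau>) * w - exp (- \<tau>') * w\<bar> \<and> \<bar>exp (- \<tau>) * w - exp (- \<tau>') * w\<bar> < 2 * pi"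
      proof -
        \<comment> \<open>So early that the phase has moved by at most 1, which is less than 2 pi,
          but has moved.\<close>
        define \<tau>' where "\<tau>' = min t (1 / (\<bar>w\<bar> + 1))"
        have p: "0 < \<tau>'" "\<tau>' \<le> t" "\<tau>' \<le> 1 / (\<bar>w\<bar> + 1)" using t by (auto simp: \<tau>'_def intro!: divide_pos_pos add_nonneg_pos)
        have "1 - exp (- \<tau>') \<le> \<tau>'" using exp_ge_add_one_self[of "- \<tau>'"] by linarith
        moreover have "0 < 1 - exp (- \<tau>')" using p by simp
        ultimately have "\<bar>w\<bar> * (1 - exp (- \<tau>')) \<le> \<bar>w\<bar> * (1 / (\<bar>w\<bar> + 1))" using p by (intro mult_left_mono) auto
        also have "\<dots> \<le> 1" by (simp add: field_simps)
        finally have "\<bar>w\<bar> * (1 - exp (- \<tau>')) \<le> 1" .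
        moreover have "\<bar>exp (- 0) * w - exp (- \<tau>') * w\<bar> = \<bar>w\<bar> * (1 - exp (- \<tau>'))"
        proof -
          have "exp (- 0) * w - exp (- \<tau>') * w = w * (1 - exp (- \<tau>'))" by (simp add: algebra_simps)
          then show ?thesis using \<open>0 < 1 - exp (- \<tau>')\<close> by (simp only: abs_mult abs_of_pos)
        qed
        moreover have "2 * pi > 1" using pi_gt3 by simp
        moreover have "0 < \<bar>w\<bar> * (1 - exp (- \<tau>'))" using \<open>w \<noteq> 0\<close> \<open>0 < 1 - exp (- \<tau>')\<close> by simp
        ultimately show ?thesis using p t \<open>w \<noteq> 0\<close> by (intro that[of 0] bexI[of _ \<tau>']) auto
      qed
      then obtain \<tau>' where \<tau>': "\<tau>' \<in> {0..t}" "0 < \<bar>exp (- \<tau>) * w - exp (- \<tau>') * w\<bar>" "\<bar>exp (- \<tau>) * w - exp (- \<tau>') * w\<bar> < 2 * pi" by blast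
      obtain i where i: "exp (- \<tau>) * w = real_of_int i * (2 * pi)"
        using c1[OF \<tau>(1)] cos_one_2pi_int[of "exp (- \<tau>) * w"] by (auto simp: mult.assoc)
      obtain j where j: "exp (- \<tau>') * w = real_of_int j * (2 * pi)"
        using c1[OF \<tau>'(1)] cos_one_2pi_int[of "exp (- \<tau>') * w"] by (auto simp: mult.assoc)
      have "\<bar>real_of_int (i - j)\<bar> * (2 * pi) = \<bar>exp (- \<tau>) * w - exp (- \<tau>') * w\<bar>"
        unfolding i j by (simp add: left_diff_distrib[symmetric] abs_mult)
      with \<tau>' have "0 < \<bar>real_of_int (i - j)\<bar> * (2 * pi)" "\<bar>real_of_int (i - j)\<bar> * (2 * pi) < 1 * (2 * pi)" by auto
      then have "0 < \<bar>real_of_int (i - j)\<bar>" "\<bar>real_of_int (i - j)\<bar> < 1"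
        by (auto simp: zero_less_mult_iff mult_less_cancel_right)
      then have "0 < \<bar>i - j\<bar>" "real_of_int \<bar>i - j\<bar> < real_of_int 1" by auto
      then show False unfolding of_int_less_iff by linarith
    qed
    ultimately show ?thesis by simp
  qed
  \<comment> \<open>Beyond \<open>W\<close> the decay estimate gives at most \<open>t / 2\<close>.
    The summand 1 makes the middle range nonempty.\<close>
  define W where "W = 4 * exp t / t + 1"
  have W: "W > 1" using t by (simp add: W_def)
  define K where "K = {w::real. 1 \<le> \<bar>w\<bar> \<and> \<bar>w\<bar> \<le> W}"
  have "K = {1..W} \<union> {-W..-1}" by (auto simp: K_def)
  then have "compact K" by (auto intro: compact_Un)
  moreover have "K \<noteq> {}" using W by (auto simp: K_def intro!: exI[of _ 1])
  ultimately obtain w0 where w0: "w0 \<in> K" "\<And>w. w \<in> K \<Longrightarrow> g w0 \<le> g w"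
    using continuous_attains_inf[of K g] continuous_on_subset[OF gcont] by (metis subset_UNIV)
  define \<kappa> where "\<kappa> = min (g w0) (min (t / 2) (t * exp (- 2 * t) / 4))"
  have gw0: "g w0 > 0" using w0(1) by (intro gpos) (auto simp: K_def)
  have "\<kappa> * min 1 (w\<^sup>2) \<le> g w" for w
  proof -
    consider "\<bar>w\<bar> < 1" | "w \<in> K" | "\<bar>w\<bar> > W" unfolding K_def by fastforce
    then show ?thesis
    proof cases
      case 1
      have "(\<integral>\<tau>\<in>{0..t}. exp (- 2 * t) / 4 * w\<^sup>2 \<partial>lborel) \<le> (\<integral>\<tau>\<in>{0..t}. 1 - cos (exp (- \<tau>) * w) \<partial>lborel)"
      proof (rule set_integral_mono[OF _ int])
        show "set_integrable lborel {0..t} (\<lambda>\<tau>. exp (- 2 * t) / 4 * w\<^sup>2)"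
          by (intro borel_integrable_atLeastAtMost' continuous_intros)
        fix \<tau> assume \<tau>: "\<tau> \<in> {0..t}"
        have "exp (- \<tau>) * \<bar>w\<bar> \<le> 1 * 1" using 1 \<tau> by (intro mult_mono) auto
        then have "(exp (- \<tau>) * w)\<^sup>2 / 4 \<le> 1 - cos (exp (- \<tau>) * w)" by (intro one_minus_cos_ge) (simp add: abs_mult)
        moreover have "exp (- 2 * t) \<le> (exp (- \<tau>))\<^sup>2" using \<tau> by (simp add: exp_double[symmetric])
        then have "exp (- 2 * t) / 4 * w\<^sup>2 \<le> (exp (- \<tau>) * w)\<^sup>2 / 4" by (simp add: power_mult_distrib mult_right_mono)
        ultimately show "exp (- 2 * t) / 4 * w\<^sup>2 \<le> 1 - cos (exp (- \<tau>) * w)" by linarith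
      qed
      then have "t * (exp (- 2 * t) / 4 * w\<^sup>2) \<le> g w" 
        by (simp only: integral_const_Icc[OF less_imp_le[OF t]] g_def Re_osc[OF less_imp_le[OF t]] real_scaleR_def)
      moreover have "\<kappa> * min 1 (w\<^sup>2) \<le> (t * exp (- 2 * t) / 4) * w\<^sup>2"
        using t gw0 by (intro mult_mono) (auto simp: \<kappa>_def)
      ultimately show ?thesis by (simp add: mult_ac)
    next
      case 2
      have "\<kappa> * min 1 (w\<^sup>2) \<le> g w0 * 1" using t gw0 by (intro mult_mono) (auto simp: \<kappa>_def)
      then show ?thesis using w0(2)[OF 2] by simp
    next
      case 3
      then have w: "w \<noteq> 0" "4 * exp t / t \<le> \<bar>w\<bar>" using W by (auto simp: W_def)
      have "norm (osc t w) \<le> 2 * exp t / \<bar>w\<bar>" using t w by (intro norm_osc_decay) auto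
      also have "\<dots> \<le> t / 2" using t w by (simp add: field_simps)
      finally have "Re (osc t w) \<le> t / 2" using complex_Re_le_cmod order_trans by blast
      then have "t / 2 \<le> g w" by (simp add: g_def)
      moreover have "\<kappa> * min 1 (w\<^sup>2) \<le> t / 2 * 1" using t gw0 by (intro mult_mono) (auto simp: \<kappa>_def)
      ultimately show ?thesis by simp
    qed
  qed
  moreover have "\<kappa> > 0" using t gw0 by (simp add: \<kappa>_def)
  ultimately show ?thesis unfolding g_def by blast
qed

section \<open>The jump measure\<close>

lemma prob_densityD:
  assumes "prob_density f"
  shows "f \<in> borel_measurable borel" "\<And>x. 0 \<le> f x" "integrable lborel f" "(\<integral>x. f x \<partial>lborel) = 1"
  using assms by (auto simp: prob_density_def)

text \<open>Transform of the law of \<open>exp (-\<tau>) Y\<close> with \<open>\<tau>\<close> Lebesgue on \<open>[0, t]\<close> and \<open>Y\<close> of density \<open>J\<close> restricted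
  to \<open>E\<close>: the displacement at time \<open>t\<close> caused by a jump \<open>Y\<close> made \<open>\<tau>\<close> time units earlier.\<close>

definition jump_mult :: "real \<Rightarrow> ('a::euclidean_space \<Rightarrow> real) \<Rightarrow> 'a set \<Rightarrow> 'a \<Rightarrow> complex" where
  "jump_mult t J E \<eta> = (\<integral>y. of_real (indicator E y * J y) * osc t (\<eta> \<bullet> y) \<partial>lborel)"

lemma osc_alt: "osc t w = (\<integral>\<tau>. of_real (indicator {0..t} \<tau>) * cis (exp (- \<tau>) * w) \<partial>lborel)"
  by (simp add: osc_def set_lebesgue_integral_def scaleR_conv_of_real)

lemma integrable_indicator_mult:
  fixes J :: "'a \<Rightarrow> real"
  assumes "integrable M J" "E \<in> sets M"
  shows "integrable M (\<lambda>y. indicator E y * J y)"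
  using integrable_mult_indicator[OF assms(2,1)] by simp

lemma integrable_indicator_mult_complex:
  fixes J :: "'a \<Rightarrow> real"
  assumes "integrable M J" "E \<in> sets M"
  shows "integrable M (\<lambda>y. complex_of_real (indicator E y * J y))"
  using integrable_indicator_mult[OF assms] by (simp only: complex_of_real_integrable_eq)

text \<open>Integrating over the jump size first leaves the transform of \<open>J\<close> at
  contracted frequencies, to which the expansion at 0 applies for every \<tau> at once.\<close>

lemma jump_mult_UNIV:
  fixes J :: "'a::euclidean_space \<Rightarrow> real"
  assumes J: "integrable lborel J"
  shows "jump_mult t J UNIV \<eta> = (\<integral>\<tau>\<in>{0..t}. ftr J (exp (- \<tau>) *\<^sub>R \<eta>) \<partial>lborel)"
proof -
  have Jc: "integrable lborel (\<lambda>y. complex_of_real (J y))" using J by simp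
  have ic: "integrable lborel (\<lambda>\<tau>. complex_of_real (indicat_real {0..t} \<tau>))"
    using integrable_indicator_Icc by (simp only: complex_of_real_integrable_eq)
  have "jump_mult t J UNIV \<eta> = (\<integral>y. of_real (J y) * (\<integral>\<tau>. of_real (indicator {0..t} \<tau>) * cis (exp (- \<tau>) * (\<eta> \<bullet> y)) \<partial>lborel) \<partial>lborel)"
    unfolding jump_mult_def osc_alt by simp
  also have "\<dots> = (\<integral>\<tau>. of_real (indicator {0..t} \<tau>) * (\<integral>y. of_real (J y) * cis (exp (- \<tau>) * (\<eta> \<bullet> y)) \<partial>lborel) \<partial>lborel)"
    by (rule lborel_pair.integral_kernel_swap[OF Jc ic, where C=1]) auto
  also have "\<dots> = (\<integral>\<tau>\<in>{0..t}. ftr J (exp (- \<tau>) *\<^sub>R \<eta>) \<partial>lborel)"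
    by (simp add: set_lebesgue_integral_def scaleR_conv_of_real ft_def inner_commute)
  finally show ?thesis .
qed

text \<open>The multiplier is the transform of the image of a measure in size and time under the
  displacement \<open>(y, \<tau>) \<mapsto> (\<epsilon> * exp (- \<tau>)) y\<close>.\<close>

lemma posm_jump_mult:
  fixes J :: "'a::euclidean_space \<Rightarrow> real"
  assumes J: "integrable lborel J" "\<And>y. 0 \<le> J y" and E[measurable]: "E \<in> sets borel"
  shows "posm (\<lambda>\<xi>. jump_mult t J E (\<epsilon> *\<^sub>R \<xi>))"
proof -
  let ?f = "\<lambda>(y, \<tau>). indicator E y * J y * indicat_real {0..t} \<tau>"
  let ?h = "\<lambda>(y, \<tau>). (\<epsilon> * exp (- \<tau>)) *\<^sub>R (y::'a)"
  have [measurable]: "J \<in> borel_measurable borel" using J by auto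
  have ic: "integrable lborel (\<lambda>\<tau>. complex_of_real (indicat_real {0..t} \<tau>))"
    using integrable_indicator_Icc by (simp only: complex_of_real_integrable_eq)
  have Jc: "integrable lborel (\<lambda>y. complex_of_real (indicator E y * J y))"
    by (rule integrable_indicator_mult_complex[OF J(1)]) simp
  have sf: "sigma_finite_measure (lborel \<Otimes>\<^sub>M lborel :: ('a \<times> real) measure)"
    unfolding lborel_prod by (rule sigma_finite_lborel)
  have fi: "integrable (lborel \<Otimes>\<^sub>M lborel) ?f"
  proof -
    have "integrable (lborel \<Otimes>\<^sub>M lborel) (\<lambda>(y, \<tau>). complex_of_real (indicator E y * J y) * complex_of_real (indicat_real {0..t} \<tau>) * 1)"
      by (rule lborel_pair.integrable_kernel[OF Jc ic, where C=1]) auto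
    then have "integrable (lborel \<Otimes>\<^sub>M lborel) (\<lambda>p. complex_of_real (?f p))"
      by (simp add: split_beta')
    then show ?thesis by (simp only: complex_of_real_integrable_eq)
  qed
  have "posm (\<lambda>\<xi>. \<integral>p. of_real (?f p) * cis (\<xi> \<bullet> ?h p) \<partial>(lborel \<Otimes>\<^sub>M lborel))"
    by (rule posm_fourier[OF sf fi]) (use J in \<open>auto simp: split_beta'\<close>)
  moreover have "(\<integral>p. of_real (?f p) * cis (\<xi> \<bullet> ?h p) \<partial>(lborel \<Otimes>\<^sub>M lborel)) = jump_mult t J E (\<epsilon> *\<^sub>R \<xi>)" for \<xi>
  proof -
    have int: "integrable (lborel \<Otimes>\<^sub>M lborel) (\<lambda>(y, \<tau>). complex_of_real (indicator E y * J y) * complex_of_real (indicat_real {0..t} \<tau>) * cis (exp (- \<tau>) * ((\<epsilon> *\<^sub>R \<xi>) \<bullet> y)))"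
      by (rule lborel_pair.integrable_kernel[OF Jc ic, where C=1]) auto
    have "jump_mult t J E (\<epsilon> *\<^sub>R \<xi>) = (\<integral>y. (\<integral>\<tau>. complex_of_real (indicator E y * J y) * complex_of_real (indicat_real {0..t} \<tau>) * cis (exp (- \<tau>) * ((\<epsilon> *\<^sub>R \<xi>) \<bullet> y)) \<partial>lborel) \<partial>lborel)"
      unfolding jump_mult_def osc_alt by (simp add: mult.assoc)
    also have "\<dots> = (\<integral>p. (case p of (y, \<tau>) \<Rightarrow> complex_of_real (indicator E y * J y) * complex_of_real (indicat_real {0..t} \<tau>) * cis (exp (- \<tau>) * ((\<epsilon> *\<^sub>R \<xi>) \<bullet> y))) \<partial>(lborel \<Otimes>\<^sub>M lborel))"
      using lborel_pair.integral_fst[OF int] by simp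
    also have "\<dots> = (\<integral>p. of_real (?f p) * cis (\<xi> \<bullet> ?h p) \<partial>(lborel \<Otimes>\<^sub>M lborel))"
      by (intro Bochner_Integration.integral_cong refl) (auto simp: split_beta' mult_ac)
    finally show ?thesis by simp
  qed
  ultimately show ?thesis by simp
qed

lemma sphere_net:
  fixes e :: real
  assumes "0 < e"
  shows "\<exists>S::'a::euclidean_space set. finite S \<and> (\<forall>v\<in>S. norm v = 1) \<and> (\<forall>x. norm x = 1 \<longrightarrow> (\<exists>v\<in>S. norm (x - v) < e))"
proof -
  have "compact (sphere (0::'a) 1)" by simp
  then obtain S where "finite S" "S \<subseteq> sphere (0::'a) 1" "sphere 0 1 \<subseteq> (\<Union>x\<in>S. ball x e)"
    using seq_compact_imp_totally_bounded[of "sphere (0::'a) 1"] assms compact_eq_seq_compact_metric by metis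
  then show ?thesis by (intro exI[of _ S]) (force simp: dist_norm norm_minus_commute)
qed

text \<open>The constants depend on \<open>t\<close> and on the expansion of the symbol only, never on the kernel. The slabs are
  indexed by a net \<open>S\<close> of the sphere that is so fine that, whatever the frequency \<open>\<eta>\<close>, on one of the slabs
  \<open>\<bar>\<eta> \<bullet> y\<bar>\<close> is at least \<open>a \<parallel>\<eta>\<parallel> / 2\<close>. One jump in each slab, at random times, thus produces a transform of
  order \<open>1 / \<parallel>\<eta>\<parallel>\<close>, uniformly in the kernel.\<close>

locale jump_consts =
  fixes t r0 \<kappa> A a :: real and S :: "'a::euclidean_space set"
  assumes t: "0 < t" and r0: "0 < r0" "r0 \<le> 1"
    and \<kappa>: "0 < \<kappa>" "\<And>w. \<kappa> * min 1 (w\<^sup>2) \<le> t - Re (osc t w)"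
    and a: "0 < a" "a\<^sup>2 = 1 / 8"
    and A: "0 < A" "real DIM('a) / A \<le> r0" "real DIM('a) * (2 * t / \<kappa> * (real DIM('a) / A)) \<le> r0\<^sup>2 / 16"
    and S: "finite S" "\<And>v. v \<in> S \<Longrightarrow> norm v = 1" "\<And>x. norm x = 1 \<Longrightarrow> \<exists>v\<in>S. norm (x - v) < a / (2 * A)"
begin

definition slab :: "'a \<Rightarrow> 'a set" where "slab v = {y. a \<le> \<bar>v \<bullet> y\<bar> \<and> norm y \<le> A}"

definition slabs :: "('a \<Rightarrow> real) \<Rightarrow> 'a \<Rightarrow> complex" where
  "slabs J \<eta> = (\<Prod>v\<in>S. jump_mult t J (slab v) \<eta> / of_real t) ^ (2 * DIM('a))"

lemma slab_sets [measurable]: "slab v \<in> sets borel"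
  unfolding slab_def by measurable

end

lemma jump_consts_exist:
  assumes "0 < t" "0 < r0" "r0 \<le> 1"
  shows "\<exists>\<kappa> A a (S::'a::euclidean_space set). jump_consts t r0 \<kappa> A a S"
proof -
  obtain \<kappa> where \<kappa>: "\<kappa> > 0" "\<And>w. \<kappa> * min 1 (w\<^sup>2) \<le> t - Re (osc t w)" using osc_coercive[OF assms(1)] by blast
  define d where "d = real DIM('a)"
  have d: "d > 0" by (simp add: d_def)
  \<comment> \<open>The cutoff for long jumps. The first bound keeps the test frequencies of length
    \<open>d / A\<close> in the range \<open>r0\<close> of the expansion; the second makes a jump
    longer than \<open>A\<close> have probability at most \<open>r0^2 / 16\<close>.\<close>
  define A where "A = max (d / r0) (32 * t * d\<^sup>2 / (\<kappa> * r0\<^sup>2))"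
  \<comment> \<open>Jumps with \<open>\<bar>v \<bullet> y\<bar> < a\<close> then contribute at most
    \<open>r0^2 / 8\<close> to the truncated moment in direction \<open>v\<close> at radius
    \<open>r0\<close>, half of the available lower bound \<open>r0^2 / 4\<close>.\<close>
  define a where "a = sqrt (1 / 8)"
  have A1: "A \<ge> d / r0" and A2: "A \<ge> 32 * t * d\<^sup>2 / (\<kappa> * r0\<^sup>2)" by (auto simp: A_def)
  have A0: "A > 0" using A1 d assms by (meson divide_pos_pos less_le_trans)
  have a0: "a > 0" by (simp add: a_def)
  obtain S :: "'a set" where S: "finite S" "\<forall>v\<in>S. norm v = 1" "\<forall>x. norm x = 1 \<longrightarrow> (\<exists>v\<in>S. norm (x - v) < a / (2 * A))"
    using sphere_net[of "a / (2 * A)"] a0 A0 by auto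
  have "jump_consts t r0 \<kappa> A a S"
  proof
    show "real DIM('a) / A \<le> r0" using A1 A0 assms by (simp add: d_def field_simps)
    have "32 * t * d\<^sup>2 \<le> A * (\<kappa> * r0\<^sup>2)" using A2 \<kappa> assms by (simp add: field_simps)
    then show "real DIM('a) * (2 * t / \<kappa> * (real DIM('a) / A)) \<le> r0\<^sup>2 / 16"
      using A0 \<kappa> unfolding d_def[symmetric] by (simp add: field_simps power2_eq_square)
  qed (use assms \<kappa> S A0 a0 in \<open>auto simp: a_def\<close>)
  then show ?thesis by blast
qed

text \<open>The choice of \<open>r0\<close> lets the error of the expansion consume at most half of
  its main term within radius \<open>r0\<close>. Only \<open>J\<close> and \<open>s\<close> change
  over the family; the other parameters are shared, so any bound in terms of them is
  uniform.\<close>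

locale jump_kernel = jump_consts t r0 \<kappa> A a S
  for t r0 \<kappa> A a :: real and S :: "'a::euclidean_space set" +
  fixes J :: "'a \<Rightarrow> real" and s C0 \<delta> :: real
  assumes dens: "prob_density J" and s: "1/2 < s" "s < 1" and C0: "0 < C0" and \<delta>: "0 < \<delta>" "C0 * r0 powr \<delta> \<le> 1/2"
    and expansion: "\<And>\<xi>. norm \<xi> \<le> 1 \<Longrightarrow> cmod (ftr J \<xi> - of_real (1 - norm \<xi> powr (2 * s))) \<le> C0 * norm \<xi> powr (2 * s + \<delta>)"
begin

abbreviation "K \<equiv> ftr J"
abbreviation "m \<equiv> jump_mult t J UNIV"
text \<open>A substitute for \<open>Re (1 - K \<eta>)\<close> that increases along rays: the cosine
  may return close to 1 at large frequencies, the truncated square does not fall again.\<close>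

definition B where "B \<eta> = (\<integral>y. J y * min 1 ((\<eta> \<bullet> y)\<^sup>2) \<partial>lborel)"

lemma J_meas [measurable]: "J \<in> borel_measurable borel" using prob_densityD[OF dens] by simp
lemma J_nonneg [simp]: "0 \<le> J y" using prob_densityD[OF dens] by simp
lemma J_int: "integrable lborel J" using prob_densityD[OF dens] by simp
lemma J_one: "(\<integral>y. J y \<partial>lborel) = 1" using prob_densityD[OF dens] by simp
lemma J_intc: "integrable lborel (\<lambda>y. complex_of_real (J y))" using J_int by simp

lemma integrable_J_bounded:
  assumes "g \<in> borel_measurable borel" "\<And>y. \<bar>g y\<bar> \<le> C"
  shows "integrable lborel (\<lambda>y. J y * g y)"
proof (rule Bochner_Integration.integrable_bound)
  show "integrable lborel (\<lambda>y. C * J y)" using J_int by auto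
  show "AE y in lborel. norm (J y * g y) \<le> norm (C * J y)"
  proof (rule AE_I2)
    fix y
    have "J y * \<bar>g y\<bar> \<le> J y * C" by (intro mult_left_mono assms) simp
    also have "\<dots> \<le> \<bar>C * J y\<bar>" by (simp add: mult.commute abs_mult mult_right_mono)
    finally show "norm (J y * g y) \<le> norm (C * J y)" by (simp add: abs_mult)
  qed
qed (use assms in auto)

section \<open>Quantitative consequences of the expansion of the symbol\<close>

lemma one_minus_K:
  assumes "norm \<eta> \<le> r0"
  shows "norm \<eta> powr (2 * s) / 2 \<le> Re (1 - K \<eta>)" "cmod (1 - K \<eta>) \<le> 2 * norm \<eta> powr (2 * s)"
proof -
  have "cmod (K \<eta> - of_real (1 - norm \<eta> powr (2 * s))) \<le> C0 * norm \<eta> powr (2 * s + \<delta>)"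
    using assms r0 by (intro expansion) auto
  also have "\<dots> = (C0 * norm \<eta> powr \<delta>) * norm \<eta> powr (2 * s)" by (simp add: powr_add mult_ac)
  also have "\<dots> \<le> 1/2 * norm \<eta> powr (2 * s)"
  proof (intro mult_right_mono)
    have "C0 * norm \<eta> powr \<delta> \<le> C0 * r0 powr \<delta>" using C0 \<delta> assms by (intro mult_left_mono powr_mono2) auto
    then show "C0 * norm \<eta> powr \<delta> \<le> 1/2" using \<delta> by linarith
  qed simp
  finally have le: "cmod (K \<eta> - of_real (1 - norm \<eta> powr (2 * s))) \<le> norm \<eta> powr (2 * s) / 2" by simp
  have "Re (K \<eta> - of_real (1 - norm \<eta> powr (2 * s))) \<le> norm \<eta> powr (2 * s) / 2"
    using complex_Re_le_cmod le by (rule order_trans)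
  then show "norm \<eta> powr (2 * s) / 2 \<le> Re (1 - K \<eta>)" by (simp add: algebra_simps)
  have "1 - K \<eta> = of_real (norm \<eta> powr (2 * s)) - (K \<eta> - of_real (1 - norm \<eta> powr (2 * s)))" by simp
  then have "cmod (1 - K \<eta>) \<le> cmod (of_real (norm \<eta> powr (2 * s))) + cmod (K \<eta> - of_real (1 - norm \<eta> powr (2 * s)))"
    using norm_triangle_ineq4 by metis
  then have "cmod (1 - K \<eta>) \<le> norm \<eta> powr (2 * s) + norm \<eta> powr (2 * s) / 2" using le by simp
  also have "\<dots> \<le> 2 * norm \<eta> powr (2 * s)" using powr_ge_zero[of "norm \<eta>" "2 * s"] by linarith
  finally show "cmod (1 - K \<eta>) \<le> 2 * norm \<eta> powr (2 * s)" .
qed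

lemma Re_one_minus_K: "Re (1 - K \<eta>) = (\<integral>y. J y * (1 - cos (\<eta> \<bullet> y)) \<partial>lborel)"
proof -
  have "Re (K \<eta>) = (\<integral>y. Re (of_real (J y) * cis (y \<bullet> \<eta>)) \<partial>lborel)"
    unfolding ft_def by (rule integral_Re[symmetric]) (rule integrable_ft[OF J_intc])
  then have "Re (K \<eta>) = (\<integral>y. J y * cos (\<eta> \<bullet> y) \<partial>lborel)" by (simp add: inner_commute)
  moreover have "(\<integral>y. J y * (1 - cos (\<eta> \<bullet> y)) \<partial>lborel) = (\<integral>y. J y \<partial>lborel) - (\<integral>y. J y * cos (\<eta> \<bullet> y) \<partial>lborel)"
    unfolding right_diff_distrib mult_1_right
    by (rule Bochner_Integration.integral_diff[OF J_int integrable_J_bounded[where C=1]]) auto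
  ultimately show ?thesis using J_one by simp
qed

lemma B_int: "integrable lborel (\<lambda>y. J y * min 1 ((\<eta> \<bullet> y)\<^sup>2))"
  by (rule integrable_J_bounded[where C=1]) auto

lemma B_ge_small:
  assumes "norm \<eta> \<le> r0" shows "norm \<eta> powr (2 * s) / 4 \<le> B \<eta>"
proof -
  have "Re (1 - K \<eta>) \<le> (\<integral>y. 2 * (J y * min 1 ((\<eta> \<bullet> y)\<^sup>2)) \<partial>lborel)"
    unfolding Re_one_minus_K
  proof (rule integral_mono)
    show "integrable lborel (\<lambda>y. J y * (1 - cos (\<eta> \<bullet> y)))"
      by (rule integrable_J_bounded[where C=2]) (use cos_le_one cos_ge_minus_one in \<open>auto simp: abs_le_iff intro: order_trans\<close>)
    show "integrable lborel (\<lambda>y. 2 * (J y * min 1 ((\<eta> \<bullet> y)\<^sup>2)))" using B_int by auto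
    show "J y * (1 - cos (\<eta> \<bullet> y)) \<le> 2 * (J y * min 1 ((\<eta> \<bullet> y)\<^sup>2))" for y
    proof -
      define w where "w = \<eta> \<bullet> y"
      have "1 - cos w \<le> 2 * min 1 (w\<^sup>2)"
      proof -
        have "cos w = 1 - 2 * (sin (w/2))\<^sup>2" using cos_double_sin[of "w/2"] by simp
        moreover have "(sin (w/2))\<^sup>2 \<le> (w/2)\<^sup>2" by (rule abs_le_square_iff[THEN iffD1, OF abs_sin_x_le_abs_x])
        moreover have "(w/2)\<^sup>2 = w\<^sup>2 / 4" by (simp add: power_divide)
        ultimately have "1 - cos w \<le> 2 * w\<^sup>2" using zero_le_power2[of w] by linarith
        then show ?thesis using cos_ge_minus_one[of w] by (auto simp: min_def)
      qed
      then have "J y * (1 - cos w) \<le> J y * (2 * min 1 (w\<^sup>2))" by (rule mult_left_mono) simp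
      then show ?thesis by (simp add: w_def mult_ac)
    qed
  qed
  then have "Re (1 - K \<eta>) \<le> 2 * B \<eta>" by (simp add: B_def)
  then show ?thesis using one_minus_K(1)[OF assms] by linarith
qed

text \<open>The frequency is shrunk to radius \<open>r0\<close>, where the expansion applies, and
  \<open>B\<close> only decreases thereby. As \<open>r0 \<le> 1\<close> and
  \<open>2 * s < 2\<close>, passing to \<open>r0^2\<close> removes \<open>s\<close> from the
  bound.\<close>

lemma B_ge_large:
  assumes "r0 \<le> norm \<eta>" shows "r0\<^sup>2 / 4 \<le> B \<eta>"
proof -
  have n: "norm \<eta> > 0" using assms r0 by linarith
  define \<eta>' where "\<eta>' = (r0 / norm \<eta>) *\<^sub>R \<eta>"
  have n': "norm \<eta>' = r0" using n r0 by (simp add: \<eta>'_def)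
  have "r0\<^sup>2 \<le> r0 powr (2 * s)" using r0 s powr_mono'[of "2 * s" 2 r0] by simp
  then have "r0\<^sup>2 / 4 \<le> B \<eta>'" using B_ge_small[of \<eta>'] n' by simp
  also have "B \<eta>' \<le> B \<eta>"
    unfolding B_def
  proof (rule integral_mono[OF B_int B_int])
    fix y
    have "r0 / norm \<eta> \<le> 1" using assms n by simp
    then have "\<bar>\<eta>' \<bullet> y\<bar> \<le> 1 * \<bar>\<eta> \<bullet> y\<bar>" unfolding \<eta>'_def inner_scaleR_left abs_mult using r0 n by (intro mult_right_mono) auto
    then have "(\<eta>' \<bullet> y)\<^sup>2 \<le> (\<eta> \<bullet> y)\<^sup>2" by (simp add: abs_le_square_iff)
    then show "J y * min 1 ((\<eta>' \<bullet> y)\<^sup>2) \<le> J y * min 1 ((\<eta> \<bullet> y)\<^sup>2)" by (intro mult_left_mono min.mono) auto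
  qed
  finally show ?thesis .
qed

lemma jump_mult_int:
  assumes "E \<in> sets borel"
  shows "integrable lborel (\<lambda>y. of_real (indicator E y * J y) * osc t (\<eta> \<bullet> y))"
proof -
  have "integrable lborel (\<lambda>y. osc t (\<eta> \<bullet> y) * of_real (indicator E y * J y))"
    by (rule integrable_bounded_mult[OF _ norm_osc_le integrable_indicator_mult_complex[OF J_int]])
       (use assms t in auto)
  then show ?thesis by (simp add: mult.commute)
qed

lemma B_le_m: "\<kappa> * B \<eta> \<le> t - Re (m \<eta>)"
proof -
  have 1: "integrable lborel (\<lambda>y. of_real (J y) * osc t (\<eta> \<bullet> y))" using jump_mult_int[of UNIV \<eta>] by simp
  have "Re (m \<eta>) = (\<integral>y. Re (of_real (J y) * osc t (\<eta> \<bullet> y)) \<partial>lborel)"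
    unfolding jump_mult_def using integral_Re[OF 1] by simp
  moreover have 2: "integrable lborel (\<lambda>y. J y * Re (osc t (\<eta> \<bullet> y)))"
    using integrable_Re[OF 1] by simp
  ultimately have "t - Re (m \<eta>) = (\<integral>y. t * J y - J y * Re (osc t (\<eta> \<bullet> y)) \<partial>lborel)"
    using J_int J_one by (subst Bochner_Integration.integral_diff) auto
  also have "\<dots> \<ge> (\<integral>y. \<kappa> * (J y * min 1 ((\<eta> \<bullet> y)\<^sup>2)) \<partial>lborel)"
  proof (rule integral_mono)
    show "integrable lborel (\<lambda>y. \<kappa> * (J y * min 1 ((\<eta> \<bullet> y)\<^sup>2)))" using B_int by auto
    show "integrable lborel (\<lambda>y. t * J y - J y * Re (osc t (\<eta> \<bullet> y)))" using J_int 2 by auto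
    fix y
    have "J y * (\<kappa> * min 1 ((\<eta> \<bullet> y)\<^sup>2)) \<le> J y * (t - Re (osc t (\<eta> \<bullet> y)))" by (intro mult_left_mono \<kappa>) simp
    then show "\<kappa> * (J y * min 1 ((\<eta> \<bullet> y)\<^sup>2)) \<le> t * J y - J y * Re (osc t (\<eta> \<bullet> y))" by (simp add: algebra_simps)
  qed
  finally show ?thesis by (simp add: B_def)
qed

lemma m_large: "r0 \<le> norm \<eta> \<Longrightarrow> \<kappa> * (r0\<^sup>2 / 4) \<le> t - Re (m \<eta>)"
  using B_le_m[of \<eta>] mult_left_mono[OF B_ge_large[of \<eta>], of \<kappa>] \<kappa> by linarith

lemma continuous_K: "continuous_on UNIV K"
  by (rule continuous_ft[OF J_intc])

lemma K_scaled_int: "set_integrable lborel {0..t} (\<lambda>\<tau>. K (exp (- \<tau>) *\<^sub>R \<eta>))"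
  by (intro borel_integrable_atLeastAtMost' continuous_on_compose2[OF continuous_K]) (auto intro!: continuous_intros)

lemma t_minus_m: "of_real t - m \<eta> = (\<integral>\<tau>\<in>{0..t}. 1 - K (exp (- \<tau>) *\<^sub>R \<eta>) \<partial>lborel)"
proof -
  have c: "set_integrable lborel {0..t} (\<lambda>\<tau>. 1::complex)" by (intro borel_integrable_atLeastAtMost' continuous_intros)
  show ?thesis unfolding jump_mult_UNIV[OF J_int] set_integral_diff(2)[OF c K_scaled_int]
    using integral_const_Icc[of t "1::complex"] t by (simp add: scaleR_conv_of_real)
qed

lemma norm_exp_scale_le: "0 \<le> \<tau> \<Longrightarrow> norm (exp (- \<tau>) *\<^sub>R (\<eta>::'a)) \<le> norm \<eta>"
  by (simp add: mult_left_le_one_le)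

lemma m_small_upper:
  assumes "norm \<eta> \<le> r0" shows "t - Re (m \<eta>) \<le> 2 * t * norm \<eta>"
proof -
  have "t - Re (m \<eta>) \<le> cmod (of_real t - m \<eta>)" using complex_Re_le_cmod[of "of_real t - m \<eta>"] by simp
  also have "\<dots> \<le> (\<integral>\<tau>\<in>{0..t}. 2 * norm \<eta> \<partial>lborel)"
    unfolding t_minus_m set_lebesgue_integral_def
  proof (rule Bochner_Integration.integral_norm_bound_integral)
    have c: "set_integrable lborel {0..t} (\<lambda>\<tau>. 1::complex)" by (intro borel_integrable_atLeastAtMost' continuous_intros)
    show "integrable lborel (\<lambda>\<tau>. indicat_real {0..t} \<tau> *\<^sub>R (1 - K (exp (- \<tau>) *\<^sub>R \<eta>)))"
      using set_integral_diff(1)[OF c K_scaled_int] by (simp add: set_integrable_def)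
    show "integrable lborel (\<lambda>\<tau>. indicat_real {0..t} \<tau> *\<^sub>R (2 * norm \<eta>))" by (simp add: integrable_indicator_Icc)
    fix \<tau>
    show "norm (indicat_real {0..t} \<tau> *\<^sub>R (1 - K (exp (- \<tau>) *\<^sub>R \<eta>))) \<le> indicat_real {0..t} \<tau> *\<^sub>R (2 * norm \<eta>)"
    proof (cases "\<tau> \<in> {0..t}")
      case True
      then have le: "norm (exp (- \<tau>) *\<^sub>R \<eta>) \<le> norm \<eta>" by (intro norm_exp_scale_le) simp
      then have "cmod (1 - K (exp (- \<tau>) *\<^sub>R \<eta>)) \<le> 2 * norm (exp (- \<tau>) *\<^sub>R \<eta>) powr (2 * s)"
        using assms by (intro one_minus_K) linarith
      also have "\<dots> \<le> 2 * norm \<eta>"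
      proof -
        have "norm (exp (- \<tau>) *\<^sub>R \<eta>) powr (2 * s) \<le> norm \<eta> powr (2 * s)" using le s by (intro powr_mono2) auto
        also have "\<dots> \<le> norm \<eta> powr 1" using assms r0 s by (intro powr_mono') auto
        finally show ?thesis by simp
      qed
      finally show ?thesis using True by simp
    qed simp
  qed
  also have "\<dots> = 2 * t * norm \<eta>" using t by (subst integral_const_Icc) auto
  finally show ?thesis .
qed

text \<open>The classical tail bound through the characteristic function near 0, with the average
  over \<tau> in place of an average over frequencies: the indicator is below the truncated square,
  whose mean \<open>B\<close> is bounded by coercivity and by the smallness of
  \<open>t - Re (m \<eta>)\<close>.\<close>

lemma prob_large_le:
  assumes "norm \<eta> \<le> r0"
  shows "(\<integral>y. J y * indicator {y. 1 \<le> \<bar>\<eta> \<bullet> y\<bar>} y \<partial>lborel) \<le> 2 * t / \<kappa> * norm \<eta>"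
proof -
  have "(\<integral>y. J y * indicator {y. 1 \<le> \<bar>\<eta> \<bullet> y\<bar>} y \<partial>lborel) \<le> B \<eta>"
    unfolding B_def
  proof (rule integral_mono[OF integrable_J_bounded[where C=1] B_int])
    fix y
    have "indicator {y. 1 \<le> \<bar>\<eta> \<bullet> y\<bar>} y \<le> min 1 ((\<eta> \<bullet> y)\<^sup>2)"
      using abs_le_square_iff[of 1 "\<eta> \<bullet> y"] by (auto simp: indicator_def)
    then show "J y * indicator {y. 1 \<le> \<bar>\<eta> \<bullet> y\<bar>} y \<le> J y * min 1 ((\<eta> \<bullet> y)\<^sup>2)" by (intro mult_left_mono) auto
  qed (auto simp: indicator_def)
  also have "\<dots> \<le> 2 * t / \<kappa> * norm \<eta>"
    using B_le_m[of \<eta>] m_small_upper[OF assms] \<kappa>(1) by (simp add: field_simps)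
  finally show ?thesis .
qed

definition q where "q v = (\<integral>y. J y * indicator (slab v) y \<partial>lborel)"

text \<open>Of the truncated moment at \<open>r0 v\<close>, at least \<open>r0^2 / 4\<close>, small
  values of \<open>v \<bullet> y\<close> account for at most \<open>r0^2 / 8\<close>; the rest
  bounds the probability of \<open>\<bar>v \<bullet> y\<bar> \<ge> a\<close>. A jump longer than
  \<open>A\<close> has a coordinate of size at least \<open>A / d\<close>, and the tail bound in
  each coordinate direction removes \<open>r0^2 / 16\<close> at most.\<close>

lemma q_bounds:
  assumes "norm v = 1" shows "r0\<^sup>2 / 16 \<le> q v" "q v \<le> 1"
proof -
  define d where "d = real DIM('a)"
  have d: "d > 0" by (simp add: d_def)
  let ?L = "\<lambda>b. {y. 1 \<le> \<bar>((d / A) *\<^sub>R b) \<bullet> y\<bar>} :: 'a set"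
  let ?G = "{y. a \<le> \<bar>v \<bullet> y\<bar>}"
  have Gi: "integrable lborel (\<lambda>y. J y * indicator ?G y)" and Li: "\<And>b. integrable lborel (\<lambda>y. J y * indicator (?L b) y)"
    and Ei: "integrable lborel (\<lambda>y. J y * indicator (slab v) y)"
    by (rule integrable_J_bounded[where C=1]; (measurable | auto simp: indicator_def))+
  have "r0\<^sup>2 / 4 \<le> B (r0 *\<^sub>R v)" by (rule B_ge_large) (use assms r0 in simp)
  also have "\<dots> \<le> (\<integral>y. J y * indicator ?G y + r0\<^sup>2 / 8 * J y \<partial>lborel)"
    unfolding B_def
  proof (rule integral_mono[OF B_int])
    show "integrable lborel (\<lambda>y. J y * indicator ?G y + r0\<^sup>2 / 8 * J y)" using Gi J_int by auto
    fix y
    have "min 1 ((r0 *\<^sub>R v \<bullet> y)\<^sup>2) \<le> indicator ?G y + r0\<^sup>2 / 8"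
    proof (cases "y \<in> ?G")
      case True then show ?thesis by (auto intro: min.coboundedI1)
    next
      case False
      then have "\<bar>v \<bullet> y\<bar> \<le> \<bar>a\<bar>" using a by auto
      then have "(v \<bullet> y)\<^sup>2 \<le> 1 / 8" using a(2) abs_le_square_iff by metis
      then have "r0\<^sup>2 * (v \<bullet> y)\<^sup>2 \<le> r0\<^sup>2 * (1 / 8)" by (intro mult_left_mono) auto
      then show ?thesis using False by (simp add: power_mult_distrib min_def)
    qed
    then have "J y * min 1 ((r0 *\<^sub>R v \<bullet> y)\<^sup>2) \<le> J y * (indicator ?G y + r0\<^sup>2 / 8)" by (intro mult_left_mono) auto
    then show "J y * min 1 ((r0 *\<^sub>R v \<bullet> y)\<^sup>2) \<le> J y * indicator ?G y + r0\<^sup>2 / 8 * J y" by (simp add: algebra_simps)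
  qed
  also have "\<dots> = (\<integral>y. J y * indicator ?G y \<partial>lborel) + r0\<^sup>2 / 8"
    using Gi J_int J_one by (subst Bochner_Integration.integral_add) auto
  finally have G: "r0\<^sup>2 / 8 \<le> (\<integral>y. J y * indicator ?G y \<partial>lborel)" by simp
  have "(\<integral>y. J y * indicator ?G y \<partial>lborel) \<le> (\<integral>y. J y * indicator (slab v) y + (\<Sum>b\<in>Basis. J y * indicator (?L b) y) \<partial>lborel)"
  proof (rule integral_mono[OF Gi])
    show "integrable lborel (\<lambda>y. J y * indicator (slab v) y + (\<Sum>b\<in>Basis. J y * indicator (?L b) y))"
      by (intro Bochner_Integration.integrable_add Bochner_Integration.integrable_sum Ei Li)
    fix y
    have "indicator ?G y \<le> (indicator (slab v) y + (\<Sum>b\<in>Basis. indicator (?L b) y) :: real)"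
    proof (cases "norm y \<le> A")
      case True
      then have "indicator ?G y \<le> (indicator (slab v) y :: real)" by (auto simp: indicator_def slab_def)
      moreover have "0 \<le> (\<Sum>b\<in>Basis. indicator (?L b) y :: real)" by (intro sum_nonneg) auto
      ultimately show ?thesis by linarith
    next
      case False
      have "\<exists>b\<in>Basis. A / d \<le> \<bar>y \<bullet> b\<bar>"
      proof (rule ccontr)
        assume "\<not> ?thesis"
        then have "(\<Sum>b\<in>Basis. \<bar>y \<bullet> b\<bar>) \<le> (\<Sum>b\<in>(Basis::'a set). A / d)" by (intro sum_mono) (auto simp: not_le less_imp_le)
        then have "norm y \<le> A" using norm_le_l1[of y] d by (simp add: d_def)
        then show False using False by simp
      qed
      then obtain b where b: "b \<in> Basis" "A / d \<le> \<bar>y \<bullet> b\<bar>" by blast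
      then have "y \<in> ?L b" using A(1) d by (simp add: abs_mult inner_commute field_simps)
      then have "(1::real) \<le> indicator (?L b) y" by simp
      also have "\<dots> \<le> (\<Sum>b\<in>Basis. indicator (?L b) y)" using b(1) by (intro member_le_sum) auto
      finally show ?thesis by (simp add: indicator_def)
    qed
    then have "J y * indicator ?G y \<le> J y * (indicator (slab v) y + (\<Sum>b\<in>Basis. indicator (?L b) y))" by (intro mult_left_mono) auto
    then show "J y * indicator ?G y \<le> J y * indicator (slab v) y + (\<Sum>b\<in>Basis. J y * indicator (?L b) y)"
      by (simp add: distrib_left sum_distrib_left)
  qed
  also have "\<dots> = q v + (\<Sum>b\<in>Basis. (\<integral>y. J y * indicator (?L b) y \<partial>lborel))"
    unfolding q_def by (simp only: Bochner_Integration.integral_add[OF Ei Bochner_Integration.integrable_sum[OF Li]] Bochner_Integration.integral_sum[OF Li])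
  also have "(\<Sum>b\<in>Basis. (\<integral>y. J y * indicator (?L b) y \<partial>lborel)) \<le> (\<Sum>b\<in>(Basis::'a set). 2 * t / \<kappa> * (d / A))"
  proof (rule sum_mono)
    fix b :: 'a assume b: "b \<in> Basis"
    have "norm ((d / A) *\<^sub>R b) = d / A" using b A(1) d by simp
    moreover have "d / A \<le> r0" using A(2) by (simp add: d_def)
    ultimately show "(\<integral>y. J y * indicator (?L b) y \<partial>lborel) \<le> 2 * t / \<kappa> * (d / A)"
      using prob_large_le[of "(d / A) *\<^sub>R b"] by simp
  qed
  also have "(\<Sum>b\<in>(Basis::'a set). 2 * t / \<kappa> * (d / A)) \<le> r0\<^sup>2 / 16"
    using A(3) by (simp add: d_def)
  finally show "r0\<^sup>2 / 16 \<le> q v" using G by linarith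
  have "q v \<le> (\<integral>y. J y \<partial>lborel)" unfolding q_def
    by (rule integral_mono[OF Ei J_int]) (auto simp: indicator_def)
  then show "q v \<le> 1" using J_one by simp
qed

lemma norm_jump_mult_le:
  assumes E: "E \<in> sets borel" and c: "\<And>y. y \<in> E \<Longrightarrow> cmod (osc t (\<eta> \<bullet> y)) \<le> c" "0 \<le> c"
  shows "cmod (jump_mult t J E \<eta>) \<le> c"
proof -
  have "cmod (jump_mult t J E \<eta>) \<le> (\<integral>y. c * J y \<partial>lborel)"
    unfolding jump_mult_def
  proof (rule Bochner_Integration.integral_norm_bound_integral[OF jump_mult_int[OF E]])
    show "integrable lborel (\<lambda>y. c * J y)" using J_int by auto
    show "norm (of_real (indicator E y * J y) * osc t (\<eta> \<bullet> y)) \<le> c * J y" for y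
      using c mult_left_mono[OF c(1), of y "J y"] by (cases "y \<in> E") (auto simp: norm_mult mult.commute)
  qed
  then show ?thesis using J_one by simp
qed

lemma norm_jump_mult_le_t: "E \<in> sets borel \<Longrightarrow> cmod (jump_mult t J E \<eta>) \<le> t"
  using t by (intro norm_jump_mult_le norm_osc_le) auto

lemma jump_mult_decay:
  assumes "\<eta> \<noteq> 0"
  shows "\<exists>v\<in>S. cmod (jump_mult t J (slab v) \<eta>) \<le> 4 * exp t / (a * norm \<eta>)"
proof -
  have n: "norm \<eta> > 0" using assms by simp
  define e where "e = \<eta> /\<^sub>R norm \<eta>"
  have "norm e = 1" using n by (simp add: e_def)
  then obtain v where v: "v \<in> S" "norm (e - v) < a / (2 * A)" using S by blast
  have "cmod (jump_mult t J (slab v) \<eta>) \<le> 4 * exp t / (a * norm \<eta>)"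
  proof (rule norm_jump_mult_le)
    fix y assume y: "y \<in> slab v"
    have "\<bar>(e - v) \<bullet> y\<bar> \<le> norm (e - v) * norm y" by (rule Cauchy_Schwarz_ineq2)
    also have "\<dots> \<le> a / (2 * A) * A" using v y a A by (intro mult_mono) (auto simp: slab_def)
    also have "\<dots> = a / 2" using A by simp
    finally have "\<bar>(e - v) \<bullet> y\<bar> \<le> a / 2" .
    moreover have "\<bar>v \<bullet> y\<bar> \<le> \<bar>e \<bullet> y\<bar> + \<bar>(e - v) \<bullet> y\<bar>" unfolding inner_diff_left by linarith
    ultimately have "a / 2 \<le> \<bar>e \<bullet> y\<bar>" using y by (simp add: slab_def)
    then have "norm \<eta> * (a / 2) \<le> norm \<eta> * \<bar>e \<bullet> y\<bar>" by (intro mult_left_mono) auto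
    also have "\<dots> = \<bar>\<eta> \<bullet> y\<bar>" using n by (simp add: e_def abs_mult)
    finally have ge: "norm \<eta> * (a / 2) \<le> \<bar>\<eta> \<bullet> y\<bar>" .
    have pos: "0 < norm \<eta> * (a / 2)" using n a by simp
    have "cmod (osc t (\<eta> \<bullet> y)) \<le> 2 * exp t / \<bar>\<eta> \<bullet> y\<bar>"
      by (rule norm_osc_decay) (use t ge pos in auto)
    also have "\<dots> \<le> 2 * exp t / (norm \<eta> * (a / 2))" using ge pos by (intro divide_left_mono) auto
    finally show "cmod (osc t (\<eta> \<bullet> y)) \<le> 4 * exp t / (a * norm \<eta>)" by (simp add: field_simps)
  qed (use n a in auto)
  then show ?thesis using v by blast
qed

text \<open>This is the purpose of the bound \<open>norm y \<le> A\<close> in the slabs: the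
  restricted jump has a transform that is Lipschitz at 0 with a constant independent of the
  kernel.\<close>

lemma jump_mult_near_0: "cmod (jump_mult t J (slab v) \<eta> - of_real (t * q v)) \<le> t * A * norm \<eta>"
proof -
  have Ei: "integrable lborel (\<lambda>y. complex_of_real (indicator (slab v) y * J y))"
    by (rule integrable_indicator_mult_complex[OF J_int]) simp
  have q: "of_real (t * q v) = (\<integral>y. complex_of_real (indicator (slab v) y * J y) * of_real t \<partial>lborel)"
    unfolding q_def integral_mult_left_zero integral_complex_of_real by (simp add: mult.commute)
  have "jump_mult t J (slab v) \<eta> - of_real (t * q v) = (\<integral>y. of_real (indicator (slab v) y * J y) * (osc t (\<eta> \<bullet> y) - of_real t) \<partial>lborel)"
    unfolding q jump_mult_def right_diff_distrib
    by (rule Bochner_Integration.integral_diff[OF jump_mult_int integrable_mult_left[OF Ei], symmetric]) simp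
  also have "cmod \<dots> \<le> (\<integral>y. t * A * norm \<eta> * J y \<partial>lborel)"
  proof (rule Bochner_Integration.integral_norm_bound_integral)
    show "integrable lborel (\<lambda>y. of_real (indicator (slab v) y * J y) * (osc t (\<eta> \<bullet> y) - of_real t))"
      unfolding right_diff_distrib by (rule Bochner_Integration.integrable_diff[OF jump_mult_int integrable_mult_left[OF Ei]]) simp
    show "integrable lborel (\<lambda>y. t * A * norm \<eta> * J y)" using J_int by auto
    fix y
    show "norm (of_real (indicator (slab v) y * J y) * (osc t (\<eta> \<bullet> y) - of_real t)) \<le> t * A * norm \<eta> * J y"
    proof (cases "y \<in> slab v")
      case True
      have "cmod (osc t (\<eta> \<bullet> y) - of_real t) \<le> t * \<bar>\<eta> \<bullet> y\<bar>" using osc_lipschitz[of t "\<eta> \<bullet> y" 0] osc_0[of t] t by simp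
      also have "\<dots> \<le> t * (norm \<eta> * A)"
        using t True Cauchy_Schwarz_ineq2[of \<eta> y] mult_left_mono[of "norm y" A "norm \<eta>"] by (intro mult_left_mono) (auto simp: slab_def)
      finally have "J y * cmod (osc t (\<eta> \<bullet> y) - of_real t) \<le> J y * (t * (norm \<eta> * A))" by (intro mult_left_mono) auto
      then show ?thesis using True by (simp add: norm_mult mult_ac)
    next
      case False then show ?thesis using t A by simp
    qed
  qed
  finally show ?thesis using J_one by simp
qed

lemma posm_jump: "E \<in> sets borel \<Longrightarrow> posm (\<lambda>\<xi>. jump_mult t J E (\<epsilon> *\<^sub>R \<xi>))"
  by (rule posm_jump_mult[OF J_int J_nonneg])

lemma posm_jump_diff:
  assumes E[measurable]: "E \<in> sets borel" shows "posm (\<lambda>\<xi>. m (\<epsilon> *\<^sub>R \<xi>) - jump_mult t J E (\<epsilon> *\<^sub>R \<xi>))"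
proof -
  have "m \<eta> - jump_mult t J E \<eta> = jump_mult t J (- E) \<eta>" for \<eta>
    unfolding jump_mult_def
    by (subst Bochner_Integration.integral_diff[OF jump_mult_int jump_mult_int, symmetric])
       (auto intro!: Bochner_Integration.integral_cong simp: indicator_def)
  then show ?thesis using posm_jump[of "- E" \<epsilon>] by simp
qed

end

section \<open>The stable limit\<close>

text \<open>The integral of \<open>exp (- (2 * s * \<tau>))\<close> over \<open>[0, t]\<close>:
  contraction of frequencies by \<open>exp (- \<tau>)\<close> multiplies the symbol, homogeneous of
  degree \<open>2 * s\<close>, by this factor.\<close>

definition acoef :: "real \<Rightarrow> real \<Rightarrow> real" where
  "acoef t s = (1 - exp (- (2 * s * t))) / (2 * s)"

text \<open>The parameter \<open>\<theta>\<close> allows \<open>stab 1\<close> to be the square of \<open>stab (1/2)\<close>.\<close>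

definition stab :: "real \<Rightarrow> real \<Rightarrow> real \<Rightarrow> 'a::euclidean_space \<Rightarrow> real" where
  "stab \<theta> t s \<zeta> = exp (- (\<theta> * acoef t s * norm \<zeta> powr (2 * s)))"

lemma acoef_integral:
  assumes "0 < s" "0 \<le> t"
  shows "(\<integral>\<tau>\<in>{0..t}. exp (- (2 * s * \<tau>)) \<partial>lborel) = acoef t s"
proof -
  have "(\<integral>\<tau>. indicat_real {0..t} \<tau> *\<^sub>R exp (- (2 * s * \<tau>)) \<partial>lborel) = (- exp (- (2 * s * t)) / (2 * s)) - (- exp (- (2 * s * 0)) / (2 * s))"
  proof (rule integral_FTC_atLeastAtMost[OF assms(2)])
    fix x
    have "((\<lambda>\<tau>. - exp (- (2 * s * \<tau>)) / (2 * s)) has_real_derivative exp (- (2 * s * x))) (at x within {0..t})"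
      using assms by (auto intro!: derivative_eq_intros simp: field_simps)
    then show "((\<lambda>\<tau>. - exp (- (2 * s * \<tau>)) / (2 * s)) has_vector_derivative exp (- (2 * s * x))) (at x within {0..t})"
      by (simp add: has_real_derivative_iff_has_vector_derivative)
  qed (intro continuous_intros)
  then show ?thesis by (simp add: set_lebesgue_integral_def acoef_def diff_divide_distrib)
qed

lemma set_integrable_exp: "set_integrable lborel {0..t::real} (\<lambda>\<tau>. exp (- (c * \<tau>)) :: real)"
  by (intro borel_integrable_atLeastAtMost' continuous_intros)

lemma acoef_bounds:
  assumes "0 < s" "s \<le> 1" "0 \<le> t"
  shows "t * exp (- (2 * t)) \<le> acoef t s" "acoef t s \<le> t"
proof -
  have c: "set_integrable lborel {0..t} (\<lambda>\<tau>. c)" for c :: real by (intro borel_integrable_atLeastAtMost' continuous_intros)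
  have "(\<integral>\<tau>\<in>{0..t}. exp (- (2 * t)) \<partial>lborel) \<le> (\<integral>\<tau>\<in>{0..t}. exp (- (2 * s * \<tau>)) \<partial>lborel)"
  proof (rule set_integral_mono[OF c set_integrable_exp])
    fix \<tau> assume "\<tau> \<in> {0..t}"
    then have "s * \<tau> \<le> 1 * t" using assms by (intro mult_mono) auto
    then show "exp (- (2 * t)) \<le> exp (- (2 * s * \<tau>))" by simp
  qed
  then show "t * exp (- (2 * t)) \<le> acoef t s"
    unfolding acoef_integral[OF assms(1,3)] integral_const_Icc[OF assms(3)] by simp
  have "(\<integral>\<tau>\<in>{0..t}. exp (- (2 * s * \<tau>)) \<partial>lborel) \<le> (\<integral>\<tau>\<in>{0..t}. 1 \<partial>lborel)"
    by (rule set_integral_mono[OF set_integrable_exp c]) (use assms in auto)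
  then show "acoef t s \<le> t"
    unfolding acoef_integral[OF assms(1,3)] integral_const_Icc[OF assms(3)] by simp
qed

lemma norm_powr_ge:
  assumes "1/2 \<le> s" shows "norm \<zeta> - 1 \<le> norm \<zeta> powr (2 * s)"
proof (cases "norm \<zeta> \<le> 1")
  case False
  then have "norm \<zeta> powr 1 \<le> norm \<zeta> powr (2 * s)" using assms by (intro powr_mono) auto
  then show ?thesis using False by simp
qed (use powr_ge_zero[of "norm \<zeta>" "2 * s"] in linarith)

text \<open>From 2 s \<ge> 1. The resulting exponential majorant does not involve \<open>s\<close>:
  it dominates when \<open>s\<close> varies, and it is the decay that makes the stable density
  real-analytic.\<close>

lemma exp_norm_powr_le:
  assumes "1/2 \<le> s" "0 \<le> c" "c \<le> b"
  shows "exp (- (b * norm \<zeta> powr (2 * s))) \<le> exp c * exp (- (c * norm \<zeta>))"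
proof -
  have "c * (norm \<zeta> - 1) \<le> c * norm \<zeta> powr (2 * s)" using norm_powr_ge[OF assms(1)] assms by (intro mult_left_mono)
  also have "\<dots> \<le> b * norm \<zeta> powr (2 * s)" using assms by (intro mult_right_mono) auto
  finally have "- (b * norm \<zeta> powr (2 * s)) \<le> c + - (c * norm \<zeta>)" by (simp add: algebra_simps)
  then show ?thesis unfolding exp_add[symmetric] by simp
qed

lemma stab_pos: "0 < stab \<theta> t s \<zeta>" by (simp add: stab_def)

lemma stab_minus: "stab \<theta> t s (- \<zeta>) = stab \<theta> t s \<zeta>" by (simp add: stab_def)

lemma stab_le:
  assumes "1/2 \<le> s" "s \<le> 1" "0 \<le> t" "0 \<le> \<theta>"
  shows "stab \<theta> t s \<zeta> \<le> exp (\<theta> * (t * exp (- (2 * t)))) * exp (- (\<theta> * (t * exp (- (2 * t))) * norm \<zeta>))"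
  unfolding stab_def using assms acoef_bounds(1)[of s t]
  by (intro exp_norm_powr_le mult_left_mono) auto

lemma continuous_stab: "0 < s \<Longrightarrow> continuous_on UNIV (stab \<theta> t s)"
  unfolding stab_def[abs_def] by (intro continuous_intros continuous_on_powr') auto

lemma borel_measurable_stab [measurable]: "stab \<theta> t s \<in> borel_measurable borel"
  unfolding stab_def[abs_def] by measurable

lemma integrable_stab:
  assumes "1/2 \<le> s" "s \<le> 1" "0 < t" "0 < \<theta>"
  shows "integrable lborel (stab \<theta> t s :: 'a::euclidean_space \<Rightarrow> real)"
proof (rule Bochner_Integration.integrable_bound)
  let ?c = "\<theta> * (t * exp (- (2 * t)))"
  show "integrable lborel (\<lambda>\<zeta>::'a. exp ?c * exp (- (?c * norm \<zeta>)))"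
    using assms by (intro integrable_mult_right integrable_exp_norm) auto
  show "AE \<zeta>::'a in lborel. norm (stab \<theta> t s \<zeta>) \<le> norm (exp ?c * exp (- (?c * norm \<zeta>)))"
    using assms stab_le[of s t \<theta>] by (intro AE_I2) (simp add: stab_pos less_imp_le)
qed simp

lemma stab_ft_tendsto:
  fixes y :: "nat \<Rightarrow> 'a::euclidean_space"
  assumes sn: "\<And>n. 1/2 \<le> sn n" "\<And>n. sn n \<le> 1" and t: "0 < t" and \<theta>: "0 < \<theta>"
    and lim: "sn \<longlonglongrightarrow> s" "y \<longlonglongrightarrow> x"
  shows "(\<lambda>n. ftr (stab \<theta> t (sn n)) (y n)) \<longlonglongrightarrow> ftr (stab \<theta> t s) x"
  unfolding ft_def
proof (rule integral_dominated_convergence)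
  let ?c = "\<theta> * (t * exp (- (2 * t)))"
  have s: "1/2 \<le> s" by (rule LIMSEQ_le_const[OF lim(1)]) (use sn(1) in auto)
  show "integrable lborel (\<lambda>\<zeta>::'a. exp ?c * exp (- (?c * norm \<zeta>)))"
    using t \<theta> by (intro integrable_mult_right integrable_exp_norm) auto
  show "AE \<zeta> in lborel. norm (of_real (stab \<theta> t (sn n) \<zeta>) * cis (\<zeta> \<bullet> y n)) \<le> exp ?c * exp (- (?c * norm \<zeta>))" for n
    using stab_le[of "sn n" t \<theta>] sn t \<theta> by (intro AE_I2) (simp add: norm_mult stab_pos less_imp_le)
  show "AE \<zeta> in lborel. (\<lambda>n. of_real (stab \<theta> t (sn n) \<zeta>) * cis (\<zeta> \<bullet> y n)) \<longlonglongrightarrow> of_real (stab \<theta> t s \<zeta>) * cis (\<zeta> \<bullet> x)"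
  proof (rule AE_I2)
    fix \<zeta> :: 'a
    have "(\<lambda>n. norm \<zeta> powr (2 * sn n)) \<longlonglongrightarrow> norm \<zeta> powr (2 * s)"
      using lim(1) by (cases "norm \<zeta> = 0") (auto intro!: tendsto_intros)
    moreover have "(\<lambda>n. acoef t (sn n)) \<longlonglongrightarrow> acoef t s"
      unfolding acoef_def using lim(1) s by (intro tendsto_intros) auto
    ultimately have "(\<lambda>n. stab \<theta> t (sn n) \<zeta>) \<longlonglongrightarrow> stab \<theta> t s \<zeta>" unfolding stab_def by (intro tendsto_exp tendsto_minus tendsto_mult tendsto_const)
    then show "(\<lambda>n. of_real (stab \<theta> t (sn n) \<zeta>) * cis (\<zeta> \<bullet> y n)) \<longlonglongrightarrow> of_real (stab \<theta> t s \<zeta>) * cis (\<zeta> \<bullet> x)"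
      using lim(2) by (intro tendsto_intros)
  qed
qed auto

text \<open>Formally the multiplier is tested on the constant 1. As that is not integrable,
  Gaussians with \<sigma> \<rightarrow> 0 take its place.\<close>

lemma posm_ft_nonneg:
  fixes \<phi> :: "'a::euclidean_space \<Rightarrow> complex"
  assumes \<phi>: "posm \<phi>" "integrable lborel \<phi>"
  shows "0 \<le> Re (ft \<phi> x)"
proof -
  have [measurable]: "\<phi> \<in> borel_measurable borel" using \<phi>(2) by auto
  define \<sigma> where "\<sigma> n = 1 / (real n + 1)" for n
  have \<sigma>: "\<sigma> n > 0" for n by (simp add: \<sigma>_def)
  have \<sigma>0: "\<sigma> \<longlonglongrightarrow> 0" unfolding \<sigma>_def using LIMSEQ_inverse_real_of_nat by (simp add: inverse_eq_divide add.commute)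
  have g: "integrable lborel (\<lambda>\<xi>::'a. complex_of_real (gauss (\<sigma> n) \<xi>))" for n
    using integrable_gauss[OF \<sigma>, where 'a='a] by simp
  have pos: "0 \<le> Re (ft (\<lambda>\<xi>::'a. complex_of_real (gauss (\<sigma> n) \<xi>)) x)" for n x
    by (rule ft_gauss_nonneg[OF \<sigma>])
  have "(\<lambda>n. ft (\<lambda>\<xi>. \<phi> \<xi> * complex_of_real (gauss (\<sigma> n) \<xi>)) x) \<longlonglongrightarrow> ft \<phi> x"
  proof (rule ft_dominated[where g="\<lambda>\<xi>. norm (\<phi> \<xi>)"])
    show "(\<lambda>n. \<phi> \<xi> * complex_of_real (gauss (\<sigma> n) \<xi>)) \<longlonglongrightarrow> \<phi> \<xi>" for \<xi>
    proof -
      have "(\<lambda>n. gauss (\<sigma> n) \<xi>) \<longlonglongrightarrow> exp (- (0\<^sup>2 * (norm \<xi>)\<^sup>2 / 2))" unfolding gauss_def by (intro tendsto_intros \<sigma>0) auto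
      then have "(\<lambda>n. \<phi> \<xi> * complex_of_real (gauss (\<sigma> n) \<xi>)) \<longlonglongrightarrow> \<phi> \<xi> * of_real (exp (- (0\<^sup>2 * (norm \<xi>)\<^sup>2 / 2)))"
        by (intro tendsto_intros)
      then show ?thesis by simp
    qed
    show "norm (\<phi> \<xi> * complex_of_real (gauss (\<sigma> n) \<xi>)) \<le> norm (\<phi> \<xi>)" for n \<xi>
      using gauss_le_1[of "\<sigma> n" \<xi>] gauss_pos[of "\<sigma> n" \<xi>] mult_left_mono[of "gauss (\<sigma> n) \<xi>" 1 "norm (\<phi> \<xi>)"] by (simp add: norm_mult)
  qed (use \<phi> in auto)
  then have "(\<lambda>n. Re (ft (\<lambda>\<xi>. \<phi> \<xi> * complex_of_real (gauss (\<sigma> n) \<xi>)) x)) \<longlonglongrightarrow> Re (ft \<phi> x)" by (rule tendsto_Re)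
  then show ?thesis by (rule LIMSEQ_le_const) (use posmD[OF \<phi>(1) g pos] in auto)
qed

lemma norm_exp_diff_le:
  assumes "Re z \<le> M" "Re w \<le> M"
  shows "norm (exp z - exp w) \<le> exp M * norm (z - w)"
proof (rule field_differentiable_bound[where S="{z. Re z \<le> M}"])
  show "convex {z. Re z \<le> M}" by (rule convex_halfspace_Re_le)
  show "(exp has_field_derivative exp z) (at z within {z. Re z \<le> M})" for z by (auto intro!: derivative_eq_intros)
qed (use assms in auto)

lemma inverse_min_le:
  fixes c x :: real
  assumes "0 < c" "0 < x" shows "min 1 (c / x) \<le> (1 + c) / (1 + x)"
proof (cases "x \<le> c")
  case True
  then have "1 \<le> (1 + c) / (1 + x)" using assms by (simp add: field_simps)
  then show ?thesis by linarith
next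
  case False
  then have "c / x \<le> (1 + c) / (1 + x)" using assms by (simp add: field_simps)
  then show ?thesis by linarith
qed

section \<open>Transform of the smoothing jumps\<close>

context jump_consts begin

definition dcoef where "dcoef = 4 * exp t / (a * t)"
definition dconst where "dconst = (1 + dcoef) ^ (2 * DIM('a))"
text \<open>A lower bound of \<open>acoef t s / 2\<close> for all s \<le> 1. The half is lost to the
  error of the expansion, which may consume the other half of the main term.\<close>

definition c0 where "c0 = t * exp (- (2 * t)) / 2"
definition Q0 where "Q0 = ((r0\<^sup>2 / 16) ^ card S) ^ (2 * DIM('a))"

lemma consts_pos: "0 < dcoef" "0 < dconst" "0 < c0" "0 < Q0"
  using t a r0 by (auto simp: dcoef_def dconst_def c0_def Q0_def intro!: zero_less_power add_pos_pos divide_pos_pos mult_pos_pos)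

end

context jump_kernel begin

text \<open>The value of \<open>slabs J\<close> at 0: the probability that
  \<open>2 * DIM('a)\<close> rounds of jumps, one for each slab, all land in the prescribed
  slabs.\<close>

definition Q where "Q = (\<Prod>v\<in>S. q v) ^ (2 * DIM('a))"

lemma Q_bounds: "Q0 \<le> Q" "Q \<le> 1"
proof -
  have "(r0\<^sup>2 / 16) ^ card S = (\<Prod>v\<in>S. r0\<^sup>2 / 16)" by simp
  also have "\<dots> \<le> (\<Prod>v\<in>S. q v)" using q_bounds S(2) by (intro prod_mono) auto
  finally show "Q0 \<le> Q" unfolding Q0_def Q_def by (intro power_mono) auto
  have 0: "0 \<le> q v" if "v \<in> S" for v using q_bounds(1)[OF S(2)[OF that]] zero_le_power2[of r0] by linarith
  have "(\<Prod>v\<in>S. q v) \<le> 1" using 0 q_bounds S(2) by (intro prod_le_1) auto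
  then show "Q \<le> 1" unfolding Q_def using 0 by (intro power_le_one prod_nonneg) auto
qed

lemma norm_jm_le_1: "E \<in> sets borel \<Longrightarrow> cmod (jump_mult t J E \<eta> / of_real t) \<le> 1"
  using norm_jump_mult_le_t[of E \<eta>] t by (simp add: norm_divide)

lemma norm_slabs_le_1: "cmod (slabs J \<eta>) \<le> 1"
  unfolding slabs_def norm_power prod_norm[symmetric] by (intro power_le_one prod_le_1 prod_nonneg) (auto intro: norm_jm_le_1)

text \<open>For every frequency one factor of the product decays like the inverse norm and the
  others are at most 1. The power turns this into an integrable bound.\<close>

lemma norm_slabs_decay: "cmod (slabs J \<eta>) \<le> dconst / (1 + norm \<eta>) ^ (2 * DIM('a))"
proof (cases "\<eta> = 0")
  case True
  have "1 \<le> dconst" unfolding dconst_def using consts_pos by (intro one_le_power) simp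
  then show ?thesis using norm_slabs_le_1[of \<eta>] True by simp
next
  case False
  then obtain v where v: "v \<in> S" "cmod (jump_mult t J (slab v) \<eta>) \<le> 4 * exp t / (a * norm \<eta>)" using jump_mult_decay by blast
  have "cmod (jump_mult t J (slab v) \<eta> / of_real t) \<le> 4 * exp t / (a * norm \<eta>) / t"
    using divide_right_mono[OF v(2), of t] t by (simp only: norm_divide norm_of_real) simp
  then have "cmod (jump_mult t J (slab v) \<eta> / of_real t) \<le> dcoef / norm \<eta>" by (simp add: dcoef_def mult_ac)
  then have le: "cmod (jump_mult t J (slab v) \<eta> / of_real t) \<le> min 1 (dcoef / norm \<eta>)" using norm_jm_le_1 by simp
  have "cmod (\<Prod>v\<in>S. jump_mult t J (slab v) \<eta> / of_real t) = cmod (jump_mult t J (slab v) \<eta> / of_real t) * (\<Prod>v\<in>S - {v}. cmod (jump_mult t J (slab v) \<eta> / of_real t))"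
    using S(1) v(1) unfolding prod_norm[symmetric] by (rule prod.remove)
  also have "\<dots> \<le> min 1 (dcoef / norm \<eta>) * 1"
    using le consts_pos False by (intro mult_mono prod_le_1 prod_nonneg) (auto intro: norm_jm_le_1)
  also have "\<dots> \<le> (1 + dcoef) / (1 + norm \<eta>)" using inverse_min_le[of dcoef "norm \<eta>"] consts_pos False by simp
  finally have "cmod (\<Prod>v\<in>S. jump_mult t J (slab v) \<eta> / of_real t) ^ (2 * DIM('a)) \<le> ((1 + dcoef) / (1 + norm \<eta>)) ^ (2 * DIM('a))"
    by (intro power_mono) auto
  then show ?thesis by (simp add: slabs_def dconst_def norm_power power_divide)
qed

lemma slabs_near_0: "cmod (slabs J \<eta> - of_real Q) \<le> real (2 * DIM('a)) * (real (card S) * (A * norm \<eta>))"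
proof -
  have qn: "norm (complex_of_real (q v)) \<le> 1" if "v \<in> S" for v
    using q_bounds[OF S(2)[OF that]] zero_le_power2[of r0] unfolding norm_of_real abs_le_iff by linarith
  have "cmod (slabs J \<eta> - of_real Q) = cmod ((\<Prod>v\<in>S. jump_mult t J (slab v) \<eta> / of_real t) ^ (2 * DIM('a)) - (\<Prod>v\<in>S. of_real (q v)) ^ (2 * DIM('a)))"
    by (simp add: slabs_def Q_def)
  also have "\<dots> \<le> real (2 * DIM('a)) * cmod ((\<Prod>v\<in>S. jump_mult t J (slab v) \<eta> / of_real t) - (\<Prod>v\<in>S. of_real (q v)))"
    by (rule norm_power_diff; unfold prod_norm[symmetric]; intro prod_le_1; use qn norm_jm_le_1 in auto)
  also have "\<dots> \<le> real (2 * DIM('a)) * (\<Sum>v\<in>S. cmod (jump_mult t J (slab v) \<eta> / of_real t - of_real (q v)))"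
    by (intro mult_left_mono norm_prod_diff qn norm_jm_le_1) auto
  also have "\<dots> \<le> real (2 * DIM('a)) * (\<Sum>v\<in>S. A * norm \<eta>)"
  proof (intro mult_left_mono sum_mono)
    fix v
    have "jump_mult t J (slab v) \<eta> / of_real t - of_real (q v) = (jump_mult t J (slab v) \<eta> - of_real (t * q v)) / of_real t"
      using t by (simp add: diff_divide_distrib)
    then have "cmod (jump_mult t J (slab v) \<eta> / of_real t - of_real (q v)) = cmod (jump_mult t J (slab v) \<eta> - of_real (t * q v)) / t"
      using t by (simp add: norm_divide)
    also have "\<dots> \<le> t * A * norm \<eta> / t" using jump_mult_near_0 t by (intro divide_right_mono) auto
    finally show "cmod (jump_mult t J (slab v) \<eta> / of_real t - of_real (q v)) \<le> A * norm \<eta>" using t by simp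
  qed auto
  finally show ?thesis by simp
qed

lemma jump_measurable [measurable]: "E \<in> sets borel \<Longrightarrow> jump_mult t J E \<in> borel_measurable borel"
  using posm_measurable[OF posm_jump[of E 1]] by simp

lemma slabs_measurable [measurable]: "slabs J \<in> borel_measurable borel"
  unfolding slabs_def[abs_def] by measurable

lemma Re_m_le: "Re (m \<eta>) \<le> t"
  using norm_jump_mult_le_t[of UNIV \<eta>] complex_Re_le_cmod[of "m \<eta>"] by simp

text \<open>The frequency scale of the stable limit: at intensity \<mu> the exponent is of order 1
  where \<open>\<mu> * norm \<eta> powr (2 * s)\<close> is.\<close>

definition \<beta> where "\<beta> \<mu> = \<mu> powr (- (1 / (2 * s)))"

text \<open>The exponent \<open>1 / (2 * s)\<close> lies between 1/2 and 1, so the scale lies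
  between two powers of \<mu> that do not involve \<open>s\<close>. The error terms are expressed by
  these powers.\<close>

lemma \<beta>_bounds:
  assumes "1 \<le> \<mu>" shows "0 < \<beta> \<mu>" "\<beta> \<mu> \<le> 1" "\<beta> \<mu> \<le> \<mu> powr (- 1/2)" "1 / \<mu> \<le> \<beta> \<mu>" "\<beta> \<mu> powr (2 * s) = 1 / \<mu>"
proof -
  show "0 < \<beta> \<mu>" using assms by (simp add: \<beta>_def)
  have e: "1/2 \<le> 1 / (2 * s)" "1 / (2 * s) \<le> 1" using s by (auto simp: field_simps)
  show 1: "\<beta> \<mu> \<le> \<mu> powr (- 1/2)" unfolding \<beta>_def using assms e by (intro powr_mono) auto
  have "\<mu> powr (- 1/2) \<le> \<mu> powr 0" using assms by (intro powr_mono) auto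
  with 1 show "\<beta> \<mu> \<le> 1" using assms by simp
  have "\<mu> powr (- 1) \<le> \<beta> \<mu>" unfolding \<beta>_def using assms e by (intro powr_mono) auto
  then show "1 / \<mu> \<le> \<beta> \<mu>" using assms by (simp add: powr_minus_divide)
  show "\<beta> \<mu> powr (2 * s) = 1 / \<mu>" unfolding \<beta>_def powr_powr using s assms by (simp add: powr_minus_divide)
qed

text \<open>The expansion of the symbol at the contracted frequency, averaged over \<tau>. The first
  bound identifies the limit; the second provides domination on the whole range where the rescaled
  frequency stays below \<open>r0\<close>.\<close>

lemma exponent_expansion:
  assumes \<mu>: "1 \<le> \<mu>" and small: "\<beta> \<mu> * norm \<zeta> \<le> r0"
  shows "cmod (of_real \<mu> * (m (\<beta> \<mu> *\<^sub>R \<zeta>) - of_real t) + of_real (acoef t s * norm \<zeta> powr (2 * s))) \<le> t * C0 * \<beta> \<mu> powr \<delta> * norm \<zeta> powr (2 * s + \<delta>)"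
    and "Re (of_real \<mu> * (m (\<beta> \<mu> *\<^sub>R \<zeta>) - of_real t)) \<le> - (acoef t s / 2 * norm \<zeta> powr (2 * s))"
proof -
  define \<eta> where "\<eta> = \<beta> \<mu> *\<^sub>R \<zeta>"
  note b = \<beta>_bounds[OF \<mu>]
  have n\<eta>: "norm \<eta> = \<beta> \<mu> * norm \<zeta>" using b by (simp add: \<eta>_def)
  have n\<tau>: "norm (exp (- \<tau>) *\<^sub>R \<eta>) powr (2 * s) = exp (- (2 * s * \<tau>)) * (norm \<zeta> powr (2 * s) / \<mu>)" for \<tau>
    using b by (simp add: n\<eta> powr_mult exp_powr_real mult_ac)
  have ei: "set_integrable lborel {0..t} (\<lambda>\<tau>. complex_of_real (exp (- (2 * s * \<tau>)) * (norm \<zeta> powr (2 * s) / \<mu>)))"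
    by (intro borel_integrable_atLeastAtMost' continuous_intros)
  have Ki: "set_integrable lborel {0..t} (\<lambda>\<tau>. 1 - K (exp (- \<tau>) *\<^sub>R \<eta>))"
    by (intro set_integral_diff(1) K_scaled_int borel_integrable_atLeastAtMost' continuous_intros)
  have "(\<integral>\<tau>\<in>{0..t}. complex_of_real (exp (- (2 * s * \<tau>)) * (norm \<zeta> powr (2 * s) / \<mu>)) \<partial>lborel) = of_real (\<integral>\<tau>\<in>{0..t}. exp (- (2 * s * \<tau>)) * (norm \<zeta> powr (2 * s) / \<mu>) \<partial>lborel)"
    by (rule set_integral_complex_of_real)
  also have "\<dots> = of_real (acoef t s * (norm \<zeta> powr (2 * s) / \<mu>))"
    unfolding set_integral_mult_left using acoef_integral[of s t] s t by simp
  finally have a_int: "of_real \<mu> * (\<integral>\<tau>\<in>{0..t}. complex_of_real (exp (- (2 * s * \<tau>)) * (norm \<zeta> powr (2 * s) / \<mu>)) \<partial>lborel) = of_real (acoef t s * norm \<zeta> powr (2 * s))"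
    using \<mu> by simp
  have eq: "of_real \<mu> * (m \<eta> - of_real t) + of_real (acoef t s * norm \<zeta> powr (2 * s))
      = - of_real \<mu> * (\<integral>\<tau>\<in>{0..t}. (1 - K (exp (- \<tau>) *\<^sub>R \<eta>)) - complex_of_real (exp (- (2 * s * \<tau>)) * (norm \<zeta> powr (2 * s) / \<mu>)) \<partial>lborel)"
    unfolding set_integral_diff(2)[OF Ki ei] a_int[symmetric] t_minus_m[symmetric] by (simp add: algebra_simps)
  have le: "norm (exp (- \<tau>) *\<^sub>R \<eta>) \<le> norm \<eta>" if "\<tau> \<in> {0..t}" for \<tau> using that by (intro norm_exp_scale_le) auto
  define D where "D = C0 * (norm \<zeta> powr (2 * s + \<delta>) * \<beta> \<mu> powr \<delta> / \<mu>)"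
  have "cmod (\<integral>\<tau>\<in>{0..t}. (1 - K (exp (- \<tau>) *\<^sub>R \<eta>)) - complex_of_real (exp (- (2 * s * \<tau>)) * (norm \<zeta> powr (2 * s) / \<mu>)) \<partial>lborel) \<le> (\<integral>\<tau>\<in>{0..t}. D \<partial>lborel)"
    unfolding set_lebesgue_integral_def
  proof (rule Bochner_Integration.integral_norm_bound_integral)
    show "integrable lborel (\<lambda>\<tau>. indicat_real {0..t} \<tau> *\<^sub>R ((1 - K (exp (- \<tau>) *\<^sub>R \<eta>)) - complex_of_real (exp (- (2 * s * \<tau>)) * (norm \<zeta> powr (2 * s) / \<mu>))))"
      using set_integral_diff(1)[OF Ki ei] by (simp add: set_integrable_def)
    show "integrable lborel (\<lambda>\<tau>. indicat_real {0..t} \<tau> *\<^sub>R D)" by (simp add: integrable_indicator_Icc)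
    fix \<tau>
    show "norm (indicat_real {0..t} \<tau> *\<^sub>R ((1 - K (exp (- \<tau>) *\<^sub>R \<eta>)) - complex_of_real (exp (- (2 * s * \<tau>)) * (norm \<zeta> powr (2 * s) / \<mu>)))) \<le> indicat_real {0..t} \<tau> *\<^sub>R D"
    proof (cases "\<tau> \<in> {0..t}")
      case True
      have small': "norm (exp (- \<tau>) *\<^sub>R \<eta>) \<le> 1" using le[OF True] small r0 n\<eta> by linarith
      have "(1 - K (exp (- \<tau>) *\<^sub>R \<eta>)) - complex_of_real (exp (- (2 * s * \<tau>)) * (norm \<zeta> powr (2 * s) / \<mu>)) = - (K (exp (- \<tau>) *\<^sub>R \<eta>) - of_real (1 - norm (exp (- \<tau>) *\<^sub>R \<eta>) powr (2 * s)))"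
        unfolding n\<tau> by simp
      then have "cmod ((1 - K (exp (- \<tau>) *\<^sub>R \<eta>)) - complex_of_real (exp (- (2 * s * \<tau>)) * (norm \<zeta> powr (2 * s) / \<mu>))) \<le> C0 * norm (exp (- \<tau>) *\<^sub>R \<eta>) powr (2 * s + \<delta>)"
        using expansion[OF small'] by (simp only: norm_minus_cancel)
      also have "\<dots> \<le> C0 * norm \<eta> powr (2 * s + \<delta>)"
        using le[OF True] C0 \<delta> s by (intro mult_left_mono powr_mono2) auto
      also have "\<dots> = D" unfolding D_def n\<eta> using b by (simp add: powr_mult powr_add mult_ac)
      finally show ?thesis using True by simp
    qed simp
  qed
  also have "\<dots> = t * D" using integral_const_Icc[of t D] t by simp
  finally have "cmod (of_real \<mu> * (m \<eta> - of_real t) + of_real (acoef t s * norm \<zeta> powr (2 * s))) \<le> \<mu> * (t * D)"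
    unfolding eq using \<mu> by (simp add: norm_mult mult_left_mono)
  also have "\<mu> * (t * D) = t * C0 * \<beta> \<mu> powr \<delta> * norm \<zeta> powr (2 * s + \<delta>)" using \<mu> by (simp add: D_def)
  finally show "cmod (of_real \<mu> * (m (\<beta> \<mu> *\<^sub>R \<zeta>) - of_real t) + of_real (acoef t s * norm \<zeta> powr (2 * s))) \<le> t * C0 * \<beta> \<mu> powr \<delta> * norm \<zeta> powr (2 * s + \<delta>)"
    by (simp add: \<eta>_def)
  have "acoef t s * (norm \<zeta> powr (2 * s) / \<mu> / 2) \<le> Re (of_real t - m \<eta>)"
  proof -
    have "acoef t s * (norm \<zeta> powr (2 * s) / \<mu> / 2) = (\<integral>\<tau>\<in>{0..t}. exp (- (2 * s * \<tau>)) * (norm \<zeta> powr (2 * s) / \<mu> / 2) \<partial>lborel)"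
      unfolding set_integral_mult_left using acoef_integral[of s t] s t by simp
    also have "\<dots> \<le> (\<integral>\<tau>\<in>{0..t}. Re (1 - K (exp (- \<tau>) *\<^sub>R \<eta>)) \<partial>lborel)"
    proof (rule set_integral_mono)
      show "set_integrable lborel {0..t} (\<lambda>\<tau>. Re (1 - K (exp (- \<tau>) *\<^sub>R \<eta>)))"
        using integrable_Re[OF Ki[unfolded set_integrable_def]] by (simp add: set_integrable_def)
      show "set_integrable lborel {0..t} (\<lambda>\<tau>. exp (- (2 * s * \<tau>)) * (norm \<zeta> powr (2 * s) / \<mu> / 2))"
        by (intro borel_integrable_atLeastAtMost' continuous_intros)
      fix \<tau> assume \<tau>: "\<tau> \<in> {0..t}"
      have "norm (exp (- \<tau>) *\<^sub>R \<eta>) \<le> r0" using le[OF \<tau>] small n\<eta> by linarith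
      from one_minus_K(1)[OF this] show "exp (- (2 * s * \<tau>)) * (norm \<zeta> powr (2 * s) / \<mu> / 2) \<le> Re (1 - K (exp (- \<tau>) *\<^sub>R \<eta>))"
        unfolding n\<tau> by simp
    qed
    also have "\<dots> = Re (of_real t - m \<eta>)"
      unfolding t_minus_m set_lebesgue_integral_def using integral_Re[OF Ki[unfolded set_integrable_def]] by simp
    finally show ?thesis .
  qed
  then have "\<mu> * (acoef t s * (norm \<zeta> powr (2 * s) / \<mu> / 2)) \<le> \<mu> * Re (of_real t - m \<eta>)" using \<mu> by (intro mult_left_mono) auto
  then show "Re (of_real \<mu> * (m (\<beta> \<mu> *\<^sub>R \<zeta>) - of_real t)) \<le> - (acoef t s / 2 * norm \<zeta> powr (2 * s))"
    using \<mu> by (simp add: \<eta>_def algebra_simps)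
qed

lemma exponent_tendsto:
  "(\<lambda>n. of_real (real n + 1) * (m (\<beta> (real n + 1) *\<^sub>R \<zeta>) - of_real t)) \<longlonglongrightarrow> - of_real (acoef t s * norm \<zeta> powr (2 * s))"
proof -
  have bl: "(\<lambda>n. \<beta> (real n + 1)) \<longlonglongrightarrow> 0"
  proof (rule tendsto_sandwich)
    show "eventually (\<lambda>n. 0 \<le> \<beta> (real n + 1)) sequentially" using \<beta>_bounds(1) by (auto intro!: always_eventually less_imp_le)
    show "eventually (\<lambda>n. \<beta> (real n + 1) \<le> (real n + 1) powr (- 1/2)) sequentially" by (intro always_eventually allI \<beta>_bounds(3)) simp
    show "(\<lambda>n. (real n + 1) powr (- 1/2)) \<longlonglongrightarrow> 0" by real_asymp
  qed simp
  then have "(\<lambda>n. \<beta> (real n + 1) * norm \<zeta>) \<longlonglongrightarrow> 0 * norm \<zeta>" by (intro tendsto_intros)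
  then have "eventually (\<lambda>n. \<beta> (real n + 1) * norm \<zeta> < r0) sequentially" using r0 by (intro order_tendstoD(2)) auto
  then have ev: "eventually (\<lambda>n. norm (of_real (real n + 1) * (m (\<beta> (real n + 1) *\<^sub>R \<zeta>) - of_real t) - (- of_real (acoef t s * norm \<zeta> powr (2 * s)))) \<le> t * C0 * \<beta> (real n + 1) powr \<delta> * norm \<zeta> powr (2 * s + \<delta>)) sequentially"
  proof eventually_elim
    case (elim n)
    then show ?case using exponent_expansion(1)[of "real n + 1" \<zeta>] by simp
  qed
  have "(\<lambda>n. t * C0 * \<beta> (real n + 1) powr \<delta> * norm \<zeta> powr (2 * s + \<delta>)) \<longlonglongrightarrow> t * C0 * 0 powr \<delta> * norm \<zeta> powr (2 * s + \<delta>)"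
    using \<delta> \<beta>_bounds(1) by (intro tendsto_intros tendsto_powr'[OF bl]) (auto intro!: always_eventually less_imp_le)
  then have z: "(\<lambda>n. t * C0 * \<beta> (real n + 1) powr \<delta> * norm \<zeta> powr (2 * s + \<delta>)) \<longlonglongrightarrow> 0" by simp
  show ?thesis by (rule LIM_zero_cancel, rule Lim_null_comparison[OF ev z])
qed

text \<open>A limit of compound Poisson multipliers of the given kernel, of intensity \<theta> \<mu>
  at scale \<open>\<beta> \<mu>\<close>. Positivity of the stable law is thus inherited from the
  kernel, which confines it to the open range of \<open>s\<close>.\<close>

lemma posm_stab: assumes "0 \<le> \<theta>" shows "posm (\<lambda>\<zeta>::'a. complex_of_real (stab \<theta> t s \<zeta>))"
proof -
  let ?e = "\<lambda>n \<zeta>. of_real (\<theta> * (real n + 1)) * m (\<beta> (real n + 1) *\<^sub>R \<zeta>)"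
  have 1: "posm (\<lambda>\<zeta>. of_real (exp (- (\<theta> * (real n + 1) * t))) * exp (?e n \<zeta>))" for n
    using assms by (intro posm_scale posm_exp posm_jump) auto
  have eq: "of_real (exp (- (\<theta> * (real n + 1) * t))) * exp (?e n \<zeta>) = exp (of_real \<theta> * (of_real (real n + 1) * (m (\<beta> (real n + 1) *\<^sub>R \<zeta>) - of_real t)))" for n \<zeta>
    by (simp add: exp_of_real[symmetric] exp_add[symmetric] algebra_simps flip: exp_of_real)
  have 2: "(\<lambda>n. of_real (exp (- (\<theta> * (real n + 1) * t))) * exp (?e n \<zeta>)) \<longlonglongrightarrow> complex_of_real (stab \<theta> t s \<zeta>)" for \<zeta>
  proof -
    have "(\<lambda>n. exp (of_real \<theta> * (of_real (real n + 1) * (m (\<beta> (real n + 1) *\<^sub>R \<zeta>) - of_real t)))) \<longlonglongrightarrow> exp (of_real \<theta> * (- of_real (acoef t s * norm \<zeta> powr (2 * s))))"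
      by (intro tendsto_intros exponent_tendsto)
    also have "exp (of_real \<theta> * (- of_real (acoef t s * norm \<zeta> powr (2 * s)))) = complex_of_real (stab \<theta> t s \<zeta>)"
      by (simp add: stab_def mult_ac flip: exp_of_real)
    finally show ?thesis unfolding eq .
  qed
  have 3: "norm (of_real (exp (- (\<theta> * (real n + 1) * t))) * exp (?e n \<zeta>)) \<le> 1" for n \<zeta>
    unfolding eq norm_exp_eq_Re using assms Re_m_le[of "\<beta> (real n + 1) *\<^sub>R \<zeta>"]
    by (simp add: mult_nonneg_nonpos)
  show ?thesis by (rule posm_lim[OF 1 2 3])
qed

lemma stab_ft_nonneg: "0 < \<theta> \<Longrightarrow> 0 \<le> Re (ftr (stab \<theta> t s) (x::'a))"
proof -
  assume \<theta>: "0 < \<theta>"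
  have "integrable lborel (\<lambda>\<zeta>::'a. complex_of_real (stab \<theta> t s \<zeta>))"
    using integrable_stab[of s t \<theta>, where 'a='a] s t \<theta> by simp
  then show ?thesis using \<theta> by (intro posm_ft_nonneg posm_stab) auto
qed

end

text \<open>Compactness in \<open>s\<close> needs the endpoints 1/2 and 1, for which there is no
  kernel: nonnegativity reaches them by continuity in \<open>s\<close>. Strict positivity then holds
  on the closed interval because \<open>stab 1\<close> is the square of \<open>stab (1/2)\<close>,
  and a continuous positive function on a compact set has a positive minimum.\<close>

lemma stab_ft_pos_uniform:
  assumes t: "0 < t"
    and nn: "\<And>s x. 1/2 < s \<Longrightarrow> s < 1 \<Longrightarrow> 0 \<le> Re (ftr (stab (1/2) t s) (x::'a::euclidean_space))"
  shows "\<exists>\<alpha>>0. \<forall>s x. 1/2 \<le> s \<longrightarrow> s \<le> 1 \<longrightarrow> norm (x::'a) \<le> \<rho> \<longrightarrow> \<alpha> \<le> Re (ftr (stab 1 t s) x)"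
proof -
  have nn': "0 \<le> Re (ftr (stab (1/2) t s) x)" if s: "1/2 \<le> s" "s \<le> 1" for s and x :: 'a
  proof -
    \<comment> \<open>A convex combination of \<open>s\<close> and 3/4 with weight
      \<open>1 / (n + 2)\<close> on 3/4: it is interior for every n, and it tends to
      \<open>s\<close>.\<close>
    define sn where "sn n = s + (3/4 - s) * (1 / (real n + 2))" for n
    have sn: "1/2 < sn n" "sn n < 1" for n
    proof -
      define w where "w = 1 / (real n + 2)"
      have w: "0 < w" "w \<le> 1/2" by (auto simp: w_def field_simps)
      define X where "X = (1 - w) * s"
      have eq: "sn n = X + w * (3/4)" by (simp add: sn_def w_def X_def algebra_simps)
      have b: "(1 - w) * (1/2) \<le> X" "X \<le> (1 - w) * 1" unfolding X_def using s w by (intro mult_left_mono; simp)+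
      have b': "1 \<le> 2 * X + w" "X + w \<le> 1" using b by (simp_all add: algebra_simps)
      have "sn n * 4 = 4 * X + 3 * w" by (simp add: eq)
      then show "1/2 < sn n" "sn n < 1" using b' w by simp_all
    qed
    have "(\<lambda>n. 1 / (real n + 2)) \<longlonglongrightarrow> 0" by real_asymp
    then have "sn \<longlonglongrightarrow> s + (3/4 - s) * 0" unfolding sn_def by (intro tendsto_intros)
    then have lim: "sn \<longlonglongrightarrow> s" by simp
    have "(\<lambda>n. Re (ftr (stab (1/2) t (sn n)) x)) \<longlonglongrightarrow> Re (ftr (stab (1/2) t s) x)"
      by (intro tendsto_Re stab_ft_tendsto) (use sn t lim in \<open>auto simp: less_imp_le\<close>)
    then show ?thesis by (rule LIMSEQ_le_const) (use nn sn in auto)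
  qed
  have pos: "0 < Re (ftr (stab 1 t s) x)" if s: "1/2 \<le> s" "s \<le> 1" for s and x :: 'a
  proof -
    let ?c = "1/2 * (t * exp (- (2 * t)))"
    have sq: "stab 1 t s = (\<lambda>\<zeta>::'a. (stab (1/2) t s \<zeta>)\<^sup>2)"
      by (auto simp: stab_def power2_eq_square exp_add[symmetric])
    show ?thesis unfolding sq
    proof (rule ft_square_pos)
      show "stab (1/2) t s \<xi> \<le> exp ?c * exp (- (?c * norm \<xi>))" for \<xi> :: 'a using s t by (intro stab_le) auto
      show "continuous_on UNIV (stab (1/2) t s :: 'a \<Rightarrow> real)" using s by (intro continuous_stab) auto
    qed (use t nn'[OF s] stab_pos stab_minus in auto)
  qed
  define G where "G = (\<lambda>(s, x::'a). Re (ftr (stab 1 t s) x))"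
  define KK where "KK = {1/2..1::real} \<times> cball (0::'a) (max \<rho> 0)"
  have "compact KK" unfolding KK_def by (intro compact_Times) auto
  moreover have "KK \<noteq> {}" by (auto simp: KK_def)
  moreover have "continuous_on KK G"
    unfolding continuous_on_sequentially
  proof (intro ballI allI impI)
    fix p and a assume a: "a \<in> KK" and p: "(\<forall>n. p n \<in> KK) \<and> p \<longlonglongrightarrow> a"
    have "(\<lambda>n. Re (ft (\<lambda>\<zeta>. of_real (stab 1 t (fst (p n)) \<zeta>)) (snd (p n)))) \<longlonglongrightarrow> Re (ftr (stab 1 t (fst a)) (snd a))"
      using p t by (intro tendsto_Re stab_ft_tendsto tendsto_fst tendsto_snd) (auto simp: KK_def mem_Times_iff)
    then show "(G \<circ> p) \<longlonglongrightarrow> G a" by (simp add: G_def o_def split_beta')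
  qed
  ultimately obtain z where z: "z \<in> KK" "\<And>y. y \<in> KK \<Longrightarrow> G z \<le> G y" using continuous_attains_inf by metis
  have "0 < G z" using z(1) pos by (auto simp: G_def KK_def split_beta')
  moreover have "G z \<le> Re (ftr (stab 1 t s) x)" if "1/2 \<le> s" "s \<le> 1" "norm x \<le> \<rho>" for s and x :: 'a
    using z(2)[of "(s, x)"] that by (auto simp: G_def KK_def)
  ultimately show ?thesis by blast
qed

section \<open>Local limit theorem\<close>

lemma ft_scale:
  fixes W :: "'a::euclidean_space \<Rightarrow> complex"
  assumes c: "0 < c" and W: "W \<in> borel_measurable borel"
  shows "ft (\<lambda>\<xi>. W (c *\<^sub>R \<xi>)) y = (1 / c ^ DIM('a)) *\<^sub>R ft W (y /\<^sub>R c)"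
proof -
  have "ft (\<lambda>\<xi>. W (c *\<^sub>R \<xi>)) y = (\<integral>\<xi>. W (0 + c *\<^sub>R \<xi>) * cis ((0 + c *\<^sub>R \<xi>) \<bullet> (y /\<^sub>R c)) \<partial>lborel)"
    unfolding ft_def using c by (simp add: mult.assoc[symmetric])
  also have "\<dots> = (1 / \<bar>c\<bar> ^ DIM('a)) *\<^sub>R (\<integral>\<xi>. W \<xi> * cis (\<xi> \<bullet> (y /\<^sub>R c)) \<partial>lborel)"
    using c W by (intro integral_lborel_affine[where f="\<lambda>\<xi>. W \<xi> * cis (\<xi> \<bullet> (y /\<^sub>R c))"]) auto
  finally show ?thesis using c by (simp add: ft_def)
qed

text \<open>Convolution of positive measures is monotone in each factor; the factors are exchanged
  one at a time.\<close>

lemma posm_prod_diff: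
  assumes "finite I" "\<And>i. i \<in> I \<Longrightarrow> posm (f i)" "\<And>i. i \<in> I \<Longrightarrow> posm (\<lambda>\<xi>. g i \<xi> - f i \<xi>)"
  shows "posm (\<lambda>\<xi>. (\<Prod>i\<in>I. g i \<xi>) - (\<Prod>i\<in>I. f i \<xi>))"
  using assms
proof (induction I rule: finite_induct)
  case empty
  then show ?case using posm_const[of 0] by simp
next
  case (insert i I)
  have g: "posm (g j)" if "j \<in> insert i I" for j
    using posm_add[OF insert.prems(1)[OF that] insert.prems(2)[OF that]] by simp
  have "posm (\<lambda>\<xi>. (g i \<xi> - f i \<xi>) * (\<Prod>i\<in>I. g i \<xi>) + f i \<xi> * ((\<Prod>i\<in>I. g i \<xi>) - (\<Prod>i\<in>I. f i \<xi>)))"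
    using insert g by (intro posm_add posm_mult posm_prod) auto
  then show ?case using insert.hyps by (simp add: algebra_simps)
qed

lemma posm_power_diff:
  assumes "posm f" "posm (\<lambda>\<xi>. g \<xi> - f \<xi>)"
  shows "posm (\<lambda>\<xi>. g \<xi> ^ n - f \<xi> ^ n)"
  using posm_prod_diff[of "{..<n}" "\<lambda>_. f" "\<lambda>_. g"] assms by simp

lemma exp_tail_bound:
  fixes z :: complex
  assumes "norm z \<le> r"
  shows "norm (exp z - (\<Sum>j<N. z ^ j / fact j)) \<le> exp r - (\<Sum>j<N. r ^ j / fact j)"
proof -
  have ez: "(\<lambda>n. z ^ n / fact n) sums exp z"
    using exp_converges[of z] by (simp add: scaleR_conv_of_real divide_inverse mult.commute)
  have er: "(\<lambda>n. r ^ n / fact n) sums exp r"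
    using exp_converges[of r] by (simp add: divide_inverse mult.commute)
  have tz: "(\<lambda>n. z ^ (n + N) / fact (n + N)) sums (exp z - (\<Sum>j<N. z ^ j / fact j))"
    using sums_split_initial_segment[OF ez] .
  have tr: "(\<lambda>n. r ^ (n + N) / fact (n + N)) sums (exp r - (\<Sum>j<N. r ^ j / fact j))"
    using sums_split_initial_segment[OF er] .
  have le: "norm (z ^ (n + N) / fact (n + N)) \<le> r ^ (n + N) / fact (n + N)" for n
    using assms by (simp add: norm_divide norm_power divide_right_mono power_mono)
  show ?thesis using norm_suminf_le[OF le sums_summable[OF tr]] tz tr by (simp add: sums_iff)
qed

context jump_consts begin

text \<open>An integer above \<open>2 * s + \<delta>\<close> for every s \<le> 1, so that one
  majorant with integer powers serves all \<open>s\<close>.\<close>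

definition deg where "deg \<delta> = nat \<lceil>2 + \<delta>\<rceil>"
definition g1 where "g1 \<delta> (\<zeta>::'a) = (1 + norm \<zeta>) ^ deg \<delta> * exp (- (c0 * norm \<zeta>))"
definition g2 where "g2 (\<zeta>::'a) = 1 / (1 + norm \<zeta>) ^ (2 * DIM('a))"
text \<open>The three summands are the error of the exponent, the variation of
  \<open>slabs J\<close> from its value at 0, and the stable multiplier beyond the range of the
  expansion. In each, the scale \<open>\<beta> \<mu>\<close> is replaced by its bound
  \<open>\<mu> powr (- 1/2)\<close>; \<open>exp c0\<close> comes from the exponential
  majorant.\<close>

definition e1 where "e1 C0 \<delta> \<mu> = (t * C0 * \<mu> powr (- \<delta> / 2) + real (2 * DIM('a)) * (real (card S) * A) * \<mu> powr (- 1/2) + \<mu> powr (- 1/2) / r0) * exp c0"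
text \<open>High frequencies: coercivity makes the Poisson factor exponentially small in \<mu>,
  which beats the power of \<mu> lost when the decay of \<open>slabs J\<close> is rescaled by means
  of \<open>1 / \<mu> \<le> \<beta> \<mu>\<close>.\<close>

definition e2 where "e2 \<mu> = dconst * \<mu> ^ (2 * DIM('a)) * exp (- (\<mu> * (\<kappa> * (r0\<^sup>2 / 4))))"
text \<open>Both parts of the error involve the kernel only through the constants of the locale.\<close>

definition err where "err C0 \<delta> \<mu> = e1 C0 \<delta> \<mu> * (\<integral>\<zeta>. g1 \<delta> \<zeta> \<partial>lborel) + e2 \<mu> * (\<integral>\<zeta>. g2 \<zeta> \<partial>lborel)"

lemma g1_int: "integrable lborel (g1 \<delta>)"
  unfolding g1_def[abs_def] by (rule integrable_power_exp_norm) (rule consts_pos)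

lemma g2_int: "integrable lborel g2"
  unfolding g2_def[abs_def] by (rule integrable_inverse_power_norm)

lemma g2_nonneg: "0 \<le> g2 \<zeta>"
  by (simp add: g2_def)

lemma err_tendsto: assumes "0 < \<delta>" shows "(err C0 \<delta> \<longlongrightarrow> 0) at_top"
proof -
  have p: "((\<lambda>\<mu>::real. \<mu> powr (- c)) \<longlongrightarrow> 0) at_top" if "0 < c" for c :: real
    using that by (intro tendsto_neg_powr filterlim_ident) auto
  have "(e1 C0 \<delta> \<longlongrightarrow> (t * C0 * 0 + real (2 * DIM('a)) * (real (card S) * A) * 0 + 0 / r0) * exp c0) at_top"
    unfolding e1_def using p[of "\<delta> / 2"] p[of "1/2"] assms r0 by (intro tendsto_intros) auto
  then have 1: "(e1 C0 \<delta> \<longlongrightarrow> 0) at_top" by simp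
  define c where "c = \<kappa> * (r0\<^sup>2 / 4)"
  have c: "0 < c" using \<kappa> r0 by (simp add: c_def)
  have "((\<lambda>\<mu>. dconst * \<mu> ^ (2 * DIM('a)) * exp (- (\<mu> * c))) \<longlongrightarrow> 0) at_top"
    using c by real_asymp
  then have 2: "(e2 \<longlongrightarrow> 0) at_top" by (simp add: e2_def[abs_def] c_def)
  have "(err C0 \<delta> \<longlongrightarrow> 0 * (\<integral>\<zeta>. g1 \<delta> \<zeta> \<partial>lborel) + 0 * (\<integral>\<zeta>. g2 \<zeta> \<partial>lborel)) at_top"
    unfolding err_def[abs_def] by (intro tendsto_intros 1 2)
  then show ?thesis by simp
qed

end

context jump_kernel begin

text \<open>The smoothing jumps followed by a compound Poisson number of free jumps, of intensity
  \<mu> per unit of time. The second factor has modulus at most 1, so \<open>slabs J\<close> alone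
  makes the product integrable.\<close>

definition khat where "khat \<mu> \<eta> = slabs J \<eta> * exp (of_real \<mu> * (m \<eta> - of_real t))"

lemma khat_measurable [measurable]: "khat \<mu> \<in> borel_measurable borel"
  unfolding khat_def[abs_def] by measurable

lemma slabs_int: "integrable lborel (slabs J)"
proof (rule Bochner_Integration.integrable_bound)
  show "integrable lborel (\<lambda>\<eta>. dconst * g2 \<eta>)" using g2_int by auto
  show "AE \<eta> in lborel. norm (slabs J \<eta>) \<le> norm (dconst * g2 \<eta>)"
    using norm_slabs_decay consts_pos by (intro AE_I2) (simp add: g2_def)
qed simp

lemma norm_khat_le: "0 \<le> \<mu> \<Longrightarrow> cmod (khat \<mu> \<eta>) \<le> cmod (slabs J \<eta>)"
  using Re_m_le[of \<eta>] mult_left_mono[of "exp (\<mu> * (Re (m \<eta>) - t))" 1 "cmod (slabs J \<eta>)"]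
  by (simp add: khat_def norm_mult mult_nonneg_nonpos)

lemma integrable_scaled:
  fixes W :: "'a \<Rightarrow> complex"
  assumes "integrable lborel W" "0 < c"
  shows "integrable lborel (\<lambda>\<xi>. W (c *\<^sub>R \<xi>))"
  using integrable_lborel_affine_iff[of c W 0] assms by auto

lemma khat_int: "0 \<le> \<mu> \<Longrightarrow> integrable lborel (khat \<mu>)"
  by (rule Bochner_Integration.integrable_bound[OF slabs_int]) (use norm_khat_le in auto)

text \<open>Up to rescaled frequency \<open>r0\<close> the two products are compared factor by
  factor. Beyond it they are not compared at all: each is small by itself.\<close>

lemma local_limit_pointwise:
  assumes \<mu>: "1 \<le> \<mu>"
  shows "cmod (khat \<mu> (\<beta> \<mu> *\<^sub>R \<zeta>) - of_real (Q * stab 1 t s \<zeta>)) \<le> e1 C0 \<delta> \<mu> * g1 \<delta> \<zeta> + e2 \<mu> * g2 \<zeta>"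
proof -
  note b = \<beta>_bounds[OF \<mu>]
  define X where "X = exp c0 * exp (- (c0 * norm \<zeta>))"
  define r where "r = (1 + norm \<zeta>) ^ deg \<delta>"
  have X0: "0 < X" by (simp add: X_def)
  have g1X: "exp c0 * g1 \<delta> \<zeta> = r * X" by (simp add: g1_def X_def r_def)
  have NN1: "1 \<le> deg \<delta>" "2 + \<delta> \<le> real (deg \<delta>)" using \<delta> unfolding deg_def by linarith+
  have r1: "norm \<zeta> \<le> r" "1 \<le> r"
  proof -
    have "(1 + norm \<zeta>) ^ 1 \<le> r" unfolding r_def by (rule power_increasing[OF NN1(1)]) simp
    then show "norm \<zeta> \<le> r" by simp
    show "1 \<le> r" unfolding r_def by (rule one_le_power) simp
  qed
  have rp: "norm \<zeta> powr (2 * s + \<delta>) \<le> r"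
  proof -
    have "norm \<zeta> powr (2 * s + \<delta>) \<le> (1 + norm \<zeta>) powr (2 * s + \<delta>)" using s \<delta> by (intro powr_mono2) auto
    also have "\<dots> \<le> (1 + norm \<zeta>) powr (real (deg \<delta>))" using s NN1 by (intro powr_mono) auto
    also have "\<dots> = r" unfolding r_def by (rule powr_realpow) (simp add: add_pos_nonneg)
    finally show ?thesis .
  qed
  have ac: "t * exp (- (2 * t)) \<le> acoef t s" using acoef_bounds[of s t] s t by simp
  have stabX: "exp (- (acoef t s / 2 * norm \<zeta> powr (2 * s))) \<le> X"
    unfolding X_def using s t ac by (intro exp_norm_powr_le) (auto simp: c0_def)
  have ac0: "0 \<le> acoef t s" using ac t by (meson exp_ge_zero less_imp_le mult_nonneg_nonneg order_trans)
  have stab1: "stab 1 t s \<zeta> \<le> X"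
  proof (rule order_trans[OF _ stabX])
    show "stab 1 t s \<zeta> \<le> exp (- (acoef t s / 2 * norm \<zeta> powr (2 * s)))"
      unfolding stab_def using ac0 by (simp add: mult_nonneg_nonneg)
  qed
  have Q01: "0 \<le> Q" "Q \<le> 1" using Q_bounds consts_pos by linarith+
  have nn: "0 \<le> e1 C0 \<delta> \<mu>" "0 \<le> e2 \<mu>"
    unfolding e1_def e2_def using t C0 A r0 consts_pos \<mu> by (auto intro!: mult_nonneg_nonneg add_nonneg_nonneg divide_nonneg_pos)
  define hb where "hb = \<mu> powr (- 1/2)"
  have hb: "0 < hb" "\<beta> \<mu> \<le> hb" using b \<mu> by (auto simp: hb_def)
  show ?thesis
  proof (cases "\<beta> \<mu> * norm \<zeta> \<le> r0")
    case True
    define Z where "Z = of_real \<mu> * (m (\<beta> \<mu> *\<^sub>R \<zeta>) - of_real t)"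
    define z where "z = complex_of_real (- (acoef t s * norm \<zeta> powr (2 * s)))"
    have ez: "exp z = of_real (stab 1 t s \<zeta>)" unfolding z_def stab_def by (simp flip: exp_of_real)
    have bd: "\<beta> \<mu> powr \<delta> \<le> \<mu> powr (- \<delta> / 2)"
    proof -
      have "\<beta> \<mu> powr \<delta> \<le> (\<mu> powr (- 1/2)) powr \<delta>" using b \<delta> by (intro powr_mono2) auto
      then show ?thesis by (simp add: powr_powr)
    qed
    have "cmod (exp Z - exp z) \<le> exp (- (acoef t s / 2 * norm \<zeta> powr (2 * s))) * cmod (Z - z)"
    proof (rule norm_exp_diff_le)
      show "Re Z \<le> - (acoef t s / 2 * norm \<zeta> powr (2 * s))" unfolding Z_def by (rule exponent_expansion(2)[OF \<mu> True])
      show "Re z \<le> - (acoef t s / 2 * norm \<zeta> powr (2 * s))" using ac0 by (simp add: z_def mult_nonneg_nonneg)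
    qed
    also have "\<dots> \<le> X * (t * C0 * \<mu> powr (- \<delta> / 2) * r)"
    proof (rule mult_mono[OF stabX])
      have "cmod (Z - z) \<le> t * C0 * \<beta> \<mu> powr \<delta> * norm \<zeta> powr (2 * s + \<delta>)"
        using exponent_expansion(1)[OF \<mu> True] by (simp add: Z_def z_def)
      also have "\<dots> \<le> t * C0 * \<mu> powr (- \<delta> / 2) * r" using t C0 bd rp by (intro mult_mono) auto
      finally show "cmod (Z - z) \<le> t * C0 * \<mu> powr (- \<delta> / 2) * r" .
    qed (use X0 in auto)
    finally have d1: "cmod (exp Z - exp z) \<le> X * (t * C0 * \<mu> powr (- \<delta> / 2) * r)" .
    have d2: "cmod (slabs J (\<beta> \<mu> *\<^sub>R \<zeta>) - of_real Q) \<le> real (2 * DIM('a)) * (real (card S) * A) * hb * r"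
    proof -
      have "A * norm (\<beta> \<mu> *\<^sub>R \<zeta>) \<le> A * (hb * r)" using A b hb r1 by (auto intro!: mult_left_mono mult_mono)
      then have "real (2 * DIM('a)) * (real (card S) * (A * norm (\<beta> \<mu> *\<^sub>R \<zeta>))) \<le> real (2 * DIM('a)) * (real (card S) * (A * (hb * r)))"
        by (rule mult_left_mono[OF mult_left_mono]) auto
      with slabs_near_0[of "\<beta> \<mu> *\<^sub>R \<zeta>"] show ?thesis by (simp add: mult_ac)
    qed
    have "khat \<mu> (\<beta> \<mu> *\<^sub>R \<zeta>) - of_real (Q * stab 1 t s \<zeta>) = slabs J (\<beta> \<mu> *\<^sub>R \<zeta>) * (exp Z - exp z) + (slabs J (\<beta> \<mu> *\<^sub>R \<zeta>) - of_real Q) * exp z"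
      unfolding khat_def Z_def[symmetric] ez by (simp add: algebra_simps)
    then have "cmod (khat \<mu> (\<beta> \<mu> *\<^sub>R \<zeta>) - of_real (Q * stab 1 t s \<zeta>)) \<le> cmod (slabs J (\<beta> \<mu> *\<^sub>R \<zeta>)) * cmod (exp Z - exp z) + cmod (slabs J (\<beta> \<mu> *\<^sub>R \<zeta>) - of_real Q) * cmod (exp z)"
      by (metis norm_mult norm_triangle_ineq)
    also have "\<dots> \<le> 1 * (X * (t * C0 * \<mu> powr (- \<delta> / 2) * r)) + (real (2 * DIM('a)) * (real (card S) * A) * hb * r) * X"
      using d1 d2 norm_slabs_le_1 stab1 stab_pos[of 1 t s \<zeta>] A hb r1
      by (intro add_mono mult_mono) (auto simp: ez)
    also have "\<dots> \<le> (t * C0 * \<mu> powr (- \<delta> / 2) + real (2 * DIM('a)) * (real (card S) * A) * hb + hb / r0) * (r * X)"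
    proof -
      have "0 \<le> hb / r0 * (r * X)" using hb r0 r1 X0 by (intro mult_nonneg_nonneg divide_nonneg_pos) auto
      then show ?thesis by (simp add: algebra_simps)
    qed
    also have "\<dots> = e1 C0 \<delta> \<mu> * g1 \<delta> \<zeta>" unfolding e1_def hb_def[symmetric] g1X[symmetric] by simp
    finally show ?thesis using nn g2_nonneg[of \<zeta>] by (simp add: add_increasing2)
  next
    case False
    then have big: "r0 \<le> norm (\<beta> \<mu> *\<^sub>R \<zeta>)" using b by simp
    have h1: "cmod (khat \<mu> (\<beta> \<mu> *\<^sub>R \<zeta>)) \<le> e2 \<mu> * g2 \<zeta>"
    proof -
      have "1 / \<mu> * (1 + norm \<zeta>) \<le> \<beta> \<mu> * (1 + norm \<zeta>)" using b by (intro mult_right_mono) auto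
      also have "\<dots> \<le> 1 + norm (\<beta> \<mu> *\<^sub>R \<zeta>)" using b by (simp add: algebra_simps)
      finally have "(1 / \<mu> * (1 + norm \<zeta>)) ^ (2 * DIM('a)) \<le> (1 + norm (\<beta> \<mu> *\<^sub>R \<zeta>)) ^ (2 * DIM('a))"
        using \<mu> by (intro power_mono) auto
      moreover have "0 < (1 / \<mu> * (1 + norm \<zeta>)) ^ (2 * DIM('a))" using \<mu> by (intro zero_less_power mult_pos_pos) (auto simp: add_pos_nonneg)
      ultimately have "dconst / (1 + norm (\<beta> \<mu> *\<^sub>R \<zeta>)) ^ (2 * DIM('a)) \<le> dconst / (1 / \<mu> * (1 + norm \<zeta>)) ^ (2 * DIM('a))"
        using consts_pos by (intro divide_left_mono) auto
      also have "\<dots> = dconst * \<mu> ^ (2 * DIM('a)) * g2 \<zeta>" using \<mu> by (simp add: g2_def power_mult_distrib power_divide)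
      finally have p: "cmod (slabs J (\<beta> \<mu> *\<^sub>R \<zeta>)) \<le> dconst * \<mu> ^ (2 * DIM('a)) * g2 \<zeta>"
        using norm_slabs_decay order_trans by blast
      have "\<mu> * (Re (m (\<beta> \<mu> *\<^sub>R \<zeta>)) - t) \<le> \<mu> * (- (\<kappa> * (r0\<^sup>2 / 4)))"
        using m_large[OF big] \<mu> by (intro mult_left_mono) auto
      then have "cmod (exp (of_real \<mu> * (m (\<beta> \<mu> *\<^sub>R \<zeta>) - of_real t))) \<le> exp (- (\<mu> * (\<kappa> * (r0\<^sup>2 / 4))))"
        by simp
      then have "cmod (khat \<mu> (\<beta> \<mu> *\<^sub>R \<zeta>)) \<le> (dconst * \<mu> ^ (2 * DIM('a)) * g2 \<zeta>) * exp (- (\<mu> * (\<kappa> * (r0\<^sup>2 / 4))))"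
        unfolding khat_def norm_mult using p by (intro mult_mono) (auto intro: order_trans[OF norm_ge_zero])
      then show ?thesis by (simp add: e2_def mult_ac)
    qed
    have h2: "Q * stab 1 t s \<zeta> \<le> e1 C0 \<delta> \<mu> * g1 \<delta> \<zeta>"
    proof -
      have "r0 \<le> hb * norm \<zeta>" using False hb mult_right_mono[OF hb(2), of "norm \<zeta>"] by simp
      also have "\<dots> \<le> hb * r" using hb r1 by (intro mult_left_mono) auto
      \<comment> \<open>Outside the range of the expansion \<open>norm \<zeta>\<close> exceeds
        \<open>r0 / hb\<close>. Spending one power of the polynomial weight therefore buys the small
        factor \<open>hb / r0\<close>, the third summand of \<open>e1\<close>.\<close>
      finally have one: "1 \<le> hb / r0 * r" using r0 by (simp add: field_simps)
      have "Q * stab 1 t s \<zeta> \<le> 1 * X" using Q01 stab1 stab_pos[of 1 t s \<zeta>] by (intro mult_mono) auto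
      also have "\<dots> \<le> hb / r0 * r * X" using one X0 by (intro mult_right_mono) auto
      also have "\<dots> = hb / r0 * (r * X)" by simp
      also have "\<dots> \<le> (t * C0 * \<mu> powr (- \<delta> / 2) + real (2 * DIM('a)) * (real (card S) * A) * hb + hb / r0) * (r * X)"
        using t C0 A hb r1 X0 by (intro mult_right_mono) auto
      also have "\<dots> = e1 C0 \<delta> \<mu> * g1 \<delta> \<zeta>" unfolding e1_def hb_def[symmetric] g1X[symmetric] by simp
      finally show ?thesis .
    qed
    have "cmod (khat \<mu> (\<beta> \<mu> *\<^sub>R \<zeta>) - of_real (Q * stab 1 t s \<zeta>)) \<le> cmod (khat \<mu> (\<beta> \<mu> *\<^sub>R \<zeta>)) + cmod (of_real (Q * stab 1 t s \<zeta>))"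
      by (rule norm_triangle_ineq4)
    also have "cmod (of_real (Q * stab 1 t s \<zeta>)) = Q * stab 1 t s \<zeta>"
      using Q01 stab_pos[of 1 t s \<zeta>] by (simp only: norm_of_real abs_of_nonneg mult_nonneg_nonneg less_imp_le)
    finally show ?thesis using h1 h2 by linarith
  qed
qed

lemma local_limit:
  assumes \<mu>: "1 \<le> \<mu>"
  shows "Q * Re (ftr (stab 1 t s) x) - err C0 \<delta> \<mu> \<le> Re (ft (\<lambda>\<zeta>. khat \<mu> (\<beta> \<mu> *\<^sub>R \<zeta>)) x)"
proof -
  have i1: "integrable lborel (\<lambda>\<zeta>. khat \<mu> (\<beta> \<mu> *\<^sub>R \<zeta>))" using \<beta>_bounds[OF \<mu>] \<mu> by (intro integrable_scaled khat_int) auto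
  have st: "integrable lborel (\<lambda>\<zeta>::'a. complex_of_real (stab 1 t s \<zeta>))" using integrable_stab[of s t 1, where 'a='a] s t by simp
  have i2: "integrable lborel (\<lambda>\<zeta>::'a. of_real (Q * stab 1 t s \<zeta>) :: complex)"
    using integrable_mult_right[OF st, of "of_real Q"] by simp
  have "cmod (ft (\<lambda>\<zeta>. khat \<mu> (\<beta> \<mu> *\<^sub>R \<zeta>) - of_real (Q * stab 1 t s \<zeta>)) x) \<le> (\<integral>\<zeta>. cmod (khat \<mu> (\<beta> \<mu> *\<^sub>R \<zeta>) - of_real (Q * stab 1 t s \<zeta>)) \<partial>lborel)"
    by (rule norm_ft_le)
  also have "\<dots> \<le> (\<integral>\<zeta>. e1 C0 \<delta> \<mu> * g1 \<delta> \<zeta> + e2 \<mu> * g2 \<zeta> \<partial>lborel)"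
    using i1 i2 g1_int g2_int by (intro integral_mono local_limit_pointwise[OF \<mu>] integrable_norm Bochner_Integration.integrable_diff Bochner_Integration.integrable_add integrable_mult_right)
  also have "\<dots> = err C0 \<delta> \<mu>" using g1_int[of \<delta>] g2_int by (simp add: err_def)
  finally have "cmod (ft (\<lambda>\<zeta>. khat \<mu> (\<beta> \<mu> *\<^sub>R \<zeta>)) x - of_real Q * ftr (stab 1 t s) x) \<le> err C0 \<delta> \<mu>"
    unfolding ft_diff[OF i1 i2] by (simp add: ft_cmult)
  then have "Re (of_real Q * ftr (stab 1 t s) x - ft (\<lambda>\<zeta>. khat \<mu> (\<beta> \<mu> *\<^sub>R \<zeta>)) x) \<le> err C0 \<delta> \<mu>"
    using complex_Re_le_cmod order_trans by (metis norm_minus_commute)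
  then show ?thesis by simp
qed

end

section \<open>Uniform lower bound for the solution multiplier\<close>

context jump_consts begin

definition njumps where "njumps = card S * (2 * DIM('a))"

definition texp :: "real \<Rightarrow> nat \<Rightarrow> complex \<Rightarrow> complex" where
  "texp \<Lambda> N z = (\<Sum>j<N. (of_real \<Lambda> * z) ^ j / fact j)"

text \<open>The loss when intensity \<open>\<Lambda>\<close> is simulated by a truncated series
  shifted by \<open>njumps\<close>: \<open>\<Lambda> ^ N\<close> exceeds the powers of the intensity
  that occur, the factorial covers the shift of the index, and the power of \<open>t\<close> cancels
  the normalisation of the smoothing jumps.\<close>

definition tconst :: "real \<Rightarrow> nat \<Rightarrow> real" where
  "tconst \<Lambda> N = \<Lambda> ^ N * fact (N + njumps) / t ^ njumps"

end

context jump_kernel begin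

text \<open>For \<open>c = \<epsilon> powr (- 2 * s)\<close> this is the multiplier of the solution.
  Keeping \<open>c\<close> free separates the intensity from the spatial scale.\<close>

definition uhat where "uhat c \<epsilon> \<xi> = exp (of_real c * (m (\<epsilon> *\<^sub>R \<xi>) - of_real t))"

text \<open>Restricting each of \<open>njumps\<close> jumps to a prescribed slab only decreases the
  measure.\<close>

lemma posm_m_power_minus_slabs: "posm (\<lambda>\<xi>. (of_real (1 / t) * m (\<epsilon> *\<^sub>R \<xi>)) ^ njumps - slabs J (\<epsilon> *\<^sub>R \<xi>))"
proof -
  have "posm (\<lambda>\<xi>. (\<Prod>v\<in>S. of_real (1 / t) * m (\<epsilon> *\<^sub>R \<xi>)) ^ (2 * DIM('a)) - (\<Prod>v\<in>S. of_real (1 / t) * jump_mult t J (slab v) (\<epsilon> *\<^sub>R \<xi>)) ^ (2 * DIM('a)))"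
  proof (intro posm_power_diff posm_prod_diff posm_prod)
    fix v
    have "posm (\<lambda>\<xi>. of_real (1 / t) * (m (\<epsilon> *\<^sub>R \<xi>) - jump_mult t J (slab v) (\<epsilon> *\<^sub>R \<xi>)))"
      using t by (intro posm_scale posm_jump_diff) auto
    then show "posm (\<lambda>\<xi>. of_real (1 / t) * m (\<epsilon> *\<^sub>R \<xi>) - of_real (1 / t) * jump_mult t J (slab v) (\<epsilon> *\<^sub>R \<xi>))"
      by (simp only: right_diff_distrib)
  qed (use t S(1) in \<open>auto intro!: posm_scale posm_jump simp del: of_real_divide\<close>)
  then show ?thesis by (simp add: slabs_def njumps_def power_mult)
qed

text \<open>For large \<open>c\<close>, the \<open>njumps\<close> smoothing jumps cost only one unit of the Poisson intensity \<open>c t\<close>.\<close>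

lemma posm_many_jumps:
  assumes "1 / t \<le> c"
  shows "posm (\<lambda>\<xi>. uhat c \<epsilon> \<xi> - of_real (exp (- 1) / fact njumps) * khat (c - 1 / t) (\<epsilon> *\<^sub>R \<xi>))"
proof -
  define M where "M \<xi> = of_real (1 / t) * m (\<epsilon> *\<^sub>R \<xi>)" for \<xi>
  define \<mu> where "\<mu> = c - 1 / t"
  have M: "posm M" unfolding M_def using t by (intro posm_scale posm_jump) auto
  have "posm (\<lambda>\<xi>. exp (M \<xi>) - (\<Sum>n\<in>{njumps}. of_real (1 / fact njumps) * M \<xi> ^ n))"
    by (rule posm_exp_minus_sum[OF M]) auto
  moreover have "posm (\<lambda>\<xi>. of_real (1 / fact njumps) * (M \<xi> ^ njumps - slabs J (\<epsilon> *\<^sub>R \<xi>)))"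
    unfolding M_def by (rule posm_scale[OF posm_m_power_minus_slabs]) simp
  ultimately have "posm (\<lambda>\<xi>. (exp (M \<xi>) - (\<Sum>n\<in>{njumps}. of_real (1 / fact njumps) * M \<xi> ^ n)) + of_real (1 / fact njumps) * (M \<xi> ^ njumps - slabs J (\<epsilon> *\<^sub>R \<xi>)))"
    by (rule posm_add)
  then have "posm (\<lambda>\<xi>. exp (M \<xi>) - of_real (1 / fact njumps) * slabs J (\<epsilon> *\<^sub>R \<xi>))"
    by (simp add: algebra_simps)
  moreover have "posm (\<lambda>\<xi>. of_real (exp (- 1) * exp (- (\<mu> * t))) * exp (of_real \<mu> * m (\<epsilon> *\<^sub>R \<xi>)))"
    using assms by (intro posm_scale posm_exp posm_jump) (auto simp: \<mu>_def)
  ultimately have "posm (\<lambda>\<xi>. (exp (M \<xi>) - of_real (1 / fact njumps) * slabs J (\<epsilon> *\<^sub>R \<xi>)) * (of_real (exp (- 1) * exp (- (\<mu> * t))) * exp (of_real \<mu> * m (\<epsilon> *\<^sub>R \<xi>))))"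
    by (rule posm_mult)
  moreover have "(exp (M \<xi>) - of_real (1 / fact njumps) * slabs J (\<epsilon> *\<^sub>R \<xi>)) * (of_real (exp (- 1) * exp (- (\<mu> * t))) * exp (of_real \<mu> * m (\<epsilon> *\<^sub>R \<xi>)))
     = uhat c \<epsilon> \<xi> - of_real (exp (- 1) / fact njumps) * khat \<mu> (\<epsilon> *\<^sub>R \<xi>)" for \<xi>
  proof -
    define E where "E = exp (of_real \<mu> * (m (\<epsilon> *\<^sub>R \<xi>) - of_real t))"
    have 1: "complex_of_real (exp (- (\<mu> * t))) * exp (of_real \<mu> * m (\<epsilon> *\<^sub>R \<xi>)) = E"
      unfolding E_def by (simp add: exp_of_real[symmetric] exp_add[symmetric] algebra_simps flip: exp_of_real)
    have "of_real c * (m (\<epsilon> *\<^sub>R \<xi>) - of_real t) = (M \<xi> + complex_of_real (- 1)) + of_real \<mu> * (m (\<epsilon> *\<^sub>R \<xi>) - of_real t)"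
      using t by (simp add: M_def \<mu>_def algebra_simps)
    then have 2: "uhat c \<epsilon> \<xi> = exp (M \<xi>) * of_real (exp (- 1)) * E"
      by (simp only: uhat_def E_def exp_add exp_of_real)
    show ?thesis unfolding 2 khat_def E_def[symmetric] of_real_mult mult.assoc 1 by (simp add: algebra_simps)
  qed
  ultimately show ?thesis by (simp add: \<mu>_def)
qed

text \<open>For bounded \<open>c\<close>, a high intensity \<open>\<Lambda>\<close> is simulated by imposing at least \<open>njumps\<close> and fewer than
  \<open>N + njumps\<close> jumps, at the price of a constant factor.\<close>

lemma posm_few_jumps:
  assumes c: "1 \<le> c" and \<Lambda>: "1 \<le> \<Lambda>"
  shows "posm (\<lambda>\<xi>. uhat c \<epsilon> \<xi> - of_real (exp (- (c * t)) / tconst \<Lambda> N) * (slabs J (\<epsilon> *\<^sub>R \<xi>) * texp \<Lambda> N (m (\<epsilon> *\<^sub>R \<xi>))))"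
proof -
  have CC0: "0 < tconst \<Lambda> N" using \<Lambda> t by (simp add: tconst_def)
  define M where "M \<xi> = of_real c * m (\<epsilon> *\<^sub>R \<xi>)" for \<xi>
  have M: "posm M" unfolding M_def using c by (intro posm_scale posm_jump) auto
  define b where "b i = \<Lambda> ^ (i - njumps) / (fact (i - njumps) * t ^ njumps * tconst \<Lambda> N * c ^ i)" for i
  have b: "0 \<le> b i" "b i \<le> 1 / fact i" if "i \<in> {0 + njumps..<N + njumps}" for i
  proof -
    show "0 \<le> b i" unfolding b_def using \<Lambda> t c CC0 by (intro divide_nonneg_nonneg mult_nonneg_nonneg) auto
    have "t ^ njumps * tconst \<Lambda> N = \<Lambda> ^ N * fact (N + njumps)" using t by (simp add: tconst_def)
    then have "b i = \<Lambda> ^ (i - njumps) / (fact (i - njumps) * (\<Lambda> ^ N * fact (N + njumps)) * c ^ i)"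
      by (simp add: b_def mult.assoc)
    also have "\<dots> \<le> \<Lambda> ^ N / (1 * (\<Lambda> ^ N * fact i) * 1)"
      using that \<Lambda> c by (intro frac_le mult_mono power_increasing fact_mono one_le_power) (auto intro!: mult_pos_pos)
    also have "\<dots> = 1 / fact i" using \<Lambda> by simp
    finally show "b i \<le> 1 / fact i" .
  qed
  have "posm (\<lambda>\<xi>. exp (M \<xi>) - (\<Sum>i\<in>{0 + njumps..<N + njumps}. of_real (b i) * M \<xi> ^ i))"
    by (rule posm_exp_minus_sum[OF M b]) auto
  moreover have "(\<Sum>i\<in>{0 + njumps..<N + njumps}. of_real (b i) * M \<xi> ^ i) = of_real (1 / tconst \<Lambda> N) * ((of_real (1 / t) * m (\<epsilon> *\<^sub>R \<xi>)) ^ njumps * texp \<Lambda> N (m (\<epsilon> *\<^sub>R \<xi>)))" for \<xi>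
  proof -
    have tm: "of_real (b (j + njumps)) * M \<xi> ^ (j + njumps) = of_real (1 / tconst \<Lambda> N) * (of_real (1 / t) * m (\<epsilon> *\<^sub>R \<xi>)) ^ njumps * ((of_real \<Lambda> * m (\<epsilon> *\<^sub>R \<xi>)) ^ j / fact j)" for j
      using c t CC0 unfolding b_def M_def by (simp add: power_mult_distrib power_add power_divide field_simps)
    show ?thesis unfolding sum.shift_bounds_nat_ivl texp_def sum_distrib_left tm
      by (simp add: atLeast0LessThan mult.assoc)
  qed
  ultimately have 1: "posm (\<lambda>\<xi>. exp (M \<xi>) - of_real (1 / tconst \<Lambda> N) * ((of_real (1 / t) * m (\<epsilon> *\<^sub>R \<xi>)) ^ njumps * texp \<Lambda> N (m (\<epsilon> *\<^sub>R \<xi>))))"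
    by simp
  have "posm (\<lambda>\<xi>. \<Sum>j<N. of_real (1 / fact j) * (of_real \<Lambda> * m (\<epsilon> *\<^sub>R \<xi>)) ^ j)"
    using \<Lambda> by (intro posm_sum posm_scale posm_power posm_jump) auto
  then have T: "posm (\<lambda>\<xi>. texp \<Lambda> N (m (\<epsilon> *\<^sub>R \<xi>)))" by (simp add: texp_def)
  have 2: "posm (\<lambda>\<xi>. of_real (1 / tconst \<Lambda> N) * (((of_real (1 / t) * m (\<epsilon> *\<^sub>R \<xi>)) ^ njumps - slabs J (\<epsilon> *\<^sub>R \<xi>)) * texp \<Lambda> N (m (\<epsilon> *\<^sub>R \<xi>))))"
    using CC0 by (intro posm_scale posm_mult posm_m_power_minus_slabs T) auto
  have "posm (\<lambda>\<xi>. exp (M \<xi>) - of_real (1 / tconst \<Lambda> N) * (slabs J (\<epsilon> *\<^sub>R \<xi>) * texp \<Lambda> N (m (\<epsilon> *\<^sub>R \<xi>))))"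
    using posm_add[OF 1 2] by (simp add: algebra_simps)
  then have "posm (\<lambda>\<xi>. of_real (exp (- (c * t))) * (exp (M \<xi>) - of_real (1 / tconst \<Lambda> N) * (slabs J (\<epsilon> *\<^sub>R \<xi>) * texp \<Lambda> N (m (\<epsilon> *\<^sub>R \<xi>)))))"
    by (rule posm_scale) simp
  moreover have "complex_of_real (exp (- (c * t))) * exp (M \<xi>) = uhat c \<epsilon> \<xi>" for \<xi>
    unfolding uhat_def M_def by (simp add: exp_of_real[symmetric] exp_add[symmetric] algebra_simps flip: exp_of_real)
  ultimately show ?thesis by (simp add: right_diff_distrib mult.assoc[symmetric])
qed

lemma khat_rescale:
  assumes "1 \<le> \<mu>" "0 < \<epsilon>"
  shows "ft (\<lambda>\<xi>. khat \<mu> (\<epsilon> *\<^sub>R \<xi>)) y = ((\<beta> \<mu> / \<epsilon>) ^ DIM('a)) *\<^sub>R ft (\<lambda>\<zeta>. khat \<mu> (\<beta> \<mu> *\<^sub>R \<zeta>)) ((\<beta> \<mu> / \<epsilon>) *\<^sub>R y)"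
  using ft_scale[of "\<epsilon> / \<beta> \<mu>" "\<lambda>\<zeta>. khat \<mu> (\<beta> \<mu> *\<^sub>R \<zeta>)" y] \<beta>_bounds[OF assms(1)] assms
  by (simp add: power_divide)

text \<open>As \<open>\<mu> * m\<close> is bounded by \<open>\<mu> * t\<close>, truncation costs the
  tail of a real exponential series, times the integral of \<open>slabs J\<close> at scale
  \<epsilon>. Its order \<open>1 / \<epsilon> ^ DIM('a)\<close> is that of the main term after
  rescaling, so the length of the truncation can be chosen independently of \<epsilon>.\<close>

lemma texp_ft_lower:
  assumes \<mu>: "1 \<le> \<mu>" and \<epsilon>: "0 < \<epsilon>"
  shows "integrable lborel (\<lambda>\<xi>. slabs J (\<epsilon> *\<^sub>R \<xi>) * texp \<mu> N (m (\<epsilon> *\<^sub>R \<xi>)))" (is ?int)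
    and "exp (\<mu> * t) * Re (ft (\<lambda>\<xi>. khat \<mu> (\<epsilon> *\<^sub>R \<xi>)) y) - (exp (\<mu> * t) - (\<Sum>j<N. (\<mu> * t) ^ j / fact j)) * (1 / \<epsilon> ^ DIM('a) * (dconst * (\<integral>\<zeta>. g2 \<zeta> \<partial>lborel)))
     \<le> Re (ft (\<lambda>\<xi>. slabs J (\<epsilon> *\<^sub>R \<xi>) * texp \<mu> N (m (\<epsilon> *\<^sub>R \<xi>))) y)" (is ?lower)
proof -
  define tail where "tail = exp (\<mu> * t) - (\<Sum>j<N. (\<mu> * t) ^ j / fact j)"
  have nz: "norm (of_real \<mu> * m \<eta>) \<le> \<mu> * t" for \<eta>
    using norm_jump_mult_le_t[of UNIV \<eta>] \<mu> by (simp add: norm_mult mult_left_mono)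
  have tl: "cmod (exp (of_real \<mu> * m \<eta>) - texp \<mu> N (m \<eta>)) \<le> tail" for \<eta>
    unfolding texp_def tail_def by (rule exp_tail_bound[OF nz])
  have tail0: "0 \<le> tail" using order_trans[OF norm_ge_zero tl] .
  have PPs: "integrable lborel (\<lambda>\<xi>. slabs J (\<epsilon> *\<^sub>R \<xi>))" by (rule integrable_scaled[OF slabs_int \<epsilon>])
  have eqH: "of_real (exp (\<mu> * t)) * khat \<mu> \<eta> = slabs J \<eta> * exp (of_real \<mu> * m \<eta>)" for \<eta>
  proof -
    have "complex_of_real (exp (\<mu> * t)) * exp (of_real \<mu> * (m \<eta> - of_real t)) = exp (of_real \<mu> * m \<eta>)"
      by (simp add: exp_of_real[symmetric] exp_add[symmetric] algebra_simps flip: exp_of_real)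
    then show ?thesis unfolding khat_def by (metis mult.left_commute)
  qed
  have [measurable]: "(\<lambda>\<xi>. texp \<mu> N (m (\<epsilon> *\<^sub>R \<xi>))) \<in> borel_measurable borel" unfolding texp_def by measurable
  have i1: "integrable lborel (\<lambda>\<xi>. of_real (exp (\<mu> * t)) * khat \<mu> (\<epsilon> *\<^sub>R \<xi>))"
    using \<mu> by (intro integrable_mult_right integrable_scaled khat_int \<epsilon>) simp
  have i2: "integrable lborel (\<lambda>\<xi>. slabs J (\<epsilon> *\<^sub>R \<xi>) * (exp (of_real \<mu> * m (\<epsilon> *\<^sub>R \<xi>)) - texp \<mu> N (m (\<epsilon> *\<^sub>R \<xi>))))"
    using integrable_bounded_mult[OF _ tl PPs]
    by (simp add: mult.commute)
  have eq: "slabs J (\<epsilon> *\<^sub>R \<xi>) * texp \<mu> N (m (\<epsilon> *\<^sub>R \<xi>)) = of_real (exp (\<mu> * t)) * khat \<mu> (\<epsilon> *\<^sub>R \<xi>) - slabs J (\<epsilon> *\<^sub>R \<xi>) * (exp (of_real \<mu> * m (\<epsilon> *\<^sub>R \<xi>)) - texp \<mu> N (m (\<epsilon> *\<^sub>R \<xi>)))" for \<xi>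
    unfolding eqH by (simp add: algebra_simps)
  show ?int unfolding eq using i1 i2 by (rule Bochner_Integration.integrable_diff)
  define D where "D = ft (\<lambda>\<xi>. slabs J (\<epsilon> *\<^sub>R \<xi>) * (exp (of_real \<mu> * m (\<epsilon> *\<^sub>R \<xi>)) - texp \<mu> N (m (\<epsilon> *\<^sub>R \<xi>)))) y"
  have "cmod D \<le> (\<integral>\<xi>. cmod (slabs J (\<epsilon> *\<^sub>R \<xi>) * (exp (of_real \<mu> * m (\<epsilon> *\<^sub>R \<xi>)) - texp \<mu> N (m (\<epsilon> *\<^sub>R \<xi>)))) \<partial>lborel)"
    unfolding D_def by (rule norm_ft_le)
  also have "\<dots> \<le> (\<integral>\<xi>. tail * (dconst * g2 (0 + \<epsilon> *\<^sub>R \<xi>)) \<partial>lborel)"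
  proof (rule integral_mono)
    show "integrable lborel (\<lambda>\<xi>. cmod (slabs J (\<epsilon> *\<^sub>R \<xi>) * (exp (of_real \<mu> * m (\<epsilon> *\<^sub>R \<xi>)) - texp \<mu> N (m (\<epsilon> *\<^sub>R \<xi>)))))"
      using i2 by (rule integrable_norm)
    have g2m: "g2 \<in> borel_measurable borel" using g2_int by auto
    have "integrable lborel (\<lambda>\<xi>. g2 (0 + \<epsilon> *\<^sub>R \<xi>))"
      using integrable_lborel_affine_iff[OF _ g2m, of \<epsilon> 0] \<epsilon> g2_int by simp
    then show "integrable lborel (\<lambda>\<xi>. tail * (dconst * g2 (0 + \<epsilon> *\<^sub>R \<xi>)))" by (intro integrable_mult_right)
    fix \<xi>
    have "cmod (slabs J (\<epsilon> *\<^sub>R \<xi>)) * cmod (exp (of_real \<mu> * m (\<epsilon> *\<^sub>R \<xi>)) - texp \<mu> N (m (\<epsilon> *\<^sub>R \<xi>))) \<le> (dconst * g2 (\<epsilon> *\<^sub>R \<xi>)) * tail"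
      using norm_slabs_decay[of "\<epsilon> *\<^sub>R \<xi>"] consts_pos g2_nonneg[of "\<epsilon> *\<^sub>R \<xi>"] tail0 by (intro mult_mono tl) (auto simp: g2_def)
    then show "cmod (slabs J (\<epsilon> *\<^sub>R \<xi>) * (exp (of_real \<mu> * m (\<epsilon> *\<^sub>R \<xi>)) - texp \<mu> N (m (\<epsilon> *\<^sub>R \<xi>)))) \<le> tail * (dconst * g2 (0 + \<epsilon> *\<^sub>R \<xi>))"
      by (simp add: norm_mult mult_ac)
  qed
  also have "\<dots> = tail * (1 / \<epsilon> ^ DIM('a) * (dconst * (\<integral>\<zeta>. g2 \<zeta> \<partial>lborel)))"
  proof -
    have "(\<integral>\<xi>. g2 (0 + \<epsilon> *\<^sub>R \<xi>) \<partial>lborel) = 1 / \<epsilon> ^ DIM('a) * (\<integral>\<zeta>. g2 \<zeta> \<partial>lborel)"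
      using integral_lborel_affine[of \<epsilon> g2 0] \<epsilon> g2_int by auto
    then show ?thesis by (simp only: integral_mult_right_zero mult.left_commute)
  qed
  finally have D: "Re D \<le> tail * (1 / \<epsilon> ^ DIM('a) * (dconst * (\<integral>\<zeta>. g2 \<zeta> \<partial>lborel)))"
    using complex_Re_le_cmod order_trans by blast
  have "ft (\<lambda>\<xi>. slabs J (\<epsilon> *\<^sub>R \<xi>) * texp \<mu> N (m (\<epsilon> *\<^sub>R \<xi>))) y = of_real (exp (\<mu> * t)) * ft (\<lambda>\<xi>. khat \<mu> (\<epsilon> *\<^sub>R \<xi>)) y - D"
    unfolding eq D_def ft_diff[OF i1 i2] ft_cmult ..
  then show ?lower using D by (simp add: tail_def)
qed

end

text \<open>The multiplier itself is not integrable, since the event of no jump leaves an atom; an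
  integrable minorant \<open>L\<close> has a transform that can be bounded pointwise. The hypothesis
  reaches out to radius \<open>2 * \<rho>\<close> because rescaling stretches the argument by a
  factor of at most 2. All constants are fixed before the kernel and the scale are
  introduced.\<close>

lemma (in jump_consts) uniform_lower:
  fixes C0 \<delta> \<alpha>0 \<rho> :: real
  assumes \<delta>: "0 < \<delta>" and \<alpha>0: "0 < \<alpha>0" and \<rho>: "0 \<le> \<rho>"
    and low: "\<And>s x. 1/2 \<le> s \<Longrightarrow> s \<le> 1 \<Longrightarrow> norm (x::'a) \<le> 2 * \<rho> \<Longrightarrow> \<alpha>0 \<le> Re (ftr (stab 1 t s) x)"
  shows "\<exists>\<alpha>>0. \<forall>J s \<epsilon>. jump_kernel t r0 \<kappa> A a S J s C0 \<delta> \<longrightarrow> 0 < \<epsilon> \<longrightarrow> \<epsilon> \<le> 1 \<longrightarrow>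
    (\<exists>L. integrable lborel L \<and> posm (\<lambda>\<xi>. exp (of_real (\<epsilon> powr (- 2 * s)) * (jump_mult t J UNIV (\<epsilon> *\<^sub>R \<xi>) - of_real t)) - L \<xi>)
      \<and> (\<forall>y. norm y \<le> \<rho> \<longrightarrow> \<alpha> \<le> Re (ft L y)))"
proof -
  define b where "b = Q0 * \<alpha>0 / 2"
  have b: "0 < b" using consts_pos \<alpha>0 by (simp add: b_def)
  have "eventually (\<lambda>\<mu>. err C0 \<delta> \<mu> < b) at_top" using err_tendsto[OF \<delta>] b by (rule order_tendstoD)
  then obtain \<Lambda>0 where \<Lambda>0: "\<And>\<mu>. \<Lambda>0 \<le> \<mu> \<Longrightarrow> err C0 \<delta> \<mu> < b" by (auto simp: eventually_at_top_linorder)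
  define \<Lambda> where "\<Lambda> = max 1 \<Lambda>0"
  have \<Lambda>: "1 \<le> \<Lambda>" "\<And>\<mu>. \<Lambda> \<le> \<mu> \<Longrightarrow> err C0 \<delta> \<mu> < b" using \<Lambda>0 by (auto simp: \<Lambda>_def)
  \<comment> \<open>For \<open>c \<ge> C1\<close>, the intensity \<open>c - 1 / t\<close> that
    remains after the smoothing jumps is at least \<open>\<Lambda>\<close> and at least
    \<open>c / 2\<close>.\<close>
  define C1 where "C1 = \<Lambda> + 2 / t"
  have C1: "1 \<le> C1" "\<Lambda> \<le> C1 - 1 / t" "2 / t \<le> C1" proof -
    have "0 < 1 / t" "2 / t = 1 / t + 1 / t" using t by (simp_all add: field_simps)
    then show "1 \<le> C1" "\<Lambda> \<le> C1 - 1 / t" "2 / t \<le> C1" unfolding C1_def using \<Lambda>(1) by linarith+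
  qed
  \<comment> \<open>The square of \<open>C1\<close> ensures \<open>c / \<Lambda>2 \<le> 1\<close>
    for every \<open>c < C1\<close>, so that the rescaled argument stays in the ball.\<close>
  define \<Lambda>2 where "\<Lambda>2 = max \<Lambda> (C1\<^sup>2)"
  have \<Lambda>2: "1 \<le> \<Lambda>2" "\<Lambda> \<le> \<Lambda>2" "C1\<^sup>2 \<le> \<Lambda>2" using \<Lambda> by (auto simp: \<Lambda>2_def)
  define G where "G = dconst * (\<integral>\<zeta>. g2 \<zeta> \<partial>lborel)"
  define b2 where "b2 = exp (\<Lambda>2 * t) * ((1 / \<Lambda>2) ^ DIM('a) * b)"
  have b2: "0 < b2" using b \<Lambda>2 by (simp add: b2_def)
  have "(\<lambda>N. (exp (\<Lambda>2 * t) - (\<Sum>j<N. (\<Lambda>2 * t) ^ j / fact j)) * G) \<longlonglongrightarrow> (exp (\<Lambda>2 * t) - exp (\<Lambda>2 * t)) * G"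
  proof (intro tendsto_intros)
    have "(\<lambda>n. (\<Lambda>2 * t) ^ n / fact n) sums exp (\<Lambda>2 * t)"
      using exp_converges[of "\<Lambda>2 * t"] by (simp add: divide_inverse mult.commute)
    then show "(\<lambda>N. \<Sum>j<N. (\<Lambda>2 * t) ^ j / fact j) \<longlonglongrightarrow> exp (\<Lambda>2 * t)" by (simp add: sums_def)
  qed
  then have "eventually (\<lambda>N. (exp (\<Lambda>2 * t) - (\<Sum>j<N. (\<Lambda>2 * t) ^ j / fact j)) * G < b2 / 2) sequentially"
    using b2 by (intro order_tendstoD(2)) auto
  then obtain N where N: "(exp (\<Lambda>2 * t) - (\<Sum>j<N. (\<Lambda>2 * t) ^ j / fact j)) * G < b2 / 2"
    by (auto simp: eventually_sequentially)
  define \<kappa>1 where "\<kappa>1 = exp (- 1 :: real) / fact njumps"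
  define \<kappa>2 where "\<kappa>2 = exp (- (C1 * t)) / tconst \<Lambda>2 N"
  have CC0: "0 < tconst \<Lambda>2 N" using \<Lambda>2 t by (simp add: tconst_def)
  have \<kappa>12: "0 < \<kappa>1" "0 < \<kappa>2" using CC0 by (auto simp: \<kappa>1_def \<kappa>2_def)
  define \<alpha> where "\<alpha> = min (\<kappa>1 * b) (\<kappa>2 * (b2 / 2))"
  have "0 < \<alpha>" using \<kappa>12 b b2 by (simp add: \<alpha>_def)
  moreover have "\<exists>L. integrable lborel L \<and> posm (\<lambda>\<xi>. exp (of_real (\<epsilon> powr (- 2 * s)) * (jump_mult t J UNIV (\<epsilon> *\<^sub>R \<xi>) - of_real t)) - L \<xi>)
      \<and> (\<forall>y. norm y \<le> \<rho> \<longrightarrow> \<alpha> \<le> Re (ft L y))"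
    if jk: "jump_kernel t r0 \<kappa> A a S J s C0 \<delta>" and \<epsilon>: "0 < \<epsilon>" "\<epsilon> \<le> 1" for J s \<epsilon>
  proof -
    interpret jump_kernel t r0 \<kappa> A a S J s C0 \<delta> by fact
    define c where "c = \<epsilon> powr (- 2 * s)"
    define e where "e = 1 / (2 * s)"
    have e: "1/2 \<le> e" "e \<le> 1" "0 < e" using s by (auto simp: e_def field_simps)
    have c1: "1 \<le> c" unfolding c_def using \<epsilon> s powr_mono'[of "- 2 * s" 0 \<epsilon>] by simp
    \<comment> \<open>Expressed through \<open>c\<close>, the stretching factor
      \<open>\<beta> \<mu> / \<epsilon>\<close> depends on \<epsilon> only via the ratio
      \<open>c / \<mu>\<close>.\<close>
    have ec: "1 / \<epsilon> = c powr e" unfolding c_def e_def powr_powr using s \<epsilon> by (simp add: powr_minus_divide)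
    have \<beta>e: "\<beta> \<mu> / \<epsilon> = (c / \<mu>) powr e" if "1 \<le> \<mu>" for \<mu>
    proof -
      have "\<beta> \<mu> / \<epsilon> = \<beta> \<mu> * (1 / \<epsilon>)" by simp
      also have "\<dots> = (c / \<mu>) powr e" unfolding ec using that c1 by (simp add: \<beta>_def e_def[symmetric] powr_divide powr_minus_divide)
      finally show ?thesis .
    qed
    have bl: "b \<le> Re (ft (\<lambda>\<zeta>. khat \<mu> (\<beta> \<mu> *\<^sub>R \<zeta>)) x)" if "\<Lambda> \<le> \<mu>" "norm x \<le> 2 * \<rho>" for \<mu> x
    proof -
      have "Q0 * \<alpha>0 \<le> Q * Re (ftr (stab 1 t s) x)"
        using Q_bounds consts_pos \<alpha>0 low[of s x] s that by (intro mult_mono) auto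
      then show ?thesis using local_limit[of \<mu> x] \<Lambda>(2)[OF that(1)] \<Lambda>(1) that(1) unfolding b_def by simp
    qed
    show ?thesis
    proof (cases "C1 \<le> c")
      case True
      define \<mu> where "\<mu> = c - 1 / t"
      have \<mu>: "\<Lambda> \<le> \<mu>" "1 \<le> \<mu>" "\<mu> \<le> c" "c \<le> 2 * \<mu>" using True C1 \<Lambda>(1) t unfolding \<mu>_def by (auto simp: algebra_simps)
      define L where "L \<xi> = of_real \<kappa>1 * khat \<mu> (\<epsilon> *\<^sub>R \<xi>)" for \<xi>
      have "integrable lborel L" unfolding L_def using \<mu> by (intro integrable_mult_right integrable_scaled khat_int \<epsilon>) auto
      moreover have "posm (\<lambda>\<xi>. exp (of_real c * (jump_mult t J UNIV (\<epsilon> *\<^sub>R \<xi>) - of_real t)) - L \<xi>)"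
        using posm_many_jumps[of c \<epsilon>] True C1 \<Lambda>(1) unfolding L_def \<kappa>1_def \<mu>_def uhat_def by auto
      moreover have "\<alpha> \<le> Re (ft L y)" if y: "norm y \<le> \<rho>" for y
      proof -
        have r: "1 \<le> \<beta> \<mu> / \<epsilon>" "\<beta> \<mu> / \<epsilon> \<le> 2"
        proof -
          have r1: "1 \<le> c / \<mu>" "c / \<mu> \<le> 2" using \<mu> by (auto simp: field_simps)
          show "1 \<le> \<beta> \<mu> / \<epsilon>" unfolding \<beta>e[OF \<mu>(2)] using r1 e by (intro ge_one_powr_ge_zero) auto
          have "(c / \<mu>) powr e \<le> (c / \<mu>) powr 1" using r1 e by (intro powr_mono) auto
          then show "\<beta> \<mu> / \<epsilon> \<le> 2" unfolding \<beta>e[OF \<mu>(2)] using r1 by simp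
        qed
        have "norm ((\<beta> \<mu> / \<epsilon>) *\<^sub>R y) \<le> 2 * \<rho>"
          unfolding norm_scaleR using r y \<rho> by (intro mult_mono) auto
        then have "b \<le> Re (ft (\<lambda>\<zeta>. khat \<mu> (\<beta> \<mu> *\<^sub>R \<zeta>)) ((\<beta> \<mu> / \<epsilon>) *\<^sub>R y))" by (rule bl[OF \<mu>(1)])
        then have "1 * b \<le> (\<beta> \<mu> / \<epsilon>) ^ DIM('a) * Re (ft (\<lambda>\<zeta>. khat \<mu> (\<beta> \<mu> *\<^sub>R \<zeta>)) ((\<beta> \<mu> / \<epsilon>) *\<^sub>R y))"
          using r b by (intro mult_mono one_le_power) auto
        then have "b \<le> Re (ft (\<lambda>\<xi>. khat \<mu> (\<epsilon> *\<^sub>R \<xi>)) y)" unfolding khat_rescale[OF \<mu>(2) \<epsilon>(1)] by simp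
        then have "\<kappa>1 * b \<le> Re (ft L y)" unfolding L_def ft_cmult using \<kappa>12 by (simp add: mult_left_mono)
        then show ?thesis by (simp add: \<alpha>_def)
      qed
      ultimately show ?thesis unfolding c_def by blast
    next
      case False
      define L where "L \<xi> = of_real (exp (- (c * t)) / tconst \<Lambda>2 N) * (slabs J (\<epsilon> *\<^sub>R \<xi>) * texp \<Lambda>2 N (m (\<epsilon> *\<^sub>R \<xi>)))" for \<xi>
      have "integrable lborel L" unfolding L_def by (intro integrable_mult_right texp_ft_lower \<Lambda>2 \<epsilon>)
      moreover have "posm (\<lambda>\<xi>. exp (of_real c * (jump_mult t J UNIV (\<epsilon> *\<^sub>R \<xi>) - of_real t)) - L \<xi>)"
        using posm_few_jumps[OF c1 \<Lambda>2(1), of \<epsilon> N] unfolding L_def uhat_def .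
      moreover have "\<alpha> \<le> Re (ft L y)" if y: "norm y \<le> \<rho>" for y
      proof -
        have e1: "1 \<le> 1 / \<epsilon>" using \<epsilon> by simp
        have "\<beta> \<Lambda>2 / \<epsilon> \<le> 1"
        proof -
          have "c / \<Lambda>2 \<le> 1 / C1" 
          proof -
            have "c * C1 \<le> C1 * C1" using False C1 by (intro mult_right_mono) auto
            then have "c * C1 \<le> \<Lambda>2" using \<Lambda>2 by (simp add: power2_eq_square)
            then show ?thesis using C1 \<Lambda>2 by (simp add: field_simps)
          qed
          also have "1 / C1 \<le> 1" using C1 by simp
          finally have "(c / \<Lambda>2) powr e \<le> 1 powr e" using c1 \<Lambda>2 e by (intro powr_mono2) auto
          then show ?thesis unfolding \<beta>e[OF \<Lambda>2(1)] by simp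
        qed
        moreover have "0 < \<beta> \<Lambda>2 / \<epsilon>" using \<beta>_bounds[OF \<Lambda>2(1)] \<epsilon> by simp
        ultimately have "norm ((\<beta> \<Lambda>2 / \<epsilon>) *\<^sub>R y) \<le> 2 * \<rho>"
          unfolding norm_scaleR using y \<rho> by (intro mult_mono) auto
        then have bb: "b \<le> Re (ft (\<lambda>\<zeta>. khat \<Lambda>2 (\<beta> \<Lambda>2 *\<^sub>R \<zeta>)) ((\<beta> \<Lambda>2 / \<epsilon>) *\<^sub>R y))" by (rule bl[OF \<Lambda>2(2)])
        have "(1 / \<epsilon>) ^ DIM('a) * ((1 / \<Lambda>2) ^ DIM('a) * b) \<le> (1 / \<epsilon>) ^ DIM('a) * (\<beta> \<Lambda>2 ^ DIM('a) * Re (ft (\<lambda>\<zeta>. khat \<Lambda>2 (\<beta> \<Lambda>2 *\<^sub>R \<zeta>)) ((\<beta> \<Lambda>2 / \<epsilon>) *\<^sub>R y)))"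
          using bb b \<beta>_bounds[OF \<Lambda>2(1)] \<epsilon> \<Lambda>2 by (intro mult_left_mono mult_mono power_mono) auto
        also have "\<dots> = Re (ft (\<lambda>\<xi>. khat \<Lambda>2 (\<epsilon> *\<^sub>R \<xi>)) y)" unfolding khat_rescale[OF \<Lambda>2(1) \<epsilon>(1)] by (simp add: power_divide)
        finally have h: "exp (\<Lambda>2 * t) * ((1 / \<epsilon>) ^ DIM('a) * ((1 / \<Lambda>2) ^ DIM('a) * b)) \<le> exp (\<Lambda>2 * t) * Re (ft (\<lambda>\<xi>. khat \<Lambda>2 (\<epsilon> *\<^sub>R \<xi>)) y)"
          by (rule mult_left_mono) simp
        have "(1 / \<epsilon>) ^ DIM('a) * ((exp (\<Lambda>2 * t) - (\<Sum>j<N. (\<Lambda>2 * t) ^ j / fact j)) * G) \<le> (1 / \<epsilon>) ^ DIM('a) * (b2 / 2)"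
          using N \<epsilon> by (intro mult_left_mono) auto
        moreover have "exp (\<Lambda>2 * t) * ((1 / \<epsilon>) ^ DIM('a) * ((1 / \<Lambda>2) ^ DIM('a) * b)) = (1 / \<epsilon>) ^ DIM('a) * b2" by (simp add: b2_def)
        moreover have "(exp (\<Lambda>2 * t) - (\<Sum>j<N. (\<Lambda>2 * t) ^ j / fact j)) * (1 / \<epsilon> ^ DIM('a) * (dconst * (\<integral>\<zeta>. g2 \<zeta> \<partial>lborel))) = (1 / \<epsilon>) ^ DIM('a) * ((exp (\<Lambda>2 * t) - (\<Sum>j<N. (\<Lambda>2 * t) ^ j / fact j)) * G)"
          by (simp add: G_def power_divide)
        ultimately have "(1 / \<epsilon>) ^ DIM('a) * b2 - (1 / \<epsilon>) ^ DIM('a) * (b2 / 2) \<le> Re (ft (\<lambda>\<xi>. slabs J (\<epsilon> *\<^sub>R \<xi>) * texp \<Lambda>2 N (m (\<epsilon> *\<^sub>R \<xi>))) y)"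
          using h texp_ft_lower(2)[OF \<Lambda>2(1) \<epsilon>(1), of y N] by linarith
        moreover have "1 * (b2 / 2) \<le> (1 / \<epsilon>) ^ DIM('a) * (b2 / 2)" using e1 b2 by (intro mult_right_mono one_le_power) auto
        moreover have "(1 / \<epsilon>) ^ DIM('a) * b2 = (1 / \<epsilon>) ^ DIM('a) * (b2 / 2) + (1 / \<epsilon>) ^ DIM('a) * (b2 / 2)" by simp
        ultimately have f: "b2 / 2 \<le> Re (ft (\<lambda>\<xi>. slabs J (\<epsilon> *\<^sub>R \<xi>) * texp \<Lambda>2 N (m (\<epsilon> *\<^sub>R \<xi>))) y)" by linarith
        have "\<kappa>2 \<le> exp (- (c * t)) / tconst \<Lambda>2 N" unfolding \<kappa>2_def using False CC0 t by (intro divide_right_mono) auto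
        then have "\<kappa>2 * (b2 / 2) \<le> (exp (- (c * t)) / tconst \<Lambda>2 N) * Re (ft (\<lambda>\<xi>. slabs J (\<epsilon> *\<^sub>R \<xi>) * texp \<Lambda>2 N (m (\<epsilon> *\<^sub>R \<xi>))) y)"
          using f b2 \<kappa>12 by (intro mult_mono) auto
        also have "\<dots> = Re (ft L y)" unfolding L_def ft_cmult by (simp only: Re_complex_of_real Im_complex_of_real times_complex.sel)
        finally show ?thesis by (simp add: \<alpha>_def)
      qed
      ultimately show ?thesis unfolding c_def by blast
    qed
  qed
  ultimately show ?thesis by blast
qed

section \<open>The solution on the Fourier side\<close>

lemma
  fixes K f :: "'a::euclidean_space \<Rightarrow> real"
  assumes K: "integrable lborel K" and f: "integrable lborel f"
  shows integrable_conv: "integrable lborel (conv K f)"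
    and norm_conv_le: "(\<integral>y. \<bar>conv K f y\<bar> \<partial>lborel) \<le> (\<integral>y. \<bar>K y\<bar> \<partial>lborel) * (\<integral>y. \<bar>f y\<bar> \<partial>lborel)"
    and ft_conv: "ftr (conv K f) \<eta> = ftr K \<eta> * ftr f \<eta>"
proof -
  have [measurable]: "K \<in> borel_measurable borel" "f \<in> borel_measurable borel" using K f by auto
  have Kz: "integrable lborel (\<lambda>y. K (y - z))" for z
    using integrable_lborel_affine_iff[of 1 K "- z"] K by simp
  have Kzn: "(\<integral>y. \<bar>K (y - z)\<bar> \<partial>lborel) = (\<integral>y. \<bar>K y\<bar> \<partial>lborel)" for z
    using integral_lborel_affine[of 1 "\<lambda>y. \<bar>K y\<bar>" "- z"] by simp
  have int: "integrable (lborel \<Otimes>\<^sub>M lborel) (\<lambda>(z, y). K (y - z) * f z)"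
  proof (rule lborel_pair.Fubini_integrable)
    show "(\<lambda>(z, y). K (y - z) * f z) \<in> borel_measurable (lborel \<Otimes>\<^sub>M lborel)" by measurable
    show "integrable lborel (\<lambda>z. \<integral>y. norm (case (z, y) of (z, y) \<Rightarrow> K (y - z) * f z) \<partial>lborel)"
      using f by (simp add: abs_mult Kzn)
    show "AE z in lborel. integrable lborel (\<lambda>y. case (z, y) of (z, y) \<Rightarrow> K (y - z) * f z)"
      using Kz by simp
  qed
  have int': "integrable (lborel \<Otimes>\<^sub>M lborel) (\<lambda>(y, z). K (y - z) * f z)"
    using lborel_pair.integrable_product_swap[OF int] by (simp add: split_beta')
  show 1: "integrable lborel (conv K f)"
    using lborel_pair.integrable_fst'[OF int'] by (simp add: conv_def[abs_def])
  have intn: "integrable (lborel \<Otimes>\<^sub>M lborel) (\<lambda>(z, y). \<bar>K (y - z) * f z\<bar>)"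
    using integrable_norm[OF int] by (simp add: split_beta')
  have intn': "integrable (lborel \<Otimes>\<^sub>M lborel) (\<lambda>(y, z). \<bar>K (y - z) * f z\<bar>)"
    using integrable_norm[OF int'] by (simp add: split_beta')
  have "(\<integral>y. \<bar>conv K f y\<bar> \<partial>lborel) \<le> (\<integral>y. (\<integral>z. \<bar>K (y - z) * f z\<bar> \<partial>lborel) \<partial>lborel)"
  proof (rule integral_mono)
    show "integrable lborel (\<lambda>y. \<bar>conv K f y\<bar>)" using 1 by (rule integrable_abs)
    show "integrable lborel (\<lambda>y. \<integral>z. \<bar>K (y - z) * f z\<bar> \<partial>lborel)"
      using lborel_pair.integrable_fst'[OF intn'] by simp
    show "\<bar>conv K f y\<bar> \<le> (\<integral>z. \<bar>K (y - z) * f z\<bar> \<partial>lborel)" for y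
      unfolding conv_def by (rule integral_abs_bound)
  qed
  also have "\<dots> = (\<integral>z. (\<integral>y. \<bar>K (y - z) * f z\<bar> \<partial>lborel) \<partial>lborel)"
    by (rule lborel_pair.Fubini_integral[OF intn])
  also have "\<dots> = (\<integral>y. \<bar>K y\<bar> \<partial>lborel) * (\<integral>y. \<bar>f y\<bar> \<partial>lborel)"
    by (simp add: abs_mult Kzn)
  finally show "(\<integral>y. \<bar>conv K f y\<bar> \<partial>lborel) \<le> (\<integral>y. \<bar>K y\<bar> \<partial>lborel) * (\<integral>y. \<bar>f y\<bar> \<partial>lborel)" .
  have intc: "integrable (lborel \<Otimes>\<^sub>M lborel) (\<lambda>(z, y). complex_of_real (K (y - z) * f z) * cis (y \<bullet> \<eta>))"
  proof -
    have "integrable (lborel \<Otimes>\<^sub>M lborel) (\<lambda>p. complex_of_real (K (snd p - fst p) * f (fst p)))"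
      using int by (simp only: complex_of_real_integrable_eq split_beta')
    then have "integrable (lborel \<Otimes>\<^sub>M lborel) (\<lambda>p. complex_of_real (K (snd p - fst p) * f (fst p)) * cis (snd p \<bullet> \<eta>))"
      by (rule integrable_mult_cis) measurable
    then show ?thesis by (simp add: split_beta')
  qed
  have "ftr (conv K f) \<eta> = (\<integral>y. (\<integral>z. complex_of_real (K (y - z) * f z) * cis (y \<bullet> \<eta>) \<partial>lborel) \<partial>lborel)"
    unfolding ft_def conv_def by (simp only: integral_mult_left_zero integral_complex_of_real)
  also have "\<dots> = (\<integral>z. (\<integral>y. complex_of_real (K (y - z) * f z) * cis (y \<bullet> \<eta>) \<partial>lborel) \<partial>lborel)"
    by (rule lborel_pair.Fubini_integral[OF intc])
  also have "\<dots> = (\<integral>z. ftr K \<eta> * (complex_of_real (f z) * cis (z \<bullet> \<eta>)) \<partial>lborel)"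
  proof (intro Bochner_Integration.integral_cong refl)
    fix z
    have "(\<integral>y. complex_of_real (K (y - z) * f z) * cis (y \<bullet> \<eta>) \<partial>lborel)
      = (\<integral>y. (complex_of_real (f z) * cis (z \<bullet> \<eta>)) * (complex_of_real (K (- z + 1 *\<^sub>R y)) * cis ((- z + 1 *\<^sub>R y) \<bullet> \<eta>)) \<partial>lborel)"
    proof (intro Bochner_Integration.integral_cong refl)
      fix y
      have "cis (y \<bullet> \<eta>) = cis (z \<bullet> \<eta>) * cis ((- z + 1 *\<^sub>R y) \<bullet> \<eta>)" unfolding cis_mult by (simp add: inner_diff_left)
      then show "complex_of_real (K (y - z) * f z) * cis (y \<bullet> \<eta>) = (complex_of_real (f z) * cis (z \<bullet> \<eta>)) * (complex_of_real (K (- z + 1 *\<^sub>R y)) * cis ((- z + 1 *\<^sub>R y) \<bullet> \<eta>))"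
        by simp
    qed
    also have "\<dots> = (complex_of_real (f z) * cis (z \<bullet> \<eta>)) * (\<integral>y. complex_of_real (K (- z + 1 *\<^sub>R y)) * cis ((- z + 1 *\<^sub>R y) \<bullet> \<eta>) \<partial>lborel)"
      by (rule integral_mult_right_zero)
    also have "(\<integral>y. complex_of_real (K (- z + 1 *\<^sub>R y)) * cis ((- z + 1 *\<^sub>R y) \<bullet> \<eta>) \<partial>lborel) = ftr K \<eta>"
      using integral_lborel_affine[of 1 "\<lambda>y. complex_of_real (K y) * cis (y \<bullet> \<eta>)" "- z"] by (simp add: ft_def)
    finally show "(\<integral>y. complex_of_real (K (y - z) * f z) * cis (y \<bullet> \<eta>) \<partial>lborel) = ftr K \<eta> * (complex_of_real (f z) * cis (z \<bullet> \<eta>))"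
      by simp
  qed
  also have "\<dots> = ftr K \<eta> * ftr f \<eta>" unfolding ft_def by (rule integral_mult_right_zero)
  finally show "ftr (conv K f) \<eta> = ftr K \<eta> * ftr f \<eta>" .
qed

section \<open>Weighted integrability and regularity in time\<close>

lemma jbr_powr_ge_1: "0 < k \<Longrightarrow> 1 \<le> jbr x powr k"
  by (rule ge_one_powr_ge_zero) (auto simp: jbr_def)

lemma borel_measurable_jbr [measurable]: "jbr \<in> borel_measurable borel"
  unfolding jbr_def[abs_def] by measurable

lemma in_L1kD:
  assumes "in_L1k k f" "0 < k"
  shows "f \<in> borel_measurable borel" "integrable lborel f"
proof -
  show [measurable]: "f \<in> borel_measurable borel" using assms by (simp add: in_L1k_def)
  show "integrable lborel f"
  proof (rule Bochner_Integration.integrable_bound)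
    show "integrable lborel (\<lambda>x. jbr x powr k * \<bar>f x\<bar>)" using assms by (simp add: in_L1k_def)
    show "AE x in lborel. norm (f x) \<le> norm (jbr x powr k * \<bar>f x\<bar>)"
      using mult_right_mono[OF jbr_powr_ge_1[OF assms(2)] abs_ge_zero] by (intro AE_I2) (simp add: abs_mult)
  qed simp
qed

lemma L1_le_dist_L1k:
  assumes f: "in_L1k k f" and g: "in_L1k k g" and k: "0 < k"
  shows "(\<integral>x. \<bar>f x - g x\<bar> \<partial>lborel) \<le> dist_L1k k f g"
  unfolding dist_L1k_def
proof (rule integral_mono)
  note [measurable] = in_L1kD(1)[OF f k] in_L1kD(1)[OF g k]
  show "integrable lborel (\<lambda>x. \<bar>f x - g x\<bar>)" using in_L1kD(2)[OF f k] in_L1kD(2)[OF g k] by auto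
  show "integrable lborel (\<lambda>x. jbr x powr k * \<bar>f x - g x\<bar>)"
  proof (rule Bochner_Integration.integrable_bound)
    show "integrable lborel (\<lambda>x. jbr x powr k * \<bar>f x\<bar> + jbr x powr k * \<bar>g x\<bar>)" using f g by (auto simp: in_L1k_def)
    show "AE x in lborel. norm (jbr x powr k * \<bar>f x - g x\<bar>) \<le> norm (jbr x powr k * \<bar>f x\<bar> + jbr x powr k * \<bar>g x\<bar>)"
    proof (rule AE_I2)
      fix x
      have "jbr x powr k * \<bar>f x - g x\<bar> \<le> jbr x powr k * (\<bar>f x\<bar> + \<bar>g x\<bar>)" by (intro mult_left_mono) auto
      then show "norm (jbr x powr k * \<bar>f x - g x\<bar>) \<le> norm (jbr x powr k * \<bar>f x\<bar> + jbr x powr k * \<bar>g x\<bar>)"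
        by (simp add: distrib_left abs_mult)
    qed
  qed measurable
  show "\<bar>f x - g x\<bar> \<le> jbr x powr k * \<bar>f x - g x\<bar>" for x
    using mult_right_mono[OF jbr_powr_ge_1[OF k] abs_ge_zero] by simp
qed

text \<open>An \<open>L\<^sup>1\<close>-continuous family need not be jointly measurable; it is, up to null sets at each time,
  since it is a pointwise limit of step functions in time.\<close>

lemma L1_continuous_representative:
  fixes u :: "real \<Rightarrow> 'a::euclidean_space \<Rightarrow> real"
  assumes int: "\<And>r. 0 \<le> r \<Longrightarrow> integrable lborel (u r)"
    and cont: "\<And>r0. 0 \<le> r0 \<Longrightarrow> ((\<lambda>r. \<integral>x. \<bar>u r x - u r0 x\<bar> \<partial>lborel) \<longlongrightarrow> 0) (at r0 within {0..})"
  shows "\<exists>v. (\<lambda>(r, x). v r x) \<in> borel_measurable (borel \<Otimes>\<^sub>M borel) \<and> (\<forall>r\<in>{0..T}. AE x in lborel. v r x = u r x)"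
proof -
  define D where "D r r' = (\<integral>x. \<bar>u r x - u r' x\<bar> \<partial>lborel)" for r r'
  have Dt: "D a b \<le> D a a' + D a' b' + D b' b" if "0 \<le> a" "0 \<le> b" "0 \<le> a'" "0 \<le> b'" for a b a' b'
  proof -
    have "D a b \<le> (\<integral>x. \<bar>u a x - u a' x\<bar> + \<bar>u a' x - u b' x\<bar> + \<bar>u b' x - u b x\<bar> \<partial>lborel)"
      unfolding D_def using int that by (intro integral_mono) auto
    also have "\<dots> = D a a' + D a' b' + D b' b" unfolding D_def using int that by simp
    finally show ?thesis .
  qed
  have Dsym: "D a b = D b a" for a b unfolding D_def by (simp add: abs_minus_commute)
  have D0: "D a a = 0" for a by (simp add: D_def)
  have Dlim: "(\<lambda>n. D (r n) r0) \<longlonglongrightarrow> 0" if "r \<longlonglongrightarrow> r0" "\<And>n. 0 \<le> r n" "0 \<le> r0" for r r0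
  proof -
    have "((\<lambda>r. D r r0) \<longlongrightarrow> D r0 r0) (at r0 within {0..})" using cont[OF that(3)] by (simp add: D0) (simp add: D_def)
    then have "continuous (at r0 within {0..}) (\<lambda>r. D r r0)" by (simp add: continuous_within)
    then have "(\<lambda>n. D (r n) r0) \<longlonglongrightarrow> D r0 r0"
      using that unfolding continuous_within_sequentially by (auto simp: o_def)
    then show ?thesis by (simp add: D0)
  qed
  define KK where "KK = {0..max T 0} \<times> {0..max T 0}"
  have "continuous_on KK (\<lambda>(a, b). D a b)"
    unfolding continuous_on_sequentially
  proof (intro ballI allI impI)
    fix p and z assume z: "z \<in> KK" and p: "(\<forall>n. p n \<in> KK) \<and> p \<longlonglongrightarrow> z"
    have nn: "0 \<le> fst (p n)" "0 \<le> snd (p n)" "0 \<le> fst z" "0 \<le> snd z" for n using p z by (auto simp: KK_def mem_Times_iff)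
    have "(\<lambda>n. D (fst (p n)) (fst z)) \<longlonglongrightarrow> 0" "(\<lambda>n. D (snd (p n)) (snd z)) \<longlonglongrightarrow> 0"
      using p nn by (auto intro!: Dlim tendsto_fst tendsto_snd)
    then have s: "(\<lambda>n. D (fst (p n)) (fst z) + D (snd (p n)) (snd z)) \<longlonglongrightarrow> 0" using tendsto_add by fastforce
    have "(\<lambda>n. D (fst (p n)) (snd (p n)) - D (fst z) (snd z)) \<longlonglongrightarrow> 0"
    proof (rule Lim_null_comparison[OF _ s], intro always_eventually allI)
      fix n
      have 1: "D (fst (p n)) (snd (p n)) \<le> D (fst (p n)) (fst z) + D (fst z) (snd z) + D (snd z) (snd (p n))"
        by (rule Dt) (rule nn)+
      have 2: "D (fst z) (snd z) \<le> D (fst z) (fst (p n)) + D (fst (p n)) (snd (p n)) + D (snd (p n)) (snd z)"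
        by (rule Dt) (rule nn)+
      show "norm (D (fst (p n)) (snd (p n)) - D (fst z) (snd z)) \<le> D (fst (p n)) (fst z) + D (snd (p n)) (snd z)"
        using 1 2 Dsym[of "snd z" "snd (p n)"] Dsym[of "fst z" "fst (p n)"] by (simp add: abs_le_iff)
    qed
    then have "(\<lambda>n. D (fst (p n)) (snd (p n))) \<longlonglongrightarrow> D (fst z) (snd z)" by (rule LIM_zero_cancel)
    then show "((\<lambda>(a, b). D a b) \<circ> p) \<longlonglongrightarrow> (\<lambda>(a, b). D a b) z" by (simp add: o_def split_beta')
  qed
  moreover have "compact KK" unfolding KK_def by (intro compact_Times) auto
  ultimately have uc: "uniformly_continuous_on KK (\<lambda>(a, b). D a b)" by (intro compact_uniformly_continuous)
  have small: "\<exists>h>0. \<forall>a\<in>{0..T}. \<forall>b\<in>{0..T}. \<bar>a - b\<bar> < h \<longrightarrow> D a b < e" if e: "0 < e" for e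
  proof -
    obtain h where h: "h > 0" "\<And>p q. p \<in> KK \<Longrightarrow> q \<in> KK \<Longrightarrow> dist q p < h \<Longrightarrow> dist ((\<lambda>(a, b). D a b) q) ((\<lambda>(a, b). D a b) p) < e"
      using uc e unfolding uniformly_continuous_on_def by metis
    have "D a b < e" if "a \<in> {0..T}" "b \<in> {0..T}" "\<bar>a - b\<bar> < h" for a b
    proof -
      have "dist (a, b) (b, b) < h" using that by (simp add: dist_Pair_Pair dist_real_def)
      then have "\<bar>D a b - D b b\<bar> < e" using h(2)[of "(b, b)" "(a, b)"] that by (auto simp: KK_def dist_real_def)
      then show ?thesis by (simp add: D0)
    qed
    then show ?thesis using h(1) by blast
  qed
  \<comment> \<open>A summable rate: it upgrades convergence of the step functions in mean to
    convergence almost everywhere.\<close>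
  have "\<forall>n. \<exists>h>0. \<forall>a\<in>{0..T}. \<forall>b\<in>{0..T}. \<bar>a - b\<bar> < h \<longrightarrow> D a b < (1/2) ^ n"
    using small by simp
  then obtain h where h: "\<And>n. 0 < h n" "\<And>n a b. a \<in> {0..T} \<Longrightarrow> b \<in> {0..T} \<Longrightarrow> \<bar>a - b\<bar> < h n \<Longrightarrow> D a b < (1/2) ^ n"
    by metis
  \<comment> \<open>The grid point to the left of \<open>r\<close>. The maximum with 0 keeps the
    sampling time admissible for negative \<open>r\<close> too, where joint measurability is still
    required.\<close>
  define P where "P n r = max 0 (real_of_int \<lfloor>r / h n\<rfloor> * h n)" for n r
  have P: "P n r \<in> {0..T}" "\<bar>r - P n r\<bar> < h n" if "r \<in> {0..T}" for n r
  proof -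
    have "0 \<le> real_of_int \<lfloor>r / h n\<rfloor>" using that h(1)[of n] by simp
    then have eq: "P n r = real_of_int \<lfloor>r / h n\<rfloor> * h n" using h(1)[of n] by (simp add: P_def mult_nonneg_nonneg)
    have f: "real_of_int \<lfloor>r / h n\<rfloor> \<le> r / h n" "r / h n < real_of_int \<lfloor>r / h n\<rfloor> + 1" by linarith+
    have "P n r \<le> r" using f(1) unfolding eq pos_le_divide_eq[OF h(1)] .
    moreover have "r < P n r + h n" using f(2) unfolding eq pos_divide_less_eq[OF h(1)] by (simp add: algebra_simps)
    moreover have "0 \<le> P n r" by (simp add: P_def)
    ultimately show "P n r \<in> {0..T}" "\<bar>r - P n r\<bar> < h n" using that by auto
  qed
  have meas: "(\<lambda>p. u (P n (fst p)) (snd p)) \<in> borel_measurable (borel \<Otimes>\<^sub>M borel)" for n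
  proof -
    have um: "u (max 0 (real_of_int i * h n)) \<in> borel_measurable borel" for i
      using int[of "max 0 (real_of_int i * h n)"] by auto
    have "(\<lambda>p. u (max 0 (real_of_int \<lfloor>fst p / h n\<rfloor> * h n)) (snd p)) \<in> borel_measurable (borel \<Otimes>\<^sub>M borel)"
      by (rule measurable_compose_countable[where f="\<lambda>i p. u (max 0 (real_of_int i * h n)) (snd p)"])
         (measurable, use um in measurable)
    then show ?thesis by (simp add: P_def)
  qed
  define v where "v r x = lim (\<lambda>n. u (P n r) x)" for r x
  have "(\<lambda>p. v (fst p) (snd p)) \<in> borel_measurable (borel \<Otimes>\<^sub>M borel)"
    unfolding v_def by (rule borel_measurable_lim_metric[OF meas])
  moreover have "AE x in lborel. v r x = u r x" if r: "r \<in> {0..T}" for r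
  proof -
    have r0: "0 \<le> r" "0 \<le> P n r" for n using r P(1)[OF r, of n] by auto
    have [measurable]: "u r \<in> borel_measurable borel" "u (P n r) \<in> borel_measurable borel" for n
      using int[OF r0(1)] int[OF r0(2)[of n]] by auto
    have "(\<integral>\<^sup>+x. (\<Sum>n. ennreal \<bar>u (P n r) x - u r x\<bar>) \<partial>lborel) = (\<Sum>n. (\<integral>\<^sup>+x. ennreal \<bar>u (P n r) x - u r x\<bar> \<partial>lborel))"
      by (rule nn_integral_suminf) measurable
    also have "\<dots> = (\<Sum>n. ennreal (D (P n r) r))"
      unfolding D_def using int r0 by (intro suminf_cong nn_integral_eq_integral) auto
    also have "\<dots> \<le> (\<Sum>n. ennreal ((1/2) ^ n))"
    proof (intro suminf_le ennreal_leI)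
      fix n
      have "\<bar>P n r - r\<bar> < h n" using P(2)[OF r, of n] by linarith
      then show "D (P n r) r \<le> (1/2) ^ n" using h(2)[OF P(1)[OF r, of n] r, of n] by simp
    qed auto
    also have "\<dots> = ennreal 2"
      using geometric_sums[of "1/2::real"] by (intro suminf_ennreal_eq) auto
    finally have "(\<integral>\<^sup>+x. (\<Sum>n. ennreal \<bar>u (P n r) x - u r x\<bar>) \<partial>lborel) \<noteq> \<infinity>" by (auto simp: top_unique)
    then have "AE x in lborel. (\<Sum>n. ennreal \<bar>u (P n r) x - u r x\<bar>) \<noteq> \<infinity>"
      by (intro nn_integral_PInf_AE) measurable
    then show ?thesis
    proof eventually_elim
      case (elim x)
      then have "summable (\<lambda>n. \<bar>u (P n r) x - u r x\<bar>)" by (intro summable_suminf_not_top) auto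
      then have "(\<lambda>n. \<bar>u (P n r) x - u r x\<bar>) \<longlonglongrightarrow> 0" by (rule summable_LIMSEQ_zero)
      then have "(\<lambda>n. u (P n r) x - u r x) \<longlonglongrightarrow> 0" by (rule tendsto_rabs_zero_cancel)
      then have "(\<lambda>n. u (P n r) x) \<longlonglongrightarrow> u r x" by (rule LIM_zero_cancel)
      then show ?case unfolding v_def by (rule limI)
    qed
  qed
  ultimately show ?thesis by (intro exI[of _ v]) (auto simp: split_beta')
qed

text \<open>\<open>V\<close> is merely continuous, but its integral form \<open>V0 + G\<close> is
  differentiable, and multiplied by the integrating factor \<open>exp (- Kk r)\<close> it has
  derivative 0.\<close>

lemma linear_volterra_solution:
  fixes V k :: "real \<Rightarrow> complex"
  assumes T: "0 \<le> T" and V: "continuous_on {0..T} V" and k: "continuous_on {0..T} k"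
    and eq: "\<And>r. r \<in> {0..T} \<Longrightarrow> V r = V0 + (\<integral>\<tau>\<in>{0..r}. k \<tau> * V \<tau> \<partial>lborel)"
  shows "V T = V0 * exp (\<integral>\<tau>\<in>{0..T}. k \<tau> \<partial>lborel)"
proof -
  have kV: "continuous_on {0..T} (\<lambda>\<tau>. k \<tau> * V \<tau>)" by (intro continuous_intros k V)
  have leb: "(\<integral>\<tau>\<in>{0..r}. f \<tau> \<partial>lborel) = integral {0..r} f" if "continuous_on {0..T} f" "r \<in> {0..T}" for f :: "real \<Rightarrow> complex" and r
  proof -
    have "continuous_on {0..r} f" by (rule continuous_on_subset[OF that(1)]) (use that(2) in auto)
    then have "set_integrable lborel {0..r} f" by (rule borel_integrable_atLeastAtMost')
    then show ?thesis by (rule set_borel_integral_eq_integral(2))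
  qed
  define Kk where "Kk r = integral {0..r} k" for r
  define G where "G r = integral {0..r} (\<lambda>\<tau>. k \<tau> * V \<tau>)" for r
  have dK: "(Kk has_vector_derivative k r) (at r within {0..T})" if "r \<in> {0..T}" for r
    unfolding Kk_def by (rule integral_has_vector_derivative[OF k that])
  have dG: "(G has_vector_derivative k r * V r) (at r within {0..T})" if "r \<in> {0..T}" for r
    unfolding G_def by (rule integral_has_vector_derivative[OF kV that])
  have Veq: "V r = V0 + G r" if "r \<in> {0..T}" for r
    using eq[OF that] leb[OF kV that] by (simp add: G_def)
  define W where "W r = (V0 + G r) * exp (- Kk r)" for r
  have dW: "(W has_vector_derivative 0) (at r within {0..T})" if r: "r \<in> {0..T}" for r
  proof -
    have "((\<lambda>r. exp (- Kk r)) has_vector_derivative (- k r * exp (- Kk r))) (at r within {0..T})"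
    proof -
      have 1: "((\<lambda>r. - Kk r) has_vector_derivative - k r) (at r within {0..T})" by (intro derivative_intros dK r)
      show ?thesis
        using field_vector_diff_chain_within[OF 1 has_field_derivative_at_within[OF DERIV_exp]]
        by (simp add: o_def)
    qed
    then have "((\<lambda>r. (V0 + G r) * exp (- Kk r)) has_vector_derivative ((V0 + G r) * (- k r * exp (- Kk r)) + (0 + k r * V r) * exp (- Kk r))) (at r within {0..T})"
      by (intro has_vector_derivative_mult has_vector_derivative_add has_vector_derivative_const dG r)
    then show ?thesis unfolding W_def[abs_def] using Veq[OF r] by (simp add: algebra_simps)
  qed
  obtain c where c: "\<And>r. r \<in> {0..T} \<Longrightarrow> W r = c"
    using has_vector_derivative_zero_constant[of "{0..T}" W] dW by auto
  have "W T = W 0" using c T by simp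
  then have "(V0 + G T) * exp (- Kk T) = V0" by (simp add: W_def G_def Kk_def)
  then have "(V0 + G T) * (exp (- Kk T) * exp (Kk T)) = V0 * exp (Kk T)" by (simp only: mult.assoc[symmetric])
  then have "V0 + G T = V0 * exp (Kk T)" by (simp add: exp_add[symmetric])
  then show ?thesis using Veq[of T] T leb[OF k, of T] by (simp add: Kk_def)
qed

lemma
  fixes J :: "'a::euclidean_space \<Rightarrow> real"
  assumes J: "integrable lborel J" and \<epsilon>: "0 < \<epsilon>"
  shows integrable_rescale: "integrable lborel (rescale \<epsilon> J)"
    and ft_rescale: "ftr (rescale \<epsilon> J) \<eta> = ftr J (\<epsilon> *\<^sub>R \<eta>)"
proof -
  have [measurable]: "J \<in> borel_measurable borel" using J by auto
  have r: "rescale \<epsilon> J x = (1 / \<epsilon> ^ DIM('a)) * J (0 + (1 / \<epsilon>) *\<^sub>R x)" for x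
    using \<epsilon> by (simp add: rescale_def powr_minus_divide powr_realpow divide_inverse)
  have "integrable lborel (\<lambda>x. J (0 + (1 / \<epsilon>) *\<^sub>R x))"
    using integrable_lborel_affine_iff[of "1 / \<epsilon>" J 0] J \<epsilon> by simp
  then show "integrable lborel (rescale \<epsilon> J)" unfolding r[abs_def] by (intro integrable_mult_right)
  have "ftr (rescale \<epsilon> J) \<eta> = ft (\<lambda>x. of_real (1 / \<epsilon> ^ DIM('a)) * of_real (J ((1 / \<epsilon>) *\<^sub>R x))) \<eta>"
    unfolding r by simp
  also have "\<dots> = of_real (1 / \<epsilon> ^ DIM('a)) * ((1 / (1 / \<epsilon>) ^ DIM('a)) *\<^sub>R ftr J (\<eta> /\<^sub>R (1 / \<epsilon>)))"
    unfolding ft_cmult using \<epsilon> by (subst ft_scale[where W="\<lambda>x. of_real (J x)"]) auto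
  also have "\<dots> = ftr J (\<epsilon> *\<^sub>R \<eta>)" using \<epsilon> by (simp add: scaleR_conv_of_real power_divide)
  finally show "ftr (rescale \<epsilon> J) \<eta> = ftr J (\<epsilon> *\<^sub>R \<eta>)" .
qed

lemma norm_ftr_diff_le:
  fixes f g :: "'a::euclidean_space \<Rightarrow> real"
  assumes "integrable lborel f" "integrable lborel g"
  shows "cmod (ftr f \<xi> - ftr g \<xi>) \<le> (\<integral>x. \<bar>f x - g x\<bar> \<partial>lborel)"
proof -
  have "ftr f \<xi> - ftr g \<xi> = ft (\<lambda>x. of_real (f x - g x)) \<xi>"
    using ft_diff[of "\<lambda>x. of_real (f x)" "\<lambda>x. of_real (g x)" \<xi>] assms by simp
  then show ?thesis using norm_ft_le[of "\<lambda>x. of_real (f x - g x)" \<xi>] by (simp del: of_real_diff)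
qed

section \<open>Transform of a mild solution\<close>

locale mild =
  fixes k \<epsilon> s :: real and J u0 :: "'a::euclidean_space \<Rightarrow> real" and u :: "real \<Rightarrow> 'a \<Rightarrow> real"
  assumes sol: "mild_solution k \<epsilon> s J u0 u" and k: "0 < k" and \<epsilon>: "0 < \<epsilon>"
    and J: "integrable lborel J" and u0: "integrable lborel u0"
begin

abbreviation "c \<equiv> \<epsilon> powr (- 2 * s)"
abbreviation "K \<equiv> rescale \<epsilon> J"

lemma c_pos: "0 < c" using \<epsilon> by simp

lemma K_int: "integrable lborel K" by (rule integrable_rescale[OF J \<epsilon>])

lemma u_L1k: "0 \<le> t \<Longrightarrow> in_L1k k (u t)"
  using sol unfolding mild_solution_def Let_def by blast

lemma u_int: "0 \<le> t \<Longrightarrow> integrable lborel (u t)"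
  using in_L1kD(2)[OF u_L1k k] .

lemma u_cont:
  assumes "0 \<le> t0" shows "((\<lambda>t. \<integral>x. \<bar>u t x - u t0 x\<bar> \<partial>lborel) \<longlongrightarrow> 0) (at t0 within {0..})"
proof (rule tendsto_sandwich[where f="\<lambda>_. 0" and h="\<lambda>t. dist_L1k k (u t) (u t0)"])
  show "((\<lambda>t. dist_L1k k (u t) (u t0)) \<longlongrightarrow> 0) (at t0 within {0..})"
    using sol assms unfolding mild_solution_def Let_def by blast
  show "eventually (\<lambda>t. (\<integral>x. \<bar>u t x - u t0 x\<bar> \<partial>lborel) \<le> dist_L1k k (u t) (u t0)) (at t0 within {0..})"
    unfolding eventually_at using assms by (intro exI[of _ 1]) (auto intro!: L1_le_dist_L1k u_L1k k)
qed auto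

lemma u_seq_cont:
  assumes "r \<longlonglongrightarrow> r0" "\<And>n. 0 \<le> r n" "0 \<le> r0"
  shows "(\<lambda>n. \<integral>x. \<bar>u (r n) x - u r0 x\<bar> \<partial>lborel) \<longlonglongrightarrow> 0"
proof -
  have "((\<lambda>t. \<integral>x. \<bar>u t x - u r0 x\<bar> \<partial>lborel) \<longlongrightarrow> (\<integral>x. \<bar>u r0 x - u r0 x\<bar> \<partial>lborel)) (at r0 within {0..})"
    using u_cont[OF assms(3)] by simp
  then have "continuous (at r0 within {0..}) (\<lambda>t. \<integral>x. \<bar>u t x - u r0 x\<bar> \<partial>lborel)" by (simp add: continuous_within)
  then have "(\<lambda>n. \<integral>x. \<bar>u (r n) x - u r0 x\<bar> \<partial>lborel) \<longlonglongrightarrow> (\<integral>x. \<bar>u r0 x - u r0 x\<bar> \<partial>lborel)"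
    using assms unfolding continuous_within_sequentially by (auto simp: o_def)
  then show ?thesis by simp
qed

text \<open>The frequency may move with time, as it does along the characteristics of the transport:
  the distance in mean bounds the difference of transforms uniformly in the frequency.\<close>

lemma ft_u_continuous:
  assumes y: "continuous_on {0..T} y"
  shows "continuous_on {0..T} (\<lambda>r. ftr (u r) (y r))"
  unfolding continuous_on_sequentially
proof (intro ballI allI impI)
  fix r r0 assume r0: "r0 \<in> {0..T}" and r: "(\<forall>n. r n \<in> {0..T}) \<and> r \<longlonglongrightarrow> r0"
  have nn: "0 \<le> r n" "0 \<le> r0" for n using r r0 by auto
  have yl: "(\<lambda>n. y (r n)) \<longlonglongrightarrow> y r0" using y r r0 unfolding continuous_on_sequentially by (auto simp: o_def)
  have "(\<lambda>n. ftr (u (r n)) (y (r n)) - ftr (u r0) (y (r n))) \<longlonglongrightarrow> 0"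
    by (rule Lim_null_comparison[OF always_eventually u_seq_cont[of r r0]])
       (use r nn in \<open>auto intro!: norm_ftr_diff_le u_int\<close>)
  moreover have "(\<lambda>n. ftr (u r0) (y (r n))) \<longlonglongrightarrow> ftr (u r0) (y r0)"
    using continuous_on_tendsto_compose[OF continuous_ft yl] u_int[OF nn(2)] by simp
  ultimately have "(\<lambda>n. (ftr (u (r n)) (y (r n)) - ftr (u r0) (y (r n))) + ftr (u r0) (y (r n))) \<longlonglongrightarrow> 0 + ftr (u r0) (y r0)"
    by (rule tendsto_add)
  then show "((\<lambda>r. ftr (u r) (y r)) \<circ> r) \<longlonglongrightarrow> ftr (u r0) (y r0)" by (simp add: o_def)
qed

lemma u_bounded: "\<exists>M\<ge>0. \<forall>r\<in>{0..t}. (\<integral>x. \<bar>u r x\<bar> \<partial>lborel) \<le> M"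
proof -
  have "continuous_on {0..t} (\<lambda>r. \<integral>x. \<bar>u r x\<bar> \<partial>lborel)"
    unfolding continuous_on_sequentially
  proof (intro ballI allI impI)
    fix r r0 assume r0: "r0 \<in> {0..t}" and r: "(\<forall>n. r n \<in> {0..t}) \<and> r \<longlonglongrightarrow> r0"
    have nn: "0 \<le> r n" "0 \<le> r0" for n using r r0 by auto
    have "(\<lambda>n. (\<integral>x. \<bar>u (r n) x\<bar> \<partial>lborel) - (\<integral>x. \<bar>u r0 x\<bar> \<partial>lborel)) \<longlonglongrightarrow> 0"
    proof (rule Lim_null_comparison[OF always_eventually u_seq_cont[of r r0]], rule allI)
      fix n
      have "(\<integral>x. \<bar>u (r n) x\<bar> \<partial>lborel) - (\<integral>x. \<bar>u r0 x\<bar> \<partial>lborel) = (\<integral>x. \<bar>u (r n) x\<bar> - \<bar>u r0 x\<bar> \<partial>lborel)"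
        using u_int nn by simp
      also have "norm \<dots> \<le> (\<integral>x. \<bar>u (r n) x - u r0 x\<bar> \<partial>lborel)"
        using u_int nn by (intro Bochner_Integration.integral_norm_bound_integral) (auto simp: abs_triangle_ineq3)
      finally show "norm ((\<integral>x. \<bar>u (r n) x\<bar> \<partial>lborel) - (\<integral>x. \<bar>u r0 x\<bar> \<partial>lborel)) \<le> (\<integral>x. \<bar>u (r n) x - u r0 x\<bar> \<partial>lborel)" .
    qed (use r nn in auto)
    then show "((\<lambda>r. \<integral>x. \<bar>u r x\<bar> \<partial>lborel) \<circ> r) \<longlonglongrightarrow> (\<integral>x. \<bar>u r0 x\<bar> \<partial>lborel)"
      by (simp add: o_def LIM_zero_cancel)
  qed
  then have "bounded ((\<lambda>r. \<integral>x. \<bar>u r x\<bar> \<partial>lborel) ` {0..t})"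
    by (intro compact_imp_bounded compact_continuous_image) auto
  then obtain M where "\<forall>r\<in>{0..t}. \<bar>\<integral>x. \<bar>u r x\<bar> \<partial>lborel\<bar> \<le> M" by (auto simp: bounded_iff)
  then show ?thesis by (intro exI[of _ "max M 0"]) force
qed

text \<open>On transforms the transport semigroup contracts the frequency by
  \<open>exp (- t)\<close>, its factor \<open>exp (d * t)\<close> being the Jacobian, and
  convolution becomes a product. Exchanging the time integral with the transform needs joint
  measurability, hence the detour through the representative \<open>v\<close>.\<close>

lemma duhamel_ft:
  assumes t: "0 \<le> t"
  shows "ftr (u t) \<xi> = of_real (exp (- (c * t))) * ftr u0 (exp (- t) *\<^sub>R \<xi>)
    + (\<integral>\<tau>\<in>{0..t}. of_real (c * exp (- (c * (t - \<tau>)))) * (ftr K (exp (- (t - \<tau>)) *\<^sub>R \<xi>) * ftr (u \<tau>) (exp (- (t - \<tau>)) *\<^sub>R \<xi>)) \<partial>lborel)"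
proof -
  obtain v where vm: "(\<lambda>(r, x). v r x) \<in> borel_measurable (borel \<Otimes>\<^sub>M borel)"
    and v: "\<And>r. r \<in> {0..t} \<Longrightarrow> AE x in lborel. v r x = u r x"
    using L1_continuous_representative[OF u_int u_cont, of t] by blast
  have vm'[measurable (raw)]: "(\<lambda>z. v (f z) (g z)) \<in> borel_measurable M" if "f \<in> borel_measurable M" "g \<in> borel_measurable M" for f g and M :: "'b measure"
    using measurable_compose[OF measurable_Pair[OF that] vm] by (simp add: split_beta')
  have [measurable]: "K \<in> borel_measurable borel" using K_int by auto
  have [measurable]: "u0 \<in> borel_measurable borel" using u0 by auto
  have vr[measurable]: "v r \<in> borel_measurable borel" for r using vm'[of "\<lambda>_. r" borel "\<lambda>x. x"] by simp
  \<comment> \<open>Convolution does not see null sets, so \<open>u\<close> and \<open>v\<close>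
    agree exactly, at every point, inside the Duhamel integral.\<close>
  have conv_eq: "conv K (u r) = conv K (v r)" if r: "r \<in> {0..t}" for r
  proof
    fix y
    have "u r \<in> borel_measurable borel" using u_int[of r] r by auto
    then show "conv K (u r) y = conv K (v r) y"
      unfolding conv_def using v[OF r] by (intro integral_cong_AE) (auto elim!: eventually_mono)
  qed
  have [measurable]: "(\<lambda>z. conv K (v (f z)) (g z)) \<in> borel_measurable M" if [measurable]: "f \<in> borel_measurable M" "g \<in> borel_measurable M" for f g and M :: "'b measure"
    unfolding conv_def by measurable
  obtain M where M: "0 \<le> M" "\<And>r. r \<in> {0..t} \<Longrightarrow> (\<integral>x. \<bar>u r x\<bar> \<partial>lborel) \<le> M" using u_bounded by blast
  define w where "w \<tau> = exp (- c * (t - \<tau>)) * exp (real DIM('a) * (t - \<tau>))" for \<tau>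
  define H where "H \<tau> x = w \<tau> * (c * conv K (v \<tau>) (exp (t - \<tau>) *\<^sub>R x))" for \<tau> x
  have [measurable]: "w \<in> borel_measurable borel" unfolding w_def by measurable
  have conv_m: "(\<lambda>p. conv K (v (fst p)) (exp (t - fst p) *\<^sub>R snd p)) \<in> borel_measurable (lborel \<Otimes>\<^sub>M lborel)"
    unfolding conv_def by measurable
  have Hm[measurable]: "(\<lambda>p. H (fst p) (snd p)) \<in> borel_measurable (lborel \<Otimes>\<^sub>M lborel)"
    unfolding H_def using conv_m by measurable
  have ci: "integrable lborel (conv K (u \<tau>))" if "\<tau> \<in> {0..t}" for \<tau> using integrable_conv[OF K_int u_int] that by simp
  have Hx: "integrable lborel (H \<tau>)" if \<tau>: "\<tau> \<in> {0..t}" for \<tau>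
  proof -
    have "integrable lborel (\<lambda>x. conv K (v \<tau>) (0 + exp (t - \<tau>) *\<^sub>R x))"
      using integrable_lborel_affine_iff[of "exp (t - \<tau>)" "conv K (v \<tau>)" 0] ci[OF \<tau>] by (auto simp: conv_eq[OF \<tau>])
    then show ?thesis unfolding H_def[abs_def] by simp
  qed
  define C where "C = c * ((\<integral>x. \<bar>K x\<bar> \<partial>lborel) * M)"
  have Hn: "(\<integral>x. \<bar>H \<tau> x\<bar> \<partial>lborel) \<le> C" if \<tau>: "\<tau> \<in> {0..t}" for \<tau>
  proof -
    have "(\<integral>x. \<bar>conv K (v \<tau>) (0 + exp (t - \<tau>) *\<^sub>R x)\<bar> \<partial>lborel) = (1 / \<bar>exp (t - \<tau>)\<bar> ^ DIM('a)) *\<^sub>R (\<integral>x. \<bar>conv K (u \<tau>) x\<bar> \<partial>lborel)"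
      unfolding conv_eq[OF \<tau>] by (rule integral_lborel_affine) (use ci[OF \<tau>] in \<open>auto simp: conv_eq[OF \<tau>]\<close>)
    moreover have "\<bar>H \<tau> x\<bar> = w \<tau> * (c * \<bar>conv K (v \<tau>) (0 + exp (t - \<tau>) *\<^sub>R x)\<bar>)" for x
      by (simp add: H_def w_def abs_mult)
    moreover have "exp (real DIM('a) * (t - \<tau>)) = exp (t - \<tau>) ^ DIM('a)" by (rule exp_of_nat_mult)
    ultimately have "(\<integral>x. \<bar>H \<tau> x\<bar> \<partial>lborel) = exp (- c * (t - \<tau>)) * (c * (\<integral>x. \<bar>conv K (u \<tau>) x\<bar> \<partial>lborel))"
      by (simp add: w_def)
    also have "\<dots> \<le> 1 * (c * ((\<integral>x. \<bar>K x\<bar> \<partial>lborel) * M))"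
    proof (intro mult_mono)
      show "exp (- c * (t - \<tau>)) \<le> 1" using \<tau> c_pos by (simp add: mult_nonneg_nonneg)
      have "(\<integral>x. \<bar>conv K (u \<tau>) x\<bar> \<partial>lborel) \<le> (\<integral>x. \<bar>K x\<bar> \<partial>lborel) * (\<integral>x. \<bar>u \<tau> x\<bar> \<partial>lborel)"
        using norm_conv_le[OF K_int u_int] \<tau> by simp
      also have "\<dots> \<le> (\<integral>x. \<bar>K x\<bar> \<partial>lborel) * M" using M(2)[OF \<tau>] by (intro mult_left_mono) auto
      finally show "(\<integral>x. \<bar>conv K (u \<tau>) x\<bar> \<partial>lborel) \<le> (\<integral>x. \<bar>K x\<bar> \<partial>lborel) * M" .
    qed auto
    finally show ?thesis by (simp add: C_def)
  qed
  have HP: "integrable (lborel \<Otimes>\<^sub>M lborel) (\<lambda>p. indicat_real {0..t} (fst p) * H (fst p) (snd p))"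
  proof (rule lborel_pair.Fubini_integrable)
    show "integrable lborel (\<lambda>\<tau>. \<integral>x. norm (indicat_real {0..t} (fst (\<tau>, x)) * H (fst (\<tau>, x)) (snd (\<tau>, x))) \<partial>lborel)"
    proof (rule Bochner_Integration.integrable_bound)
      show "integrable lborel (\<lambda>\<tau>. C * indicat_real {0..t} \<tau>)" using integrable_indicator_Icc by (rule integrable_mult_right)
      show "AE \<tau> in lborel. norm (\<integral>x. norm (indicat_real {0..t} (fst (\<tau>, x)) * H (fst (\<tau>, x)) (snd (\<tau>, x))) \<partial>lborel) \<le> norm (C * indicat_real {0..t} \<tau>)"
      proof (rule AE_I2)
        fix \<tau>
        show "norm (\<integral>x. norm (indicat_real {0..t} (fst (\<tau>, x)) * H (fst (\<tau>, x)) (snd (\<tau>, x))) \<partial>lborel) \<le> norm (C * indicat_real {0..t} \<tau>)"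
          using Hn[of \<tau>] by (cases "\<tau> \<in> {0..t}") (auto simp: abs_mult)
      qed
    qed (use Hm in measurable)
    show "AE \<tau> in lborel. integrable lborel (\<lambda>x. indicat_real {0..t} (fst (\<tau>, x)) * H (fst (\<tau>, x)) (snd (\<tau>, x)))"
    proof (rule AE_I2)
      fix \<tau> show "integrable lborel (\<lambda>x. indicat_real {0..t} (fst (\<tau>, x)) * H (fst (\<tau>, x)) (snd (\<tau>, x)))"
        using Hx[of \<tau>] by (cases "\<tau> \<in> {0..t}") auto
    qed
  qed measurable
  have HPc: "integrable (lborel \<Otimes>\<^sub>M lborel) (\<lambda>(\<tau>, x). complex_of_real (indicat_real {0..t} \<tau> * H \<tau> x) * cis (x \<bullet> \<xi>))"
  proof -
    have "integrable (lborel \<Otimes>\<^sub>M lborel) (\<lambda>p. complex_of_real (indicat_real {0..t} (fst p) * H (fst p) (snd p)))"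
      using HP by (simp only: complex_of_real_integrable_eq)
    then have "integrable (lborel \<Otimes>\<^sub>M lborel) (\<lambda>p. complex_of_real (indicat_real {0..t} (fst p) * H (fst p) (snd p)) * cis (snd p \<bullet> \<xi>))"
      by (rule integrable_mult_cis) measurable
    then show ?thesis by (simp only: split_beta')
  qed
  define A where "A x = exp (- c * t) * exp (real DIM('a) * t) * u0 (exp t *\<^sub>R x)" for x
  define B where "B x = (\<integral>\<tau>. indicat_real {0..t} \<tau> * H \<tau> x \<partial>lborel)" for x
  have Ai: "integrable lborel A"
    using integrable_lborel_affine_iff[of "exp t" u0 0] u0 unfolding A_def[abs_def] by (intro integrable_mult_right) auto
  have Bi: "integrable lborel B"
    using lborel_pair.integrable_snd[of "\<lambda>\<tau> x. indicat_real {0..t} \<tau> * H \<tau> x"] HP by (simp add: B_def[abs_def] split_beta')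
  have uAB: "AE x in lborel. u t x = A x + B x"
  proof -
    have "AE x in lborel. u t x = exp (- c * t) * exp (real DIM('a) * t) * u0 (exp t *\<^sub>R x)
       + (\<integral>\<tau>\<in>{0..t}. exp (- c * (t - \<tau>)) * exp (real DIM('a) * (t - \<tau>)) * (c * conv K (u \<tau>) (exp (t - \<tau>) *\<^sub>R x)) \<partial>lborel)"
      using sol t unfolding mild_solution_def Let_def by (auto elim!: eventually_mono)
    then show ?thesis
    proof eventually_elim
      case (elim x)
      have "(\<integral>\<tau>\<in>{0..t}. exp (- c * (t - \<tau>)) * exp (real DIM('a) * (t - \<tau>)) * (c * conv K (u \<tau>) (exp (t - \<tau>) *\<^sub>R x)) \<partial>lborel) = B x"
        unfolding B_def set_lebesgue_integral_def
        by (intro Bochner_Integration.integral_cong refl) (auto simp: indicator_def H_def w_def conv_eq)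
      then show ?case using elim by (simp add: A_def)
    qed
  qed
  have [measurable]: "u t \<in> borel_measurable borel" "A \<in> borel_measurable borel" "B \<in> borel_measurable borel"
    using u_int[OF t] Ai Bi by auto
  have "ftr (u t) \<xi> = ft (\<lambda>x. of_real (A x) + of_real (B x)) \<xi>"
    unfolding ft_def by (rule integral_cong_AE) (measurable, use uAB in eventually_elim, simp)
  also have "\<dots> = ftr A \<xi> + ftr B \<xi>" using Ai Bi by (intro ft_add) auto
  also have "ftr A \<xi> = of_real (exp (- (c * t))) * ftr u0 (exp (- t) *\<^sub>R \<xi>)"
  proof -
    have "ftr A \<xi> = of_real (exp (- c * t) * exp (real DIM('a) * t)) * ((1 / exp t ^ DIM('a)) *\<^sub>R ftr u0 (\<xi> /\<^sub>R exp t))"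
      unfolding A_def of_real_mult[of _ "u0 _"] ft_cmult by (subst ft_scale[where W="\<lambda>x. of_real (u0 x)"]) auto
    moreover have "exp (real DIM('a) * t) = exp t ^ DIM('a)" by (rule exp_of_nat_mult)
    ultimately show ?thesis by (simp add: exp_minus scaleR_conv_of_real)
  qed
  also have "ftr B \<xi> = (\<integral>x. (\<integral>\<tau>. complex_of_real (indicat_real {0..t} \<tau> * H \<tau> x) * cis (x \<bullet> \<xi>) \<partial>lborel) \<partial>lborel)"
    unfolding ft_def B_def by (simp only: integral_mult_left_zero integral_complex_of_real)
  also have "\<dots> = (\<integral>\<tau>. (\<integral>x. complex_of_real (indicat_real {0..t} \<tau> * H \<tau> x) * cis (x \<bullet> \<xi>) \<partial>lborel) \<partial>lborel)"
    by (rule lborel_pair.Fubini_integral[OF HPc])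
  also have "\<dots> = (\<integral>\<tau>\<in>{0..t}. of_real (c * exp (- (c * (t - \<tau>)))) * (ftr K (exp (- (t - \<tau>)) *\<^sub>R \<xi>) * ftr (u \<tau>) (exp (- (t - \<tau>)) *\<^sub>R \<xi>)) \<partial>lborel)"
    unfolding set_lebesgue_integral_def
  proof (intro Bochner_Integration.integral_cong refl)
    fix \<tau> :: real
    show "(\<integral>x. complex_of_real (indicat_real {0..t} \<tau> * H \<tau> x) * cis (x \<bullet> \<xi>) \<partial>lborel) = indicat_real {0..t} \<tau> *\<^sub>R (of_real (c * exp (- (c * (t - \<tau>)))) * (ftr K (exp (- (t - \<tau>)) *\<^sub>R \<xi>) * ftr (u \<tau>) (exp (- (t - \<tau>)) *\<^sub>R \<xi>)))"
    proof (cases "\<tau> \<in> {0..t}")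
      case True
      have "(\<integral>x. complex_of_real (indicat_real {0..t} \<tau> * H \<tau> x) * cis (x \<bullet> \<xi>) \<partial>lborel) = ft (\<lambda>x. of_real (w \<tau> * c) * of_real (conv K (u \<tau>) (exp (t - \<tau>) *\<^sub>R x))) \<xi>"
        using True by (simp add: ft_def H_def conv_eq mult.assoc)
      also have "\<dots> = of_real (w \<tau> * c) * ((1 / exp (t - \<tau>) ^ DIM('a)) *\<^sub>R ftr (conv K (u \<tau>)) (\<xi> /\<^sub>R exp (t - \<tau>)))"
        unfolding ft_cmult using ci[OF True] by (subst ft_scale[where W="\<lambda>x. of_real (conv K (u \<tau>) x)"]) auto
      also have "\<dots> = of_real (w \<tau> * c / exp (t - \<tau>) ^ DIM('a)) * ftr (conv K (u \<tau>)) (exp (- (t - \<tau>)) *\<^sub>R \<xi>)"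
        by (simp add: scaleR_conv_of_real exp_minus[symmetric])
      also have "w \<tau> * c / exp (t - \<tau>) ^ DIM('a) = c * exp (- (c * (t - \<tau>)))"
      proof -
        have "exp (real DIM('a) * (t - \<tau>)) = exp (t - \<tau>) ^ DIM('a)" by (rule exp_of_nat_mult)
        then show ?thesis by (simp add: w_def)
      qed
      also have "ftr (conv K (u \<tau>)) (exp (- (t - \<tau>)) *\<^sub>R \<xi>) = ftr K (exp (- (t - \<tau>)) *\<^sub>R \<xi>) * ftr (u \<tau>) (exp (- (t - \<tau>)) *\<^sub>R \<xi>)"
        using True by (intro ft_conv K_int u_int) auto
      finally show ?thesis using True by simp
    qed simp
  qed
  finally show ?thesis .
qed

text \<open>Along the characteristic \<open>exp (r - T) \<xi>\<close> all contractions in Duhamel's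
  formula compose to frequencies that depend on the integration time only; after multiplication by
  \<open>exp (c * r)\<close> a scalar linear Volterra equation for \<open>V\<close> remains.\<close>

lemma ft_solution:
  assumes T: "0 \<le> T"
  shows "ftr (u T) \<xi> = ftr u0 (exp (- T) *\<^sub>R \<xi>) * exp (of_real c * (jump_mult T J UNIV (\<epsilon> *\<^sub>R \<xi>) - of_real T))"
proof -
  define V where "V r = of_real (exp (c * r)) * ftr (u r) (exp (r - T) *\<^sub>R \<xi>)" for r
  define kk where "kk \<tau> = of_real c * ftr K (exp (\<tau> - T) *\<^sub>R \<xi>)" for \<tau>
  have Kc: "integrable lborel (\<lambda>x. complex_of_real (K x))" using K_int by simp
  have "V T = ftr u0 (exp (- T) *\<^sub>R \<xi>) * exp (\<integral>\<tau>\<in>{0..T}. kk \<tau> \<partial>lborel)"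
  proof (rule linear_volterra_solution[OF T])
    show "continuous_on {0..T} V" unfolding V_def by (intro continuous_intros ft_u_continuous)
    show "continuous_on {0..T} kk" unfolding kk_def
      by (intro continuous_intros continuous_on_compose2[OF continuous_ft[OF Kc]]) auto
    fix r assume r: "r \<in> {0..T}"
    have "V r = of_real (exp (c * r)) * (of_real (exp (- (c * r))) * ftr u0 (exp (- r) *\<^sub>R exp (r - T) *\<^sub>R \<xi>)
      + (\<integral>\<tau>\<in>{0..r}. of_real (c * exp (- (c * (r - \<tau>)))) * (ftr K (exp (- (r - \<tau>)) *\<^sub>R exp (r - T) *\<^sub>R \<xi>) * ftr (u \<tau>) (exp (- (r - \<tau>)) *\<^sub>R exp (r - T) *\<^sub>R \<xi>)) \<partial>lborel))"
      unfolding V_def using duhamel_ft[of r "exp (r - T) *\<^sub>R \<xi>"] r by simp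
    also have "\<dots> = of_real (exp (c * r) * exp (- (c * r))) * ftr u0 (exp (- r) *\<^sub>R exp (r - T) *\<^sub>R \<xi>)
      + (\<integral>\<tau>\<in>{0..r}. of_real (exp (c * r)) * (of_real (c * exp (- (c * (r - \<tau>)))) * (ftr K (exp (- (r - \<tau>)) *\<^sub>R exp (r - T) *\<^sub>R \<xi>) * ftr (u \<tau>) (exp (- (r - \<tau>)) *\<^sub>R exp (r - T) *\<^sub>R \<xi>))) \<partial>lborel)"
      by (simp only: distrib_left set_integral_mult_right of_real_mult mult.assoc)
    also have "exp (c * r) * exp (- (c * r)) = 1" by (simp add: exp_add[symmetric])
    also have "exp (- r) *\<^sub>R exp (r - T) *\<^sub>R \<xi> = exp (- T) *\<^sub>R \<xi>" by (simp add: exp_add[symmetric])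
    also have "(\<integral>\<tau>\<in>{0..r}. of_real (exp (c * r)) * (of_real (c * exp (- (c * (r - \<tau>)))) * (ftr K (exp (- (r - \<tau>)) *\<^sub>R exp (r - T) *\<^sub>R \<xi>) * ftr (u \<tau>) (exp (- (r - \<tau>)) *\<^sub>R exp (r - T) *\<^sub>R \<xi>))) \<partial>lborel)
      = (\<integral>\<tau>\<in>{0..r}. kk \<tau> * V \<tau> \<partial>lborel)"
    proof (intro set_lebesgue_integral_cong allI impI)
      fix \<tau>
      have 1: "exp (c * r) * (c * exp (- (c * (r - \<tau>)))) = c * exp (c * \<tau>)"
        by (simp add: exp_add[symmetric] algebra_simps)
      have 2: "exp (- (r - \<tau>)) *\<^sub>R exp (r - T) *\<^sub>R \<xi> = exp (\<tau> - T) *\<^sub>R \<xi>" by (simp add: exp_add[symmetric])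
      show "of_real (exp (c * r)) * (of_real (c * exp (- (c * (r - \<tau>)))) * (ftr K (exp (- (r - \<tau>)) *\<^sub>R exp (r - T) *\<^sub>R \<xi>) * ftr (u \<tau>) (exp (- (r - \<tau>)) *\<^sub>R exp (r - T) *\<^sub>R \<xi>))) = kk \<tau> * V \<tau>"
      proof -
        define X where "X = ftr K (exp (\<tau> - T) *\<^sub>R \<xi>)"
        define Y where "Y = ftr (u \<tau>) (exp (\<tau> - T) *\<^sub>R \<xi>)"
        have "complex_of_real (exp (c * r)) * (of_real (c * exp (- (c * (r - \<tau>)))) * (X * Y)) = of_real (exp (c * r) * (c * exp (- (c * (r - \<tau>))))) * (X * Y)"
          by (simp only: of_real_mult mult.assoc)
        also have "\<dots> = of_real c * X * (of_real (exp (c * \<tau>)) * Y)"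
          unfolding 1 of_real_mult by (simp only: mult_ac)
        finally show ?thesis unfolding 2 kk_def V_def X_def Y_def .
      qed
    qed simp
    finally show "V r = ftr u0 (exp (- T) *\<^sub>R \<xi>) + (\<integral>\<tau>\<in>{0..r}. kk \<tau> * V \<tau> \<partial>lborel)" by simp
  qed
  moreover have "(\<integral>\<tau>\<in>{0..T}. kk \<tau> \<partial>lborel) = of_real c * jump_mult T J UNIV (\<epsilon> *\<^sub>R \<xi>)"
  proof -
    have Jc: "integrable lborel (\<lambda>x. complex_of_real (J x))" using J by simp
    define g where "g \<tau> = indicat_real {0..T} \<tau> *\<^sub>R ftr J (exp (- \<tau>) *\<^sub>R \<epsilon> *\<^sub>R \<xi>)" for \<tau>
    have "continuous_on UNIV (\<lambda>\<tau>. ftr J (exp (- \<tau>) *\<^sub>R \<epsilon> *\<^sub>R \<xi>))"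
      by (intro continuous_on_compose2[OF continuous_ft[OF Jc]] continuous_intros) auto
    then have [measurable]: "(\<lambda>\<tau>. ftr J (exp (- \<tau>) *\<^sub>R \<epsilon> *\<^sub>R \<xi>)) \<in> borel_measurable borel" by (rule borel_measurable_continuous_onI)
    have gm: "g \<in> borel_measurable borel" unfolding g_def[abs_def] by measurable
    \<comment> \<open>Time is reversed: \<open>kk\<close> is indexed by the time of the jump,
      \<open>jump_mult\<close> by the time elapsed since.\<close>
    have "(\<integral>\<tau>\<in>{0..T}. kk \<tau> \<partial>lborel) = (\<integral>\<tau>. of_real c * g (T - \<tau>) \<partial>lborel)"
      unfolding set_lebesgue_integral_def kk_def g_def
      by (intro Bochner_Integration.integral_cong refl) (auto simp: indicator_def ft_rescale[OF J \<epsilon>] mult.commute)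
    also have "\<dots> = of_real c * (\<integral>\<tau>. g \<tau> \<partial>lborel)"
      unfolding integral_mult_right_zero by (subst integral_lborel_reflect[OF gm]) (rule refl)
    finally show ?thesis unfolding jump_mult_UNIV[OF J] by (simp add: g_def set_lebesgue_integral_def)
  qed
  ultimately have VT: "V T = ftr u0 (exp (- T) *\<^sub>R \<xi>) * exp (of_real c * jump_mult T J UNIV (\<epsilon> *\<^sub>R \<xi>))" by simp
  have "ftr (u T) \<xi> = of_real (exp (- (c * T)) * exp (c * T)) * ftr (u T) \<xi>" by (simp add: exp_add[symmetric])
  also have "\<dots> = of_real (exp (- (c * T))) * V T" by (simp add: V_def)
  also have "\<dots> = ftr u0 (exp (- T) *\<^sub>R \<xi>) * (of_real (exp (- (c * T))) * exp (of_real c * jump_mult T J UNIV (\<epsilon> *\<^sub>R \<xi>)))"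
    unfolding VT by simp
  also have "of_real (exp (- (c * T))) * exp (of_real c * jump_mult T J UNIV (\<epsilon> *\<^sub>R \<xi>)) = exp (of_real c * (jump_mult T J UNIV (\<epsilon> *\<^sub>R \<xi>) - of_real T))"
    by (simp add: exp_of_real[symmetric] exp_add[symmetric] algebra_simps flip: exp_of_real)
  finally show ?thesis .
qed

end

section \<open>Back to physical space\<close>

lemma integrable_indicator_bounded:
  assumes "A \<in> sets borel" "bounded A"
  shows "integrable lborel (indicat_real (A::'a::euclidean_space set))"
  by (rule integrable_real_indicator) (use assms emeasure_bounded_finite[OF assms(2)] in auto)

text \<open>Otherwise inner regularity gives a compact set of positive measure inside the ball on
  which \<open>f < a\<close>; continuous cutoffs decreasing to its indicator contradict the
  hypothesis in the limit.\<close>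

lemma AE_ge_of_test_functions:
  fixes f :: "'a::euclidean_space \<Rightarrow> real"
  assumes f: "integrable lborel f"
    and test: "\<And>\<phi>. continuous_on UNIV \<phi> \<Longrightarrow> (\<And>x. 0 \<le> \<phi> x) \<Longrightarrow> (\<And>x. \<phi> x \<le> 1) \<Longrightarrow> (\<And>x. x \<notin> ball 0 R \<Longrightarrow> \<phi> x = 0)
      \<Longrightarrow> a * (\<integral>x. \<phi> x \<partial>lborel) \<le> (\<integral>x. f x * \<phi> x \<partial>lborel)"
  shows "AE x in lborel. x \<in> ball 0 R \<longrightarrow> a \<le> f x"
proof -
  have [measurable]: "f \<in> borel_measurable borel" using f by auto
  define N where "N = {x \<in> ball 0 R. f x < a}"
  have Nb: "N \<in> sets borel" unfolding N_def by measurable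
  have Nfin: "emeasure lborel N < \<infinity>"
  proof -
    have "emeasure lborel N \<le> emeasure lborel (ball (0::'a) R)" by (intro emeasure_mono) (auto simp: N_def)
    also have "\<dots> < \<infinity>" by (rule emeasure_bounded_finite) simp
    finally show ?thesis .
  qed
  have "emeasure lborel N = 0"
  proof (rule ccontr)
    assume pos: "emeasure lborel N \<noteq> 0"
    define e where "e = measure lborel N"
    have eN: "emeasure lborel N = ennreal e" unfolding e_def using Nfin by (intro emeasure_eq_ennreal_measure) auto
    have e: "e > 0" using pos eN by (metis ennreal_eq_0_iff e_def measure_nonneg order_le_less order_refl)
    \<comment> \<open>An error below the measure of \<open>N\<close> leaves \<open>C\<close> with
      positive measure.\<close>
    obtain C where C: "closed C" "C \<subseteq> N" "emeasure lebesgue (N - C) < ennreal e"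
      using sets_lebesgue_inner_closed[of N e] Nb e by (metis sets_completionI_sets sets_lborel)
    have Cb: "C \<in> sets borel" using C(1) by (rule borel_closed)
    have Cball: "C \<subseteq> ball 0 R" using C(2) by (auto simp: N_def)
    have compC: "compact C"
      using Cball C(1) bounded_subset[OF bounded_ball] by (simp add: compact_eq_bounded_closed)
    have NC: "emeasure lborel (N - C) < emeasure lborel N" using C(3) Nb Cb eN by (simp add: emeasure_completion)
    have Cpos: "emeasure lborel C \<noteq> 0"
    proof
      assume "emeasure lborel C = 0"
      then have "emeasure lborel (N - C) = emeasure lborel N"
        using Nb Cb by (intro emeasure_Diff_null_set) (auto simp: null_sets_def)
      then show False using NC by simp
    qed
    then have Cne: "C \<noteq> {}" by auto
    obtain \<eta> where \<eta>: "\<eta> > 0" "{x. infdist x C \<le> \<eta>} \<subseteq> ball 0 R"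
      using compact_in_open_separated[OF Cne compC open_ball Cball] by blast
    \<comment> \<open>A slope above \<open>1 / \<eta>\<close> makes all cutoffs vanish outside the
      ball.\<close>
    obtain n0 :: nat where n0: "1 / \<eta> < real n0" using reals_Archimedean2 by blast
    have n0p: "0 < real n0" using n0 \<eta>(1) by (meson less_trans zero_less_divide_1_iff)
    define \<phi> where "\<phi> n x = max 0 (1 - real (n + n0) * infdist x C)" for n and x :: 'a
    have \<phi>c: "continuous_on UNIV (\<phi> n)" for n unfolding \<phi>_def by (intro continuous_intros)
    have [measurable]: "\<phi> n \<in> borel_measurable borel" for n using \<phi>c by (rule borel_measurable_continuous_onI)
    have \<phi>01: "0 \<le> \<phi> n x" "\<phi> n x \<le> 1" for n x unfolding \<phi>_def using infdist_nonneg[of x C] by auto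
    have \<phi>0: "\<phi> n x = 0" if "x \<notin> ball 0 R" for n x
    proof -
      have "\<eta> < infdist x C" using that \<eta>(2) by (force simp: not_le)
      then have "1 / \<eta> * \<eta> \<le> real (n + n0) * infdist x C" using n0 \<eta>(1) by (intro mult_mono) auto
      then show ?thesis using \<eta>(1) by (simp add: \<phi>_def)
    qed
    have lim: "(\<lambda>n. \<phi> n x) \<longlonglongrightarrow> indicator C x" for x
    proof (cases "x \<in> C")
      case True then show ?thesis by (simp add: \<phi>_def)
    next
      case False
      then have d: "infdist x C > 0" using C(1) Cne by (metis in_closed_iff_infdist_zero infdist_nonneg order_le_less)
      obtain n1 :: nat where n1: "1 / infdist x C < real n1" using reals_Archimedean2 by blast
      have "\<phi> n x = 0" if "n \<ge> n1" for n
      proof -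
        have "1 / infdist x C * infdist x C \<le> real (n + n0) * infdist x C" using n1 that d by (intro mult_right_mono) auto
        then show ?thesis using d by (simp add: \<phi>_def)
      qed
      then have "eventually (\<lambda>n. \<phi> n x = indicator C x) sequentially" using False by (intro eventually_sequentiallyI[of n1]) simp
      then show ?thesis by (rule tendsto_eventually)
    qed
    have ball_int: "integrable lborel (indicat_real (ball (0::'a) R))"
      by (rule integrable_indicator_bounded) auto
    have l1: "(\<lambda>n. \<integral>x. \<phi> n x \<partial>lborel) \<longlonglongrightarrow> (\<integral>x. indicat_real C x \<partial>lborel)"
    proof (rule integral_dominated_convergence[where w="indicat_real (ball (0::'a) R)"])
      show "AE x in lborel. norm (\<phi> n x) \<le> indicat_real (ball 0 R) x" for n
        using \<phi>01 \<phi>0 by (intro AE_I2) (auto simp: indicator_def)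
    qed (use lim ball_int Cb in auto)
    have l2: "(\<lambda>n. \<integral>x. f x * \<phi> n x \<partial>lborel) \<longlonglongrightarrow> (\<integral>x. f x * indicat_real C x \<partial>lborel)"
    proof (rule integral_dominated_convergence[where w="\<lambda>x. \<bar>f x\<bar>"])
      show "AE x in lborel. norm (f x * \<phi> n x) \<le> \<bar>f x\<bar>" for n
        using \<phi>01 by (intro AE_I2) (simp add: abs_mult mult_left_le)
      show "AE x in lborel. (\<lambda>n. f x * \<phi> n x) \<longlonglongrightarrow> f x * indicat_real C x" by (intro AE_I2 tendsto_intros lim)
    qed (use f Cb in auto)
    have "a * (\<integral>x. indicat_real C x \<partial>lborel) \<le> (\<integral>x. f x * indicat_real C x \<partial>lborel)"
      by (rule LIMSEQ_le[OF tendsto_mult[OF tendsto_const l1] l2]) (use test[OF \<phi>c \<phi>01 \<phi>0] in auto)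
    moreover have Ci: "integrable lborel (indicat_real C)"
      using Cb compC by (intro integrable_indicator_bounded compact_imp_bounded)
    moreover have fCi: "integrable lborel (\<lambda>x. f x * indicat_real C x)"
      using integrable_mult_indicator[OF _ f, of C] Cb by (simp add: mult.commute)
    ultimately have le0: "(\<integral>x. a * indicat_real C x - f x * indicat_real C x \<partial>lborel) \<le> 0" by simp
    have nn: "0 \<le> a * indicat_real C x - f x * indicat_real C x" for x using C(2) by (auto simp: N_def indicator_def)
    have "(\<integral>x. a * indicat_real C x - f x * indicat_real C x \<partial>lborel) = 0"
      using le0 nn by (intro order_antisym Bochner_Integration.integral_nonneg) auto
    then have "AE x in lborel. a * indicat_real C x - f x * indicat_real C x = 0"
      using integral_nonneg_eq_0_iff_AE[of lborel "\<lambda>x. a * indicat_real C x - f x * indicat_real C x"] Ci fCi nn by auto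
    then have "AE x in lborel. x \<notin> C"
      by eventually_elim (use C(2) in \<open>auto simp: N_def indicator_def split: if_splits\<close>)
    then show False using Cpos Cb AE_iff_null_sets[of C lborel] by (auto simp: null_sets_def)
  qed
  then have "AE x in lborel. x \<notin> N" using Nb by (subst AE_iff_null_sets[symmetric]) (auto simp: null_sets_def)
  then show ?thesis by eventually_elim (auto simp: N_def not_less)
qed

context mild begin

text \<open>The Gaussian factor makes inversion legitimate although \<open>E\<close> is only
  bounded. As \<open>ft\<close> inverts itself up to reflection, the transition density appears at
  \<open>exp (- t) z - x0\<close>, the negative of the displacement from the transported point to
  \<open>x0\<close>.\<close>

lemma smoothed_solution:
  assumes t: "0 \<le> t" and \<sigma>: "0 < \<sigma>"
    and E: "E \<in> borel_measurable borel" "\<And>\<xi>. cmod (E \<xi>) \<le> B"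
    and eq: "\<And>\<xi>. ftr (u t) \<xi> = ftr u0 (exp (- t) *\<^sub>R \<xi>) * E \<xi>"
  shows "(2 * pi) ^ DIM('a) * (\<integral>x. u t x * heat \<sigma> (x - x0) \<partial>lborel)
    = (\<integral>z. u0 z * Re (ft (\<lambda>\<xi>. E \<xi> * of_real (gauss \<sigma> \<xi>)) (exp (- t) *\<^sub>R z - x0)) \<partial>lborel)"
proof -
  note [measurable] = E(1)
  have uc: "integrable lborel (\<lambda>x. complex_of_real (u t x))" using u_int[OF t] by simp
  have u0c: "integrable lborel (\<lambda>x. complex_of_real (u0 x))" using u0 by simp
  have g: "integrable lborel (\<lambda>\<xi>::'a. complex_of_real (gauss \<sigma> \<xi>))" using integrable_gauss[OF \<sigma>, where 'a='a] by simp
  have Eg: "integrable lborel (\<lambda>\<xi>. E \<xi> * complex_of_real (gauss \<sigma> \<xi>))" by (rule integrable_bounded_mult[OF _ E(2) g]) measurable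
  have "complex_of_real ((2 * pi) ^ DIM('a) * (\<integral>x. u t x * heat \<sigma> (x - x0) \<partial>lborel))
     = (\<integral>x. of_real (u t x) * ftr (gauss \<sigma>) (x - x0) \<partial>lborel)"
  proof -
    have "(\<integral>x. of_real (u t x) * ftr (gauss \<sigma>) (x - x0) \<partial>lborel) = (\<integral>x. complex_of_real ((2 * pi) ^ DIM('a) * (u t x * heat \<sigma> (x - x0))) \<partial>lborel)"
      unfolding ft_gauss[OF \<sigma>] by (intro Bochner_Integration.integral_cong refl) simp
    then show ?thesis by (simp only: integral_complex_of_real integral_mult_right_zero)
  qed
  also have "\<dots> = (\<integral>x. of_real (u t x) * (\<integral>\<xi>. of_real (gauss \<sigma> \<xi>) * cis (\<xi> \<bullet> (x - x0)) \<partial>lborel) \<partial>lborel)" by (simp only: ft_def)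
  also have "\<dots> = (\<integral>\<xi>. of_real (gauss \<sigma> \<xi>) * (\<integral>x. of_real (u t x) * cis (\<xi> \<bullet> (x - x0)) \<partial>lborel) \<partial>lborel)"
    by (rule lborel_pair.integral_kernel_swap[OF uc g, where C=1]) auto
  also have "\<dots> = (\<integral>\<xi>. (E \<xi> * of_real (gauss \<sigma> \<xi>)) * (\<integral>z. of_real (u0 z) * cis (\<xi> \<bullet> (exp (- t) *\<^sub>R z - x0)) \<partial>lborel) \<partial>lborel)"
  proof (intro Bochner_Integration.integral_cong refl)
    fix \<xi>
    have c1: "cis (\<xi> \<bullet> (x - x0)) = cis (x \<bullet> \<xi>) * cis (- (\<xi> \<bullet> x0))" for x
      unfolding cis_mult by (simp add: inner_diff_right inner_commute)
    have c2: "cis (\<xi> \<bullet> (exp (- t) *\<^sub>R z - x0)) = cis (z \<bullet> (exp (- t) *\<^sub>R \<xi>)) * cis (- (\<xi> \<bullet> x0))" for z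
      unfolding cis_mult by (simp add: inner_diff_right inner_commute)
    have "(\<integral>x. of_real (u t x) * cis (\<xi> \<bullet> (x - x0)) \<partial>lborel) = ftr (u t) \<xi> * cis (- (\<xi> \<bullet> x0))"
      unfolding c1 ft_def mult.assoc[symmetric] by (rule integral_mult_left_zero)
    moreover have "(\<integral>z. of_real (u0 z) * cis (\<xi> \<bullet> (exp (- t) *\<^sub>R z - x0)) \<partial>lborel) = ftr u0 (exp (- t) *\<^sub>R \<xi>) * cis (- (\<xi> \<bullet> x0))"
      unfolding c2 ft_def mult.assoc[symmetric] by (rule integral_mult_left_zero)
    ultimately show "of_real (gauss \<sigma> \<xi>) * (\<integral>x. of_real (u t x) * cis (\<xi> \<bullet> (x - x0)) \<partial>lborel) = (E \<xi> * of_real (gauss \<sigma> \<xi>)) * (\<integral>z. of_real (u0 z) * cis (\<xi> \<bullet> (exp (- t) *\<^sub>R z - x0)) \<partial>lborel)"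
      by (simp add: eq)
  qed
  also have "\<dots> = (\<integral>z. of_real (u0 z) * (\<integral>\<xi>. (E \<xi> * of_real (gauss \<sigma> \<xi>)) * cis (\<xi> \<bullet> (exp (- t) *\<^sub>R z - x0)) \<partial>lborel) \<partial>lborel)"
    by (rule lborel_pair.integral_kernel_swap[OF Eg u0c, where C=1]) auto
  also have "\<dots> = (\<integral>z. of_real (u0 z) * ft (\<lambda>\<xi>. E \<xi> * of_real (gauss \<sigma> \<xi>)) (exp (- t) *\<^sub>R z - x0) \<partial>lborel)" by (simp only: ft_def)
  finally have "(2 * pi) ^ DIM('a) * (\<integral>x. u t x * heat \<sigma> (x - x0) \<partial>lborel) = Re (\<integral>z. of_real (u0 z) * ft (\<lambda>\<xi>. E \<xi> * of_real (gauss \<sigma> \<xi>)) (exp (- t) *\<^sub>R z - x0) \<partial>lborel)"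
    by (metis Re_complex_of_real)
  also have "\<dots> = (\<integral>z. u0 z * Re (ft (\<lambda>\<xi>. E \<xi> * of_real (gauss \<sigma> \<xi>)) (exp (- t) *\<^sub>R z - x0)) \<partial>lborel)"
  proof -
    have fm: "(\<lambda>z. ft (\<lambda>\<xi>. E \<xi> * of_real (gauss \<sigma> \<xi>)) (exp (- t) *\<^sub>R z - x0)) \<in> borel_measurable lborel"
      using borel_measurable_ft[OF Eg] by measurable
    have "integrable lborel (\<lambda>z. of_real (u0 z) * ft (\<lambda>\<xi>. E \<xi> * of_real (gauss \<sigma> \<xi>)) (exp (- t) *\<^sub>R z - x0))"
      using integrable_bounded_mult[OF fm norm_ft_le u0c] by (simp add: mult.commute)
    then show ?thesis by (subst integral_Re[symmetric]) auto
  qed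
  finally show ?thesis .
qed

text \<open>For \<open>z\<close> in the ball of radius \<open>R2\<close> and \<open>x0\<close> in
  that of radius \<open>R1\<close>, the argument \<open>exp (- t) z - x0\<close> has norm at most R1
  + R2, where \<open>L\<close> yields \<open>\<alpha>\<close>. For all other \<open>z\<close>,
  positivity of the full multiplier suffices. The estimate is proved for Gaussian averages, which
  are then tested against continuous functions while \<sigma> \<rightarrow> 0.\<close>

lemma lower_bound:
  assumes t: "0 \<le> t" and u0_nonneg: "\<And>x. 0 \<le> u0 x"
    and L: "integrable lborel L"
    and E: "posm (\<lambda>\<xi>. exp (of_real c * (jump_mult t J UNIV (\<epsilon> *\<^sub>R \<xi>) - of_real t)))"
    and EL: "posm (\<lambda>\<xi>. exp (of_real c * (jump_mult t J UNIV (\<epsilon> *\<^sub>R \<xi>) - of_real t)) - L \<xi>)"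
    and low: "\<And>y. norm y \<le> R1 + R2 \<Longrightarrow> \<alpha> \<le> Re (ft L y)"
  shows "AE x in lborel. x \<in> ball 0 R1 \<longrightarrow> \<alpha> / (2 * pi) ^ DIM('a) * (\<integral>y\<in>ball 0 R2. u0 y \<partial>lborel) \<le> u t x"
proof (rule AE_ge_of_test_functions[OF u_int[OF t]])
  define Em where "Em = (\<lambda>\<xi>. exp (of_real c * (jump_mult t J UNIV (\<epsilon> *\<^sub>R \<xi>) - of_real t)))"
  define U where "U = (\<integral>y\<in>ball 0 R2. u0 y \<partial>lborel)"
  define \<sigma> where "\<sigma> n = 1 / (real n + 1)" for n
  have \<sigma>: "0 < \<sigma> n" for n by (simp add: \<sigma>_def)
  have \<sigma>0: "\<sigma> \<longlonglongrightarrow> 0" unfolding \<sigma>_def using LIMSEQ_inverse_real_of_nat by (simp add: inverse_eq_divide add.commute)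
  have U0: "0 \<le> U" unfolding U_def set_lebesgue_integral_def using u0_nonneg by (intro Bochner_Integration.integral_nonneg) (auto simp: indicator_def)
  have [measurable]: "u0 \<in> borel_measurable borel" "L \<in> borel_measurable borel" "u t \<in> borel_measurable borel"
    using u0 L u_int[OF t] by auto
  have Emm[measurable]: "Em \<in> borel_measurable borel" unfolding Em_def by (rule posm_measurable[OF E])
  obtain B where B: "\<And>\<xi>. cmod (Em \<xi>) \<le> B" using posm_bounded[OF E] unfolding Em_def by blast
  have g: "integrable lborel (\<lambda>\<xi>::'a. complex_of_real (gauss (\<sigma> n) \<xi>))" for n using integrable_gauss[OF \<sigma>, where 'a='a] by simp
  have Eg: "integrable lborel (\<lambda>\<xi>. Em \<xi> * complex_of_real (gauss (\<sigma> n) \<xi>))" for n by (rule integrable_bounded_mult[OF _ B g]) measurable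
  \<comment> \<open>The error of the Gaussian cutoff in the transform of \<open>L\<close>, uniform
    in the point. It vanishes in the limit because \<open>L\<close> is integrable.\<close>
  define \<eta> where "\<eta> n = (\<integral>\<xi>. cmod (L \<xi> * (1 - of_real (gauss (\<sigma> n) \<xi>))) \<partial>lborel)" for n
  have g01: "cmod (1 - complex_of_real (gauss (\<sigma> n) \<xi>)) \<le> 1" for n and \<xi> :: 'a
  proof -
    have "1 - complex_of_real (gauss (\<sigma> n) \<xi>) = of_real (1 - gauss (\<sigma> n) \<xi>)" by simp
    then show ?thesis using gauss_pos[of "\<sigma> n" \<xi>] gauss_le_1[of "\<sigma> n" \<xi>] by (simp only: norm_of_real)
  qed
  have Lg: "integrable lborel (\<lambda>\<xi>. L \<xi> * (1 - of_real (gauss (\<sigma> n) \<xi>)))" for n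
    using integrable_bounded_mult[OF _ g01 L] by (simp add: mult.commute)
  have gl: "(\<lambda>n. gauss (\<sigma> n) \<xi>) \<longlonglongrightarrow> 1" for \<xi> :: 'a
  proof -
    have "(\<lambda>n. gauss (\<sigma> n) \<xi>) \<longlonglongrightarrow> exp (- (0\<^sup>2 * (norm \<xi>)\<^sup>2 / 2))" unfolding gauss_def by (intro tendsto_intros \<sigma>0) auto
    then show ?thesis by simp
  qed
  have \<eta>0: "\<eta> \<longlonglongrightarrow> 0"
  proof -
    have "\<eta> \<longlonglongrightarrow> (\<integral>(\<xi>::'a). cmod (L \<xi> * (1 - of_real 1)) \<partial>lborel)"
      unfolding \<eta>_def
    proof (rule integral_dominated_convergence[where w="\<lambda>\<xi>. cmod (L \<xi>)"])
      show "AE \<xi> in lborel. (\<lambda>n. cmod (L \<xi> * (1 - of_real (gauss (\<sigma> n) \<xi>)))) \<longlonglongrightarrow> cmod (L \<xi> * (1 - of_real 1))"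
        by (intro AE_I2 tendsto_intros gl)
      show "AE \<xi> in lborel. norm (cmod (L \<xi> * (1 - of_real (gauss (\<sigma> n) \<xi>)))) \<le> cmod (L \<xi>)" for n
        using g01 mult_left_mono[OF g01 norm_ge_zero] by (intro AE_I2) (simp add: norm_mult)
    qed (use L in auto)
    then show ?thesis by simp
  qed
  have Eg_nonneg: "0 \<le> Re (ft (\<lambda>\<xi>. Em \<xi> * of_real (gauss (\<sigma> n) \<xi>)) y)" for n y
    unfolding Em_def by (rule posmD[OF E g ft_gauss_nonneg[OF \<sigma>]])
  have Eg_low: "\<alpha> - \<eta> n \<le> Re (ft (\<lambda>\<xi>. Em \<xi> * of_real (gauss (\<sigma> n) \<xi>)) y)" if y: "norm y \<le> R1 + R2" for n y
  proof -
    have d: "0 \<le> Re (ft (\<lambda>\<xi>. (Em \<xi> - L \<xi>) * of_real (gauss (\<sigma> n) \<xi>)) y)"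
      unfolding Em_def by (rule posmD[OF EL g ft_gauss_nonneg[OF \<sigma>]])
    have i2: "integrable lborel (\<lambda>\<xi>. L \<xi> - L \<xi> * (1 - of_real (gauss (\<sigma> n) \<xi>)))" using L Lg by (rule Bochner_Integration.integrable_diff)
    have i1: "integrable lborel (\<lambda>\<xi>. Em \<xi> * of_real (gauss (\<sigma> n) \<xi>))" by (rule Eg)
    have "(\<lambda>\<xi>. (Em \<xi> - L \<xi>) * of_real (gauss (\<sigma> n) \<xi>)) = (\<lambda>\<xi>. Em \<xi> * of_real (gauss (\<sigma> n) \<xi>) - (L \<xi> - L \<xi> * (1 - of_real (gauss (\<sigma> n) \<xi>))))"
      by (auto simp: algebra_simps)
    then have "ft (\<lambda>\<xi>. (Em \<xi> - L \<xi>) * of_real (gauss (\<sigma> n) \<xi>)) y = ft (\<lambda>\<xi>. Em \<xi> * of_real (gauss (\<sigma> n) \<xi>)) y - (ft L y - ft (\<lambda>\<xi>. L \<xi> * (1 - of_real (gauss (\<sigma> n) \<xi>))) y)"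
      using ft_diff[OF i1 i2] ft_diff[OF L Lg] by simp
    moreover have "Re (ft (\<lambda>\<xi>. L \<xi> * (1 - of_real (gauss (\<sigma> n) \<xi>))) y) \<le> \<eta> n"
      unfolding \<eta>_def by (rule order_trans[OF complex_Re_le_cmod norm_ft_le])
    ultimately show ?thesis using d low[OF y] by simp
  qed
  have pt: "(\<alpha> - \<eta> n) * U \<le> (2 * pi) ^ DIM('a) * (\<integral>x. u t x * heat (\<sigma> n) (x - x0) \<partial>lborel)" if x0: "x0 \<in> ball 0 R1" for n x0
  proof -
    have "(\<alpha> - \<eta> n) * U = (\<integral>z. (\<alpha> - \<eta> n) * (indicator (ball 0 R2) z * u0 z) \<partial>lborel)"
      by (simp add: U_def set_lebesgue_integral_def)
    also have "\<dots> \<le> (\<integral>z. u0 z * Re (ft (\<lambda>\<xi>. Em \<xi> * of_real (gauss (\<sigma> n) \<xi>)) (exp (- t) *\<^sub>R z - x0)) \<partial>lborel)"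
    proof (rule integral_mono)
      show "integrable lborel (\<lambda>z. (\<alpha> - \<eta> n) * (indicator (ball 0 R2) z * u0 z))"
        by (intro integrable_mult_right integrable_indicator_mult u0) simp
      have fm: "(\<lambda>z. ft (\<lambda>\<xi>. Em \<xi> * of_real (gauss (\<sigma> n) \<xi>)) (exp (- t) *\<^sub>R z - x0)) \<in> borel_measurable lborel"
        using borel_measurable_ft[OF Eg] by measurable
      have u0c: "integrable lborel (\<lambda>x. complex_of_real (u0 x))" using u0 by simp
      have "integrable lborel (\<lambda>z. Re (ft (\<lambda>\<xi>. Em \<xi> * of_real (gauss (\<sigma> n) \<xi>)) (exp (- t) *\<^sub>R z - x0) * of_real (u0 z)))"
        by (rule integrable_Re[OF integrable_bounded_mult[OF fm norm_ft_le u0c]])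
      then show "integrable lborel (\<lambda>z. u0 z * Re (ft (\<lambda>\<xi>. Em \<xi> * of_real (gauss (\<sigma> n) \<xi>)) (exp (- t) *\<^sub>R z - x0)))"
        by (simp add: mult.commute)
      fix z
      show "(\<alpha> - \<eta> n) * (indicator (ball 0 R2) z * u0 z) \<le> u0 z * Re (ft (\<lambda>\<xi>. Em \<xi> * of_real (gauss (\<sigma> n) \<xi>)) (exp (- t) *\<^sub>R z - x0))"
      proof (cases "z \<in> ball 0 R2")
        case True
        have "norm (exp (- t) *\<^sub>R z - x0) \<le> norm (exp (- t) *\<^sub>R z) + norm x0" by (rule norm_triangle_ineq4)
        also have "norm (exp (- t) *\<^sub>R z) \<le> norm z" using t by (simp add: mult_left_le_one_le)
        finally have "norm (exp (- t) *\<^sub>R z - x0) \<le> R1 + R2" using True x0 by simp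
        from mult_left_mono[OF Eg_low[OF this, of n] u0_nonneg[of z]] show ?thesis using True by (simp add: mult.commute)
      next
        case False
        then show ?thesis using u0_nonneg[of z] Eg_nonneg by simp
      qed
    qed
    also have "\<dots> = (2 * pi) ^ DIM('a) * (\<integral>x. u t x * heat (\<sigma> n) (x - x0) \<partial>lborel)"
      by (rule smoothed_solution[symmetric, OF t \<sigma> Emm B]) (simp add: Em_def ft_solution[OF t])
    finally show ?thesis .
  qed
  fix \<phi> :: "'a \<Rightarrow> real"
  assume \<phi>c: "continuous_on UNIV \<phi>" and \<phi>01: "\<And>x. 0 \<le> \<phi> x" "\<And>x. \<phi> x \<le> 1" and \<phi>0: "\<And>x. x \<notin> ball 0 R1 \<Longrightarrow> \<phi> x = 0"
  have [measurable]: "\<phi> \<in> borel_measurable borel" using \<phi>c by (rule borel_measurable_continuous_onI)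
  have \<phi>i: "integrable lborel \<phi>"
  proof (rule Bochner_Integration.integrable_bound)
    show "integrable lborel (indicat_real (ball (0::'a) R1))"
      by (rule integrable_indicator_bounded) auto
    show "AE x in lborel. norm (\<phi> x) \<le> norm (indicat_real (ball 0 R1) x)"
      using \<phi>01 \<phi>0 by (intro AE_I2) (auto simp: indicator_def)
  qed simp
  define S where "S n x = (\<integral>z. heat (\<sigma> n) z * \<phi> (x - z) \<partial>lborel)" for n x
  have hphi: "integrable lborel (\<lambda>z. heat (\<sigma> n) z * \<phi> (x - z))" for n x
  proof (rule Bochner_Integration.integrable_bound[OF integrable_heat[OF \<sigma>, of n]])
    show "AE z in lborel. norm (heat (\<sigma> n) z * \<phi> (x - z)) \<le> norm (heat (\<sigma> n) z)"
      using \<phi>01 by (intro AE_I2) (simp add: abs_mult mult_left_le)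
  qed simp
  have S01: "0 \<le> S n x" "S n x \<le> 1" for n x
  proof -
    show "0 \<le> S n x" unfolding S_def by (intro Bochner_Integration.integral_nonneg mult_nonneg_nonneg heat_nonneg \<sigma> \<phi>01)
    have "S n x \<le> (\<integral>(z::'a). heat (\<sigma> n) z \<partial>lborel)" unfolding S_def
      by (intro integral_mono hphi integrable_heat \<sigma> mult_left_le \<phi>01 heat_nonneg)
    then show "S n x \<le> 1" using integral_heat[OF \<sigma>, of n, where 'a='a] by simp
  qed
  have Sm[measurable]: "S n \<in> borel_measurable borel" for n unfolding S_def[abs_def] by measurable
  have swap: "(\<integral>x0. \<phi> x0 * (\<integral>x. u t x * heat (\<sigma> n) (x - x0) \<partial>lborel) \<partial>lborel) = (\<integral>x. u t x * S n x \<partial>lborel)"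
    and swap_int: "integrable lborel (\<lambda>x0. \<phi> x0 * (\<integral>x. u t x * heat (\<sigma> n) (x - x0) \<partial>lborel))" for n
  proof -
    define Ch where "Ch = 1 / (sqrt (2 * pi) * \<sigma> n) ^ DIM('a)"
    have hb: "\<bar>heat (\<sigma> n) y\<bar> \<le> Ch" for y :: 'a
      unfolding heat_def Ch_def using gauss_pos[of "1 / \<sigma> n" y] gauss_le_1[of "1 / \<sigma> n" y] \<sigma>[of n]
      by (simp add: abs_of_pos divide_right_mono)
    have int: "integrable (lborel \<Otimes>\<^sub>M lborel) (\<lambda>(x0, x). \<phi> x0 * u t x * heat (\<sigma> n) (x - x0))"
    proof -
      have "integrable (lborel \<Otimes>\<^sub>M lborel) (\<lambda>(x0, x). complex_of_real (\<phi> x0) * complex_of_real (u t x) * complex_of_real (heat (\<sigma> n) (x - x0)))"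
        by (rule lborel_pair.integrable_kernel[where C=Ch]) (use \<phi>i u_int[OF t] hb in \<open>auto\<close>)
      then have "integrable (lborel \<Otimes>\<^sub>M lborel) (\<lambda>p. complex_of_real (\<phi> (fst p) * u t (snd p) * heat (\<sigma> n) (snd p - fst p)))"
        by (simp add: split_beta')
      then show ?thesis by (simp only: complex_of_real_integrable_eq split_beta')
    qed
    have e1: "(\<integral>x. \<phi> x0 * u t x * heat (\<sigma> n) (x - x0) \<partial>lborel) = \<phi> x0 * (\<integral>x. u t x * heat (\<sigma> n) (x - x0) \<partial>lborel)" for x0
      by (simp only: mult.assoc integral_mult_right_zero)
    show "integrable lborel (\<lambda>x0. \<phi> x0 * (\<integral>x. u t x * heat (\<sigma> n) (x - x0) \<partial>lborel))"
      using lborel_pair.integrable_fst'[OF int] by (simp only: prod.case e1)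
    have e2: "(\<integral>x0. \<phi> x0 * u t x * heat (\<sigma> n) (x - x0) \<partial>lborel) = u t x * S n x" for x
    proof -
      have "(\<integral>x0. \<phi> x0 * u t x * heat (\<sigma> n) (x - x0) \<partial>lborel) = u t x * (\<integral>x0. heat (\<sigma> n) (x - x0) * \<phi> x0 \<partial>lborel)"
        by (subst integral_mult_right_zero[symmetric]) (simp add: mult_ac)
      also have "(\<integral>x0. heat (\<sigma> n) (x - x0) * \<phi> x0 \<partial>lborel) = S n x"
        unfolding S_def by (subst integral_lborel_reflect[where t=x, symmetric]) auto
      finally show ?thesis .
    qed
    show "(\<integral>x0. \<phi> x0 * (\<integral>x. u t x * heat (\<sigma> n) (x - x0) \<partial>lborel) \<partial>lborel) = (\<integral>x. u t x * S n x \<partial>lborel)"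
      using lborel_pair.Fubini_integral[OF int] unfolding e1 e2 by simp
  qed
  have ineq: "(\<alpha> - \<eta> n) * U * (\<integral>x. \<phi> x \<partial>lborel) \<le> (2 * pi) ^ DIM('a) * (\<integral>x. u t x * S n x \<partial>lborel)" for n
  proof -
    have "(\<integral>x0. (\<alpha> - \<eta> n) * U * \<phi> x0 \<partial>lborel) \<le> (\<integral>x0. (2 * pi) ^ DIM('a) * (\<phi> x0 * (\<integral>x. u t x * heat (\<sigma> n) (x - x0) \<partial>lborel)) \<partial>lborel)"
    proof (rule integral_mono)
      show "integrable lborel (\<lambda>x0. (\<alpha> - \<eta> n) * U * \<phi> x0)" using \<phi>i by auto
      show "integrable lborel (\<lambda>x0. (2 * pi) ^ DIM('a) * (\<phi> x0 * (\<integral>x. u t x * heat (\<sigma> n) (x - x0) \<partial>lborel)))"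
        by (intro integrable_mult_right swap_int)
      fix x0
      show "(\<alpha> - \<eta> n) * U * \<phi> x0 \<le> (2 * pi) ^ DIM('a) * (\<phi> x0 * (\<integral>x. u t x * heat (\<sigma> n) (x - x0) \<partial>lborel))"
      proof (cases "x0 \<in> ball 0 R1")
        case True
        from mult_right_mono[OF pt[OF True, of n] \<phi>01(1)[of x0]] show ?thesis by (simp only: mult_ac)
      next
        case False then show ?thesis using \<phi>0[OF False] by simp
      qed
    qed
    then show ?thesis by (simp only: integral_mult_right_zero swap)
  qed
  have Sl: "(\<lambda>n. \<integral>x. u t x * S n x \<partial>lborel) \<longlonglongrightarrow> (\<integral>x. u t x * \<phi> x \<partial>lborel)"
  proof (rule integral_dominated_convergence[where w="\<lambda>x. \<bar>u t x\<bar>"])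
    show "AE x in lborel. (\<lambda>n. u t x * S n x) \<longlonglongrightarrow> u t x * \<phi> x"
    proof (rule AE_I2)
      fix x
      have "(\<lambda>n. S n x) \<longlonglongrightarrow> \<phi> x"
        unfolding S_def using heat_approx_identity[OF \<phi>c, of 1 \<sigma> x] \<phi>01 \<sigma> \<sigma>0 by simp
      then show "(\<lambda>n. u t x * S n x) \<longlonglongrightarrow> u t x * \<phi> x" by (intro tendsto_intros)
    qed
    show "AE x in lborel. norm (u t x * S n x) \<le> \<bar>u t x\<bar>" for n
      using S01 by (intro AE_I2) (simp add: abs_mult mult_left_le)
  qed (use u_int[OF t] in auto)
  have "(\<alpha> - 0) * U * (\<integral>x. \<phi> x \<partial>lborel) \<le> (2 * pi) ^ DIM('a) * (\<integral>x. u t x * \<phi> x \<partial>lborel)"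
  proof (rule LIMSEQ_le)
    show "(\<lambda>n. (\<alpha> - \<eta> n) * U * (\<integral>x. \<phi> x \<partial>lborel)) \<longlonglongrightarrow> (\<alpha> - 0) * U * (\<integral>x. \<phi> x \<partial>lborel)" by (intro tendsto_intros \<eta>0)
    show "(\<lambda>n. (2 * pi) ^ DIM('a) * (\<integral>x. u t x * S n x \<partial>lborel)) \<longlonglongrightarrow> (2 * pi) ^ DIM('a) * (\<integral>x. u t x * \<phi> x \<partial>lborel)" by (intro tendsto_intros Sl)
  qed (use ineq in auto)
  moreover have "0 < (2 * pi) ^ DIM('a)" by simp
  ultimately show "\<alpha> / (2 * pi) ^ DIM('a) * (\<integral>y\<in>ball 0 R2. u0 y \<partial>lborel) * (\<integral>x. \<phi> x \<partial>lborel) \<le> (\<integral>x. u t x * \<phi> x \<partial>lborel)"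
    unfolding U_def by (simp add: pos_divide_le_eq mult_ac)
qed

end

section \<open>From the hypothesis on the family to uniform constants\<close>

lemma H1_jump_kernel:
  fixes J :: "real \<Rightarrow> 'a::euclidean_space \<Rightarrow> real"
  assumes H1: "H1 J" and t: "0 < t"
  shows "\<exists>r0 \<kappa> A a (S::'a set) C0 \<delta>. 0 < \<delta> \<and> jump_consts t r0 \<kappa> A a S \<and> (\<forall>s\<in>{1/2<..<1}. jump_kernel t r0 \<kappa> A a S (J s) s C0 \<delta>)"
proof -
  obtain \<delta> C0 where \<delta>: "0 < \<delta>" and C0: "0 < C0"
    and ex: "\<And>s \<xi>. s \<in> {1/2<..<1} \<Longrightarrow> norm (\<xi>::'a) \<le> 1 \<Longrightarrow> cmod (fourier (J s) \<xi> - complex_of_real (1 - norm \<xi> powr (2 * s))) \<le> C0 * norm \<xi> powr (2 * s + \<delta>)"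
    using H1 unfolding H1_def by blast
  \<comment> \<open>The solution of \<open>C0 * r0 powr \<delta> = 1/2\<close>, capped at 1, the
    radius on which the expansion is given.\<close>
  define r0 where "r0 = min 1 ((1 / (2 * C0)) powr (1 / \<delta>))"
  have r0: "0 < r0" "r0 \<le> 1" using C0 by (auto simp: r0_def)
  have r0\<delta>: "C0 * r0 powr \<delta> \<le> 1/2"
  proof -
    have "r0 powr \<delta> \<le> ((1 / (2 * C0)) powr (1 / \<delta>)) powr \<delta>" using \<delta> r0 by (intro powr_mono2) (auto simp: r0_def)
    also have "\<dots> = 1 / (2 * C0)" using \<delta> C0 by (simp add: powr_powr)
    finally show ?thesis using C0 by (simp add: field_simps)
  qed
  obtain \<kappa> A a and S :: "'a set" where c: "jump_consts t r0 \<kappa> A a S" using jump_consts_exist[OF t r0] by blast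
  have "jump_kernel t r0 \<kappa> A a S (J s) s C0 \<delta>" if s: "s \<in> {1/2<..<1}" for s
  proof -
    interpret jump_consts t r0 \<kappa> A a S by (rule c)
    show ?thesis
    proof
      show "prob_density (J s)" using H1 s unfolding H1_def by blast
      show "cmod (ftr (J s) \<xi> - of_real (1 - norm \<xi> powr (2 * s))) \<le> C0 * norm \<xi> powr (2 * s + \<delta>)" if "norm \<xi> \<le> 1" for \<xi>
      proof -
        \<comment> \<open>The opposite sign conventions are reconciled by reflecting \<xi>, since
          the expansion depends on \<open>norm \<xi>\<close> only.\<close>
        have "fourier (J s) (- \<xi>) = ftr (J s) \<xi>" by (simp add: fourier_def ft_def mult.commute)
        then show ?thesis using ex[OF s, of "- \<xi>"] that by simp
      qed
    qed (use s C0 \<delta> r0\<delta> in auto)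
  qed
  then show ?thesis using c \<delta> by blast
qed

theorem theorem3p5:
  fixes J :: "real \<Rightarrow> 'a::euclidean_space \<Rightarrow> real" and k :: real
  assumes "H1 J" and "0 < k" and "k < 1"
  shows "\<forall>t>0. \<forall>R1>0. \<forall>R2>0. \<exists>\<alpha>>0.
           \<forall>\<epsilon>\<in>{0<..1}. \<forall>s\<in>{1/2<..<1}. \<forall>u0 u.
             prob_density u0 \<longrightarrow> in_L1k k u0 \<longrightarrow> mild_solution k \<epsilon> s (J s) u0 u \<longrightarrow>
             (AE x in lborel. x \<in> ball 0 R1 \<longrightarrow>
                u t x \<ge> \<alpha> * (\<integral>y\<in>ball 0 R2. u0 y \<partial>lborel))"
proof (intro allI impI)
  fix t R1 R2 :: real
  assume t: "0 < t" and R: "0 < R1" "0 < R2"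
  obtain r0 \<kappa> A a C0 \<delta> and S :: "'a set" where \<delta>: "0 < \<delta>" and cns: "jump_consts t r0 \<kappa> A a S"
    and kern: "\<And>s. s \<in> {1/2<..<1} \<Longrightarrow> jump_kernel t r0 \<kappa> A a S (J s) s C0 \<delta>"
    using H1_jump_kernel[OF assms(1) t] by blast
  \<comment> \<open>For each \<open>s\<close> the kernel \<open>J s\<close> itself is used to
    approximate the stable law of that index.\<close>
  have nn: "0 \<le> Re (ftr (stab (1/2) t s) (x::'a))" if "1/2 < s" "s < 1" for s x
    using jump_kernel.stab_ft_nonneg[OF kern[of s], of "1/2"] that by simp
  obtain \<alpha>0 where \<alpha>0: "0 < \<alpha>0" "\<And>s x. 1/2 \<le> s \<Longrightarrow> s \<le> 1 \<Longrightarrow> norm (x::'a) \<le> 2 * (R1 + R2) \<Longrightarrow> \<alpha>0 \<le> Re (ftr (stab 1 t s) x)"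
    using stab_ft_pos_uniform[OF t nn, of "2 * (R1 + R2)"] by blast
  have R0: "0 \<le> R1 + R2" using R by simp
  obtain \<alpha> where \<alpha>: "0 < \<alpha>" and low: "\<And>J s \<epsilon>. jump_kernel t r0 \<kappa> A a S J s C0 \<delta> \<Longrightarrow> 0 < \<epsilon> \<Longrightarrow> \<epsilon> \<le> 1 \<Longrightarrow>
    (\<exists>L. integrable lborel L \<and> posm (\<lambda>\<xi>. exp (of_real (\<epsilon> powr (- 2 * s)) * (jump_mult t J UNIV (\<epsilon> *\<^sub>R \<xi>) - of_real t)) - L \<xi>)
      \<and> (\<forall>y. norm y \<le> R1 + R2 \<longrightarrow> \<alpha> \<le> Re (ft L y)))"
    using jump_consts.uniform_lower[OF cns \<delta> \<alpha>0(1) R0 \<alpha>0(2)] by blast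
  show "\<exists>\<alpha>>0. \<forall>\<epsilon>\<in>{0<..1}. \<forall>s\<in>{1/2<..<1}. \<forall>u0 u.
             prob_density u0 \<longrightarrow> in_L1k k u0 \<longrightarrow> mild_solution k \<epsilon> s (J s) u0 u \<longrightarrow>
             (AE x in lborel. x \<in> ball 0 R1 \<longrightarrow> u t x \<ge> \<alpha> * (\<integral>y\<in>ball 0 R2. u0 y \<partial>lborel))"
  \<comment> \<open>The power of 2 pi comes from Fourier inversion. \<open>\<alpha>\<close> was
    obtained before \<epsilon>, \<open>s\<close> and the datum are introduced, whence the
    uniformity.\<close>
  proof (intro exI[of _ "\<alpha> / (2 * pi) ^ DIM('a)"] conjI ballI allI impI)
    show "0 < \<alpha> / (2 * pi) ^ DIM('a)" using \<alpha> by simp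
    fix \<epsilon> s u0 u
    assume \<epsilon>: "\<epsilon> \<in> {0<..1}" and s: "s \<in> {1/2<..<1}" and ic: "prob_density u0" and ms: "mild_solution k \<epsilon> s (J s) u0 u"
    have e: "0 < \<epsilon>" "\<epsilon> \<le> 1" using \<epsilon> by auto
    interpret jk: jump_kernel t r0 \<kappa> A a S "J s" s C0 \<delta> by (rule kern[OF s])
    interpret mild k \<epsilon> s "J s" u0 u
      by unfold_locales (use ms assms(2) e jk.J_int prob_densityD[OF ic] in auto)
    obtain L where L: "integrable lborel L" "posm (\<lambda>\<xi>. exp (of_real (\<epsilon> powr (- 2 * s)) * (jump_mult t (J s) UNIV (\<epsilon> *\<^sub>R \<xi>) - of_real t)) - L \<xi>)"
      "\<And>y. norm y \<le> R1 + R2 \<Longrightarrow> \<alpha> \<le> Re (ft L y)"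
      using low[OF kern[OF s] e] by blast
    have "posm (\<lambda>\<xi>. of_real (exp (- (\<epsilon> powr (- 2 * s) * t))) * exp (of_real (\<epsilon> powr (- 2 * s)) * jump_mult t (J s) UNIV (\<epsilon> *\<^sub>R \<xi>)))"
      by (intro posm_scale posm_exp jk.posm_jump) auto
    moreover have "of_real (exp (- (c * t))) * exp (of_real c * z) = exp (of_real c * (z - of_real t))" for c :: real and z :: complex
      by (simp add: exp_of_real[symmetric] exp_add[symmetric] algebra_simps flip: exp_of_real)
    ultimately have E: "posm (\<lambda>\<xi>. exp (of_real (\<epsilon> powr (- 2 * s)) * (jump_mult t (J s) UNIV (\<epsilon> *\<^sub>R \<xi>) - of_real t)))"
      by simp
    show "AE x in lborel. x \<in> ball 0 R1 \<longrightarrow> \<alpha> / (2 * pi) ^ DIM('a) * (\<integral>y\<in>ball 0 R2. u0 y \<partial>lborel) \<le> u t x"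
      by (rule lower_bound[OF _ _ L(1) E L(2) L(3)]) (use t prob_densityD[OF ic] in auto)
  qed
qed

end
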